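(* Let $m\in\mathbf{N}=\{0,1,2,\dots\}$. Let $\omega$ be a smooth $\mathbf{S}^1$-invariant volume form on $\mathbf{P}^1$ with $\int_{\mathbf{P}^1}\omega=1$, and let $h$ be a smooth $\mathbf{S}^1$-invariant hermitian metric on $\mathcal{O}(m)$. Suppose that $$1<\frac{\overline{h}_\omega(x)}{\min(1,2(1-x))^m}<\frac{2\min(x,1-x)}{\overline{g}_\omega(x)}\qquad\text{for all } x\in\,]0,1[ .$$ Then the invariant eigenvalues $0=\lambda_0(\omega,h)<\lambda_1(\omega,h)<\lambda_2(\omega,h)<\cdots$ of $\Delta_{\omega,h}$ satisfy $$\lambda_j(\omega,h)<\frac{\xi_{m,j}^2}{2},\qquad j=1,2,\ldots,$$ where $0<\xi_{m,1}<\xi_{m,2}<\cdots$ are the positive zeros of the function $z\mapsto \frac{d}{dz}\bigl(z^{-m}J_0(z)J_m(z)\bigr)$ and $J_n$ is the Bessel function (of the first kind) of order $n$. Moreover, these bounds are optimal: for every $m\in\mathbf{N}$ and every $j\ge 1$, the supremum of $\lambda_j(\omega,h)$ over all pairs $(\omega,h)$ consisting of a smooth $\mathbf{S}^1$-invariant volume form $\omega$ on $\mathbf{P}^1$ with $\int_{\mathbf{P}^1}\omega=1$ and a smooth $\mathbf{S}^1$-invariant hermitian metric $h$ on $\mathcal{O}(m)$ such that $1<\frac{\overline{h}_\omega(x)}{\min(1,2(1-x))^m}<\frac{2\min(x,1-x)}{\overline{g}_\omega(x)}$ for all $x\in\,]0,1[$ equals $\xi_{m,j}^2/2$.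
   Context: Coordinates. $[x_0:x_1]$ are homogeneous coordinates on $\mathbf{P}^1$ (the complex projective line), $z=x_1/x_0$ is the affine coordinate on $\mathbf{C}=\{x_0\neq 0\}$. $\mathbf{S}^1$ acts by $z\mapsto e^{i\theta}z$; "invariant" means $\mathbf{S}^1$-invariant. Volume forms are positive everywhere. On $\mathbf{C}^\ast$ write $z=e^{-u}e^{i\theta}$ with $u\in\mathbf{R}$, $\theta\in\mathbf{R}/2\pi\mathbf{Z}$. The global section $x_0^m$ of $\mathcal{O}(m)$ is denoted $1$. Symplectic coordinates. Let $\omega$ be an invariant volume form of total mass $1$. There is an invariant hermitian metric $\|\cdot\|_\omega$ on $\mathcal{O}(1)$ with $c_1(\mathcal{O}(1),\|\cdot\|_\omega)=\omega$; put $F_\omega(u)=\log\|1\|_\omega(e^{-u})$, where here $1=x_0$. Then $\omega$ has density $-\frac{1}{2\pi}F_\omega''(u)$ with respect to the measure $du\,d\theta$ on $\mathbf{C}^\ast$, $F_\omega$ is strictly concave, and $F_\omega'$ is a decreasing bijection from $\mathbf{R}$ onto $]0,1[$ with $F_\omega'(+\infty)=0$, $F_\omega'(-\infty)=1$ (equivalently $F'_\omega(u)=\omega(\{|z|<e^{-u}\})$). Let $G_\omega:\,]0,1[\to\mathbf{R}$ be the inverse of $F_\omega'$, and set $$\overline{g}_\omega(x)=\frac{1}{-G_\omega'(x)}=-F_\omega''(G_\omega(x)),\qquad x\in\,]0,1[ .$$ For an invariant hermitian metric $h$ on $\mathcal{O}(m)$ set $\overline{h}_\omega(x)=h(1,1)(e^{-G_\omega(x)})$,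 $x\in\,]0,1[$, i.e. $h(1,1)$ evaluated at the point $z=e^{-G_\omega(x)}$. Laplacian. $A^{(0,q)}(\mathbf{P}^1,\mathcal{O}(m))$ denotes the space of smooth $(0,q)$-forms with values in $\mathcal{O}(m)$. On $A^{(0,0)}$ use the $L^2$ product $(s,t)_{\omega,h}=\int_{\mathbf{P}^1}h(s,t)\,\omega$; on $A^{(0,1)}$ use the product whose square norm on $\overline\partial s$ is $\frac{i}{2\pi}\int h\bigl(\frac{\partial s}{\partial\overline z},\frac{\partial s}{\partial\overline z}\bigr)dz\wedge d\overline z$. Then $\Delta_{\omega,h}=\overline\partial^\ast_{\mathcal{O}(m)}\overline\partial_{\mathcal{O}(m)}$ acting on $A^{(0,0)}(\mathbf{P}^1,\mathcal{O}(m))$; it has a self-adjoint extension with discrete nonnegative spectrum. An invariant element of $A^{(0,0)}(\mathbf{P}^1,\mathcal{O}(m))$ is one of the form $f\otimes 1$ on $\mathbf{C}$ with $f$ an $\mathbf{S}^1$-invariant function. The invariant eigenvalues are the eigenvalues of $\Delta_{\omega,h}$ that admit a nonzero invariant eigensection, listed in increasing order $0=\lambda_0(\omega,h)<\lambda_1(\omega,h)<\cdots$. *)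

theory Defs
  imports "HOL-Analysis.Analysis"
begin

section \<open>Smooth functions on the complex plane\<close>

primrec C_k :: "nat \<Rightarrow> ('a::euclidean_space \<Rightarrow> 'b::real_normed_vector) \<Rightarrow> bool" where
  "C_k 0 f \<longleftrightarrow> continuous_on UNIV f"
| "C_k (Suc k) f \<longleftrightarrow> (\<forall>x. f differentiable (at x)) \<and>
     (\<forall>v. C_k k (\<lambda>x. frechet_derivative f (at x) v))"

definition smooth :: "('a::euclidean_space \<Rightarrow> 'b::real_normed_vector) \<Rightarrow> bool" where
  "smooth f \<longleftrightarrow> (\<forall>k. C_k k f)"

definition d_z :: "(complex \<Rightarrow> complex) \<Rightarrow> complex \<Rightarrow> complex" where
  "d_z f p = (frechet_derivative f (at p) 1 - \<i> * frechet_derivative f (at p) \<i>) / 2"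

definition d_zbar :: "(complex \<Rightarrow> complex) \<Rightarrow> complex \<Rightarrow> complex" where
  "d_zbar f p = (frechet_derivative f (at p) 1 + \<i> * frechet_derivative f (at p) \<i>) / 2"


section \<open>Objects on the projective line\<close>

text \<open>
  The projective line is glued from two copies of the complex plane, with affine coordinates
  z = x1/x0 and w = x0/x1 = 1/z.  A global object is the pair of its expressions in the
  z-chart (first component) and the w-chart (second component), which have to match where both
  charts are defined.  The line bundle O(m) is trivialised by the global sections x0^m (the
  section denoted 1) on the z-chart and x1^m on the w-chart; on the overlap x1^m = z^m x0^m.
\<close>

type_synonym 'a charts = "(complex \<Rightarrow> 'a) \<times> (complex \<Rightarrow> 'a)"

text \<open>
  A volume form is given by its densities with respect to dx dy = (i/2) dz dzbar, respectively
  (i/2) dw dwbar; since dw = - dz / z^2, the densities differ by the factor |z|^4.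
\<close>

definition volume_form :: "real charts \<Rightarrow> bool" where
  "volume_form \<omega> \<longleftrightarrow> smooth (fst \<omega>) \<and> smooth (snd \<omega>) \<and>
     (\<forall>z. fst \<omega> z > 0) \<and> (\<forall>w. snd \<omega> w > 0) \<and>
     (\<forall>z. z \<noteq> 0 \<longrightarrow> fst \<omega> z = snd \<omega> (1 / z) / cmod z ^ 4)"

text \<open>The point at infinity is a null set, so integrals are taken over the z-chart.\<close>

definition total_mass :: "real charts \<Rightarrow> real" where
  "total_mass \<omega> = (LINT z|lborel. fst \<omega> z)"

text \<open>
  A hermitian metric h on O(m) is given by h(x0^m, x0^m) on the z-chart and by h(x1^m, x1^m) on
  the w-chart.
\<close>

definition hermitian_metric :: "nat \<Rightarrow> real charts \<Rightarrow> bool" where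
  "hermitian_metric m h \<longleftrightarrow> smooth (fst h) \<and> smooth (snd h) \<and>
     (\<forall>z. fst h z > 0) \<and> (\<forall>w. snd h w > 0) \<and>
     (\<forall>z. z \<noteq> 0 \<longrightarrow> snd h (1 / z) = cmod z ^ (2 * m) * fst h z)"

text \<open>
  A smooth section of O(m) is given by its coefficients f, g in f x0^m = g x1^m.
\<close>

definition smooth_section :: "nat \<Rightarrow> complex charts \<Rightarrow> bool" where
  "smooth_section m s \<longleftrightarrow> smooth (fst s) \<and> smooth (snd s) \<and>
     (\<forall>z. z \<noteq> 0 \<longrightarrow> fst s z = z ^ m * snd s (1 / z))"

text \<open>
  Invariance under the circle action z \<mapsto> exp(i t) z.  For volume forms and hermitian metrics
  invariance of the z-chart component determines everything by continuity.  For sections,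
  invariance means by definition that the coefficient with respect to x0^m is an invariant
  function; the coefficient with respect to x1^m is then not invariant when m > 0.
\<close>

definition S1_invariant :: "'a charts \<Rightarrow> bool" where
  "S1_invariant a \<longleftrightarrow> (\<forall>t z. fst a (cis t * z) = fst a z)"


section \<open>Symplectic coordinates\<close>

text \<open>
  First Chern form -(i/(2 pi)) d dbar log k of a hermitian metric k, written as densities with
  respect to (i/2) dz dzbar and (i/2) dw dwbar.
\<close>

definition chern_form :: "real charts \<Rightarrow> complex charts" where
  "chern_form k =
     (\<lambda>z. - d_z (d_zbar (\<lambda>p. complex_of_real (ln (fst k p)))) z / complex_of_real pi,
      \<lambda>w. - d_z (d_zbar (\<lambda>p. complex_of_real (ln (snd k p)))) w / complex_of_real pi)"

text \<open>
  The metric on O(1) with Chern form \<omega> is unique only up to a positive constant factor.  Another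
  choice changes F by an additive constant, and only the derivative of F is used below.
\<close>

definition polarization :: "real charts \<Rightarrow> real charts" where
  "polarization \<omega> = (SOME k. hermitian_metric 1 k \<and> S1_invariant k \<and>
     chern_form k = (\<lambda>z. complex_of_real (fst \<omega> z), \<lambda>w. complex_of_real (snd \<omega> w)))"

definition F_sym :: "real charts \<Rightarrow> real \<Rightarrow> real" where
  "F_sym \<omega> u = ln (sqrt (fst (polarization \<omega>) (complex_of_real (exp (- u)))))"

definition G_sym :: "real charts \<Rightarrow> real \<Rightarrow> real" where
  "G_sym \<omega> = inv_into UNIV (deriv (F_sym \<omega>))"

definition g_bar :: "real charts \<Rightarrow> real \<Rightarrow> real" where
  "g_bar \<omega> x = 1 / (- deriv (G_sym \<omega>) x)"

definition h_bar :: "real charts \<Rightarrow> real charts \<Rightarrow> real \<Rightarrow> real" where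
  "h_bar \<omega> h x = fst h (complex_of_real (exp (- G_sym \<omega> x)))"


section \<open>The Laplacian and its invariant eigenvalues\<close>

definition inner_00 :: "real charts \<Rightarrow> real charts \<Rightarrow> complex charts \<Rightarrow> complex charts \<Rightarrow> complex" where
  "inner_00 \<omega> h s t =
     (LINT z|lborel. complex_of_real (fst h z) * fst s z * cnj (fst t z) * complex_of_real (fst \<omega> z))"

text \<open>
  (0,1)-forms with values in O(m) are given by their coefficients with respect to
  dzbar x0^m and dwbar x1^m.
\<close>

definition dbar :: "complex charts \<Rightarrow> complex charts" where
  "dbar s = (d_zbar (fst s), d_zbar (snd s))"

text \<open>The factor 1/pi comes from (i/(2 pi)) dz dzbar = (1/pi) dx dy.\<close>

definition inner_01 :: "real charts \<Rightarrow> complex charts \<Rightarrow> complex charts \<Rightarrow> complex" where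
  "inner_01 h a b =
     (LINT z|lborel. complex_of_real (fst h z) * fst a z * cnj (fst b z)) / complex_of_real pi"

definition dbar_adjoint :: "nat \<Rightarrow> real charts \<Rightarrow> real charts \<Rightarrow> complex charts \<Rightarrow> complex charts" where
  "dbar_adjoint m \<omega> h a = (THE t. smooth_section m t \<and>
     (\<forall>v. smooth_section m v \<longrightarrow> inner_00 \<omega> h t v = inner_01 h a (dbar v)))"

definition laplacian :: "nat \<Rightarrow> real charts \<Rightarrow> real charts \<Rightarrow> complex charts \<Rightarrow> complex charts" where
  "laplacian m \<omega> h s = dbar_adjoint m \<omega> h (dbar s)"

definition invariant_spectrum :: "nat \<Rightarrow> real charts \<Rightarrow> real charts \<Rightarrow> real set" where
  "invariant_spectrum m \<omega> h = {l. \<exists>s. smooth_section m s \<and> S1_invariant s \<and>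
     s \<noteq> (\<lambda>z. 0, \<lambda>w. 0) \<and>
     laplacian m \<omega> h s = (\<lambda>z. complex_of_real l * fst s z, \<lambda>w. complex_of_real l * snd s w)}"

definition increasing_listing :: "(nat \<Rightarrow> real) \<Rightarrow> real set \<Rightarrow> bool" where
  "increasing_listing a S \<longleftrightarrow> strict_mono a \<and> range a = S"

definition invariant_eigenvalue :: "nat \<Rightarrow> real charts \<Rightarrow> real charts \<Rightarrow> nat \<Rightarrow> real" where
  "invariant_eigenvalue m \<omega> h = (THE a. increasing_listing a (invariant_spectrum m \<omega> h))"


section \<open>Bessel functions\<close>

definition bessel_J :: "nat \<Rightarrow> real \<Rightarrow> real" where
  "bessel_J n x = (\<Sum>k. (- 1) ^ k / (fact k * fact (k + n)) * (x / 2) ^ (2 * k + n))"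

definition xi_zeros :: "nat \<Rightarrow> real set" where
  "xi_zeros m = {x. x > 0 \<and> deriv (\<lambda>z. z powi (- int m) * bessel_J 0 z * bessel_J m z) x = 0}"

text \<open>The zeros are numbered from 1; the value at index 0 is irrelevant.\<close>

definition xi :: "nat \<Rightarrow> nat \<Rightarrow> real" where
  "xi m j = (THE a. increasing_listing a (xi_zeros m)) (j - 1)"


section \<open>The pairs under consideration\<close>

definition pinched :: "nat \<Rightarrow> real charts \<Rightarrow> real charts \<Rightarrow> bool" where
  "pinched m \<omega> h \<longleftrightarrow> (\<forall>x. 0 < x \<and> x < 1 \<longrightarrow>
     1 < h_bar \<omega> h x / (min 1 (2 * (1 - x))) ^ m \<and>
     h_bar \<omega> h x / (min 1 (2 * (1 - x))) ^ m < 2 * min x (1 - x) / g_bar \<omega> x)"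

definition admissible_pairs :: "nat \<Rightarrow> (real charts \<times> real charts) set" where
  "admissible_pairs m = {(\<omega>, h).
     volume_form \<omega> \<and> S1_invariant \<omega> \<and> total_mass \<omega> = 1 \<and>
     hermitian_metric m h \<and> S1_invariant h \<and> pinched m \<omega> h}"

end

theory Submission
  imports Defs
begin

text \<open>
  In the symplectic coordinate \<open>x\<close>, invariant eigensections are the solutions of
  \<open>(p f')' = - \<lambda> w f\<close> with \<open>p = h g / 2\<close> and \<open>w = h\<close> that are regular at both poles \<open>x = 0, 1\<close>. Let
  \<open>\<alpha>\<close> and \<open>\<beta>\<close> be the Pruefer angles at \<open>x = 1/2\<close> of the solutions regular at \<open>0\<close> and at \<open>1\<close>. The sum
  \<open>\<alpha> + \<beta>\<close> increases from \<open>0\<close> to infinity with \<open>\<lambda> \<ge> 0\<close>, and \<open>\<lambda>\<close> is an eigenvalue iff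
  \<open>\<alpha> + \<beta>\<close> is a multiple of \<open>\<pi>\<close>. The pinching condition says that \<open>w > w0\<close> and \<open>p < p0\<close>, where
  \<open>w0 = min(1, 2(1-x))\<^sup>m\<close> and \<open>p0 = min(x, 1-x) w0\<close>, so the angles exceed those of the limit
  problem \<open>(p0, w0)\<close>. The latter is a pair of Bessel equations of orders \<open>0\<close> and \<open>m\<close>, which match at
  \<open>x = 1/2\<close> iff \<open>\<xi> = \<surd>(2\<lambda>)\<close> is a critical point of \<open>z\<^sup>-\<^sup>m J\<^sub>0(z) J\<^sub>m(z)\<close>. Conversely, if
  \<open>p \<ge> p0 / \<rho>\<close> and \<open>w \<le> \<rho> w0\<close>, the same comparison bounds the eigenvalues below by those of the
  limit problem divided by \<open>\<rho>\<^sup>2\<close>, and \<open>\<rho>\<close> can be taken arbitrarily close to \<open>1\<close>.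
\<close>

section \<open>Sturm comparison for singular problems\<close>

text \<open>The main obstacle is the singularity at the poles: 1/p is not integrable there, so the
  Pruefer equation is not Lipschitz at its starting point, and a comparison from equal initial
  values needs an argument. It is rescued by the angles themselves, which vanish at the pole at the
  rate at which the coefficient blows up. A second tension is between coordinates. Smoothness of
  sections and metrics lives in s = |z|^2, whereas the limit problem has a fixed form only in x. The
  regular solutions and their angles are therefore constructed in s, and the passage to x is made at
  the level of the angle equations, where it is a mere reparametrisation. Angles also replace
  spectral theory: the eigenvalues solve a scalar equation with a strictly increasing left hand
  side, so enumeration and strict comparison need no compactness of resolvents. For optimality the
  difficulty is that the window left by the pinching condition closes at both poles. A smooth metric
  close to w0 must approach it there to a prescribed order, which dictates the powers in the
  construction.\<close>

lemma deriv_nonpos_imp_nonincreasing_open: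
  fixes f :: "real \<Rightarrow> real"
  assumes ab: "a \<le> b" and cont: "continuous_on {a..b} f"
    and d: "\<And>x. a < x \<Longrightarrow> x < b \<Longrightarrow> \<exists>y. (f has_real_derivative y) (at x) \<and> y \<le> 0"
  shows "f b \<le> f a"
proof (cases "a = b")
  case False
  then have lt: "a < b" using ab by simp
  obtain l z where z: "a < z" "z < b" "(f has_real_derivative l) (at z)" "f b - f a = (b - a) * l"
    using MVT[OF lt cont] d by (meson real_differentiable_def)
  then have "l \<le> 0" using d[of z] DERIV_unique by blast
  then have "(b - a) * l \<le> 0" using lt by (simp add: mult_nonneg_nonpos)
  then show ?thesis using z by simp
qed simp

text \<open>The bound makes y^2 exp (- 2 K x) nonincreasing and y^2 exp (2 K x) nondecreasing, so a
  zero at c spreads to the right and to the left.\<close>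

lemma gronwall_zero:
  fixes y y' :: "real \<Rightarrow> real"
  assumes deriv: "\<And>x. a \<le> x \<Longrightarrow> x \<le> b \<Longrightarrow> (y has_real_derivative y' x) (at x)"
    and bound: "\<And>x. a \<le> x \<Longrightarrow> x \<le> b \<Longrightarrow> \<bar>y' x\<bar> \<le> K * \<bar>y x\<bar>"
    and c: "a \<le> c" "c \<le> b" "y c = 0" and x: "a \<le> x" "x \<le> b"
  shows "y x = 0"
proof -
  have K: "0 \<le> K \<or> (\<forall>x. a \<le> x \<longrightarrow> x \<le> b \<longrightarrow> y x = 0)"
  proof (cases "0 \<le> K")
    case False
    { fix x assume "a \<le> x" "x \<le> b"
      then have "0 \<le> K * \<bar>y x\<bar>" using bound[of x] by linarith
      then have "y x = 0" using False by (simp add: zero_le_mult_iff) }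
    then show ?thesis by blast
  qed auto
  have sq: "y x * y' x \<le> K * (y x)\<^sup>2" "- (y x * y' x) \<le> K * (y x)\<^sup>2" if "a \<le> x" "x \<le> b" for x
  proof -
    have "\<bar>y x * y' x\<bar> \<le> \<bar>y x\<bar> * (K * \<bar>y x\<bar>)"
      unfolding abs_mult by (rule mult_left_mono[OF bound[OF that]]) simp
    also have "\<dots> = K * (y x)\<^sup>2" by (simp add: power2_eq_square)
    finally show "y x * y' x \<le> K * (y x)\<^sup>2" "- (y x * y' x) \<le> K * (y x)\<^sup>2" by linarith+
  qed
  show ?thesis
  proof (cases "c \<le> x")
    case True
    have "(y x)\<^sup>2 * exp (- 2 * K * x) \<le> (y c)\<^sup>2 * exp (- 2 * K * c)"
    proof (rule DERIV_nonpos_imp_nonincreasing[OF True])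
      fix t assume t: "c \<le> t" "t \<le> x"
      then have ab: "a \<le> t" "t \<le> b" using c x by auto
      have "((\<lambda>x. (y x)\<^sup>2 * exp (- 2 * K * x)) has_real_derivative
          (2 * (y t * y' t) - 2 * (K * (y t)\<^sup>2)) * exp (- 2 * K * t)) (at t)"
        by (rule derivative_eq_intros deriv ab refl | simp)+ (simp add: algebra_simps power2_eq_square)
      moreover have "(2 * (y t * y' t) - 2 * (K * (y t)\<^sup>2)) * exp (- 2 * K * t) \<le> 0"
        using sq(1)[OF ab] by (intro mult_nonpos_nonneg) auto
      ultimately show "\<exists>d. ((\<lambda>x. (y x)\<^sup>2 * exp (- 2 * K * x)) has_real_derivative d) (at t) \<and> d \<le> 0"
        by blast
    qed
    then have "(y x)\<^sup>2 \<le> 0" using c by (simp add: mult_le_0_iff)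
    then show ?thesis by simp
  next
    case False
    then have xc: "x \<le> c" by simp
    have "(y x)\<^sup>2 * exp (2 * K * x) \<le> (y c)\<^sup>2 * exp (2 * K * c)"
    proof (rule DERIV_nonneg_imp_nondecreasing[OF xc])
      fix t assume t: "x \<le> t" "t \<le> c"
      then have ab: "a \<le> t" "t \<le> b" using c x by auto
      have "((\<lambda>x. (y x)\<^sup>2 * exp (2 * K * x)) has_real_derivative
          (2 * (y t * y' t) + 2 * (K * (y t)\<^sup>2)) * exp (2 * K * t)) (at t)"
        by (rule derivative_eq_intros deriv ab refl | simp)+ (simp add: algebra_simps power2_eq_square)
      moreover have "(2 * (y t * y' t) + 2 * (K * (y t)\<^sup>2)) * exp (2 * K * t) \<ge> 0"
        using sq(2)[OF ab] by (intro mult_nonneg_nonneg) auto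
      ultimately show "\<exists>d. ((\<lambda>x. (y x)\<^sup>2 * exp (2 * K * x)) has_real_derivative d) (at t) \<and> d \<ge> 0"
        by blast
    qed
    then have "(y x)\<^sup>2 \<le> 0" using c by (simp add: mult_le_0_iff)
    then show ?thesis by simp
  qed
qed

lemma continuous_on_Icc_bounded:
  fixes r :: "real \<Rightarrow> real"
  assumes "continuous_on {a..b} r"
  obtains K where "K > 0" "\<And>x. x \<in> {a..b} \<Longrightarrow> \<bar>r x\<bar> \<le> K"
proof -
  have "bounded (r ` {a..b})" using compact_continuous_image[OF assms] compact_imp_bounded by blast
  then show ?thesis using that unfolding bounded_pos by auto
qed

text \<open>Uniqueness for the first order system: f^2 + q^2 has derivative 2 (P - V) f q, which is
  bounded by a multiple of f^2 + q^2 itself.\<close>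

lemma linear_system_zero:
  fixes f q P V :: "real \<Rightarrow> real"
  assumes f: "\<And>x. a \<le> x \<Longrightarrow> x \<le> b \<Longrightarrow> (f has_real_derivative P x * q x) (at x)"
    and q: "\<And>x. a \<le> x \<Longrightarrow> x \<le> b \<Longrightarrow> (q has_real_derivative - (V x * f x)) (at x)"
    and cont: "continuous_on {a..b} P" "continuous_on {a..b} V"
    and c: "a \<le> c" "c \<le> b" "f c = 0" "q c = 0" and x: "a \<le> x" "x \<le> b"
  shows "f x = 0"
proof -
  have "continuous_on {a..b} (\<lambda>x. P x - V x)" by (intro continuous_intros cont)
  from continuous_on_Icc_bounded[OF this] obtain K where
    K: "K > 0" "\<And>x. x \<in> {a..b} \<Longrightarrow> \<bar>P x - V x\<bar> \<le> K" by blast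
  define N where "N = (\<lambda>x. (f x)\<^sup>2 + (q x)\<^sup>2)"
  have "N x = 0"
  proof (rule gronwall_zero[of a b N "\<lambda>x. 2 * (P x - V x) * (f x * q x)" K c])
    fix x assume x: "a \<le> x" "x \<le> b"
    show "(N has_real_derivative 2 * (P x - V x) * (f x * q x)) (at x)"
      unfolding N_def by (rule derivative_eq_intros f q x refl | simp)+ (simp add: algebra_simps)
    have "2 * \<bar>f x * q x\<bar> \<le> N x"
      using sum_squares_bound[of "\<bar>f x\<bar>" "\<bar>q x\<bar>"] by (simp add: N_def abs_mult)
    moreover have "\<bar>P x - V x\<bar> \<le> K" using K x by auto
    ultimately have "\<bar>P x - V x\<bar> * (2 * \<bar>f x * q x\<bar>) \<le> K * N x"
      using K(1) by (intro mult_mono) auto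
    then show "\<bar>2 * (P x - V x) * (f x * q x)\<bar> \<le> K * \<bar>N x\<bar>"
      by (simp only: abs_mult N_def) (simp add: ac_simps)
  qed (use c x in \<open>auto simp: N_def\<close>)
  then show ?thesis by (simp add: N_def add_nonneg_eq_0_iff)
qed

text \<open>Rescaling the primitive to the fixed interval from 0 to 1 makes one formula serve for s
  of either sign. It also lets powers of s be taken out of the integral, so that a division by them
  at a singular point becomes harmless.\<close>

lemma primitive_has_derivative:
  fixes g :: "real \<Rightarrow> real"
  assumes g: "continuous_on UNIV g"
  shows "((\<lambda>s. s * integral {0..1} (\<lambda>t. g (t * s))) has_real_derivative g s) (at s)"
proof -
  have "\<exists>F. \<forall>x. (F has_real_derivative g x) (at x)"
  proof -
    have ent: "((\<lambda>u. LBINT x=0..u. g x) has_vector_derivative g x) (at x within {a..b})"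
      if "a \<le> x" "x \<le> b" "a \<le> 0" "0 \<le> b" for a b x
      using interval_integral_FTC2[of a 0 b g x] that g continuous_on_subset[OF g]
      by (auto simp: zero_ereal_def)
    have "((\<lambda>u. LBINT x=0..u. g x) has_real_derivative g x) (at x)" for x
    proof -
      have "(at x within {- \<bar>x\<bar> - 1..\<bar>x\<bar> + 1}) = at x"
        by (rule at_within_interior) (auto simp: interior_atLeastAtMost_real)
      then show ?thesis using ent[of "- \<bar>x\<bar> - 1" x "\<bar>x\<bar> + 1"]
        by (simp add: has_real_derivative_iff_has_vector_derivative)
    qed
    then show ?thesis by blast
  qed
  then obtain F where F: "\<And>x. (F has_real_derivative g x) (at x)" by blast
  have eq: "s * integral {0..1} (\<lambda>t. g (t * s)) = F s - F 0" for s
  proof -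
    have "((\<lambda>t. g (t * s) * s) has_integral F (1 * s) - F (0 * s)) {0..1}"
    proof (rule fundamental_theorem_of_calculus)
      fix t :: real
      have "((\<lambda>t. F (t * s)) has_real_derivative g (t * s) * s) (at t)"
        by (rule DERIV_chain2[OF F]) (rule derivative_eq_intros refl | simp)+
      then show "((\<lambda>t. F (t * s)) has_vector_derivative g (t * s) * s) (at t within {0..1})"
        by (simp add: has_real_derivative_iff_has_vector_derivative[symmetric] has_field_derivative_at_within)
    qed simp
    then have "integral {0..1} (\<lambda>t. g (t * s) * s) = F s - F 0" by (simp only: integral_unique mult_1 mult_zero_left)
    then show ?thesis unfolding integral_mult_left by (simp add: mult.commute)
  qed
  show ?thesis unfolding eq by (rule derivative_eq_intros F refl | simp)+
qed

text \<open>This justifies \<open>THE\<close> in the enumerations of eigenvalues and zeros. At the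
  first index where a and b differ, each of the two values occurs in the other sequence, but not
  earlier, which gives both inequalities.\<close>

lemma strict_mono_range_unique:
  fixes a b :: "nat \<Rightarrow> real"
  assumes "strict_mono a" "strict_mono b" "range a = range b"
  shows "a = b"
proof (rule ccontr)
  assume "a \<noteq> b"
  then have ex: "\<exists>n. a n \<noteq> b n" by auto
  define n where "n = (LEAST n. a n \<noteq> b n)"
  have n: "a n \<noteq> b n" unfolding n_def by (rule LeastI_ex[OF ex])
  have below: "a i = b i" if "i < n" for i using not_less_Least[of i "\<lambda>n. a n \<noteq> b n"] that n_def by auto
  obtain k where k: "a n = b k" using assms(3) by (metis rangeI imageE)
  obtain l where l: "b n = a l" using assms(3) by (metis rangeI imageE)
  have "\<not> k < n" using below[of k] k assms(1) by (metis strict_mono_less order_less_irrefl)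
  then have "b n \<le> a n" using k assms(2) by (simp add: strict_mono_less_eq)
  moreover have "\<not> l < n" using below[of l] l assms(2) by (metis strict_mono_less order_less_irrefl)
  then have "a n \<le> b n" using l assms(1) by (simp add: strict_mono_less_eq)
  ultimately show False using n by simp
qed

lemma increasing_listing_unique: "increasing_listing a S \<Longrightarrow> increasing_listing b S \<Longrightarrow> a = b"
  unfolding increasing_listing_def by (rule strict_mono_range_unique) auto

lemma the_increasing_listing: "increasing_listing a S \<Longrightarrow> (THE a. increasing_listing a S) = a"
  by (rule the_equality) (auto intro: increasing_listing_unique)

text \<open>Pruefer's substitution: the conclusion says that \<open>(f, -q)\<close> is parallel to \<open>(cos \<alpha>, sin \<alpha>)\<close>.\<close>

lemma pruefer_angle:
  fixes f q f' q' \<alpha> :: "real \<Rightarrow> real"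
  assumes ab: "a \<le> b"
    and f: "\<And>x. a \<le> x \<Longrightarrow> x \<le> b \<Longrightarrow> (f has_real_derivative f' x) (at x)"
    and q: "\<And>x. a \<le> x \<Longrightarrow> x \<le> b \<Longrightarrow> (q has_real_derivative q' x) (at x)"
    and \<alpha>: "\<And>x. a \<le> x \<Longrightarrow> x \<le> b \<Longrightarrow>
       (\<alpha> has_real_derivative (q x * f' x - f x * q' x) / ((f x)\<^sup>2 + (q x)\<^sup>2)) (at x)"
    and pos: "\<And>x. a \<le> x \<Longrightarrow> x \<le> b \<Longrightarrow> (f x)\<^sup>2 + (q x)\<^sup>2 > 0"
    and cont: "continuous_on {a..b} f'" "continuous_on {a..b} q'"
    and init: "f a * sin (\<alpha> a) + q a * cos (\<alpha> a) = 0"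
    and x: "a \<le> x" "x \<le> b"
  shows "f x * sin (\<alpha> x) + q x * cos (\<alpha> x) = 0"
proof -
  define y where "y = (\<lambda>x. f x * sin (\<alpha> x) + q x * cos (\<alpha> x))"
  \<comment> \<open>This is the logarithmic derivative of the radius sqrt (f^2 + q^2). The defect y
    satisfies y' = r y and starts at 0.\<close>
  define r where "r = (\<lambda>x. (f x * f' x + q x * q' x) / ((f x)\<^sup>2 + (q x)\<^sup>2))"
  have cf: "continuous_on {a..b} f" "continuous_on {a..b} q"
    using f q by (auto intro!: DERIV_isCont continuous_at_imp_continuous_on)
  have "continuous_on {a..b} r"
    unfolding r_def using pos by (intro continuous_intros cf cont) (metis atLeastAtMost_iff less_irrefl)
  from continuous_on_Icc_bounded[OF this]
  obtain K where K: "\<And>x. x \<in> {a..b} \<Longrightarrow> \<bar>r x\<bar> \<le> K" by blast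
  have dy: "(y has_real_derivative r t * y t) (at t)" if t: "a \<le> t" "t \<le> b" for t
  proof -
    let ?N = "(f t)\<^sup>2 + (q t)\<^sup>2"
    have N: "?N \<noteq> 0" using pos[OF t] by (metis less_irrefl)
    define R where "R = (q t * f' t - f t * q' t) / ?N"
    have R: "R * ?N = q t * f' t - f t * q' t" using N by (simp add: R_def)
    have "(y has_real_derivative
       f' t * sin (\<alpha> t) + f t * (cos (\<alpha> t) * R) + (q' t * cos (\<alpha> t) - q t * (sin (\<alpha> t) * R))) (at t)"
      unfolding y_def by (rule derivative_eq_intros f q \<alpha>[OF t, folded R_def] t refl | simp)+
    moreover have "f' t * sin (\<alpha> t) + f t * (cos (\<alpha> t) * R) + (q' t * cos (\<alpha> t) - q t * (sin (\<alpha> t) * R)) = r t * y t"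
    proof -
      have "(f' t * sin (\<alpha> t) + f t * (cos (\<alpha> t) * R) + (q' t * cos (\<alpha> t) - q t * (sin (\<alpha> t) * R))) * ?N
         = (f t * f' t + q t * q' t) * y t" unfolding y_def using R by algebra
      also have "\<dots> = (r t * y t) * ?N" using N by (simp add: r_def)
      finally show ?thesis by (rule mult_right_cancel[OF N, THEN iffD1])
    qed
    ultimately show ?thesis by simp
  qed
  have "y x = 0"
  proof (rule gronwall_zero[OF dy _ _ _ _ x, of K a])
    fix t assume "a \<le> t" "t \<le> b"
    then show "\<bar>r t * y t\<bar> \<le> K * \<bar>y t\<bar>" using K[of t] by (simp add: abs_mult mult_right_mono)
  qed (use ab init in \<open>auto simp: y_def\<close>)
  then show ?thesis by (simp add: y_def)
qed

lemma pruefer_polar: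
  fixes f q \<alpha> :: real
  assumes "f * sin \<alpha> + q * cos \<alpha> = 0"
  obtains C where "f = C * cos \<alpha>" "q = - (C * sin \<alpha>)" "C\<^sup>2 = f\<^sup>2 + q\<^sup>2"
proof -
  define C where "C = f * cos \<alpha> - q * sin \<alpha>"
  have sc: "sin \<alpha> * sin \<alpha> + cos \<alpha> * cos \<alpha> = 1" using sin_cos_squared_add3 by (metis add.commute)
  show ?thesis
  proof (rule that[of C])
    show "f = C * cos \<alpha>" unfolding C_def using assms sc by algebra
    show "q = - (C * sin \<alpha>)" unfolding C_def using assms sc by algebra
    show "C\<^sup>2 = f\<^sup>2 + q\<^sup>2" unfolding C_def using assms sc by algebra
  qed
qed

text \<open>Eliminates f and q from the derivative of the angle. In this form the angles of
  different problems obey scalar equations of one type and can be compared.\<close>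

lemma pruefer_rate:
  fixes f q \<alpha> P V :: real
  assumes "f * sin \<alpha> + q * cos \<alpha> = 0" "f\<^sup>2 + q\<^sup>2 \<noteq> 0"
  shows "(P * q\<^sup>2 + V * f\<^sup>2) / (f\<^sup>2 + q\<^sup>2) = P * (sin \<alpha>)\<^sup>2 + V * (cos \<alpha>)\<^sup>2"
proof -
  obtain C where C: "f = C * cos \<alpha>" "q = - (C * sin \<alpha>)" "C\<^sup>2 = f\<^sup>2 + q\<^sup>2"
    using pruefer_polar[OF assms(1)] by blast
  have "P * q\<^sup>2 + V * f\<^sup>2 = (P * (sin \<alpha>)\<^sup>2 + V * (cos \<alpha>)\<^sup>2) * C\<^sup>2"
    unfolding C(1,2) by algebra
  then show ?thesis using assms(2) C(3) by simp
qed

section \<open>Comparison of Pruefer angles, also from a singular end point\<close>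

lemma sin_sq_diff: "(sin (x::real))\<^sup>2 - (sin y)\<^sup>2 = sin (x - y) * sin (x + y)"
proof -
  have "(sin x)\<^sup>2 + (cos x)\<^sup>2 = 1" "(sin y)\<^sup>2 + (cos y)\<^sup>2 = 1" by simp_all
  then show ?thesis unfolding sin_add sin_diff by algebra
qed

text \<open>The difference is split into a change of the angle at the coefficients P2, V2 and a
  change of the coefficients at the angle x. In the first part sin^2 y - sin^2 x = sin (y - x) sin
  (x + y), and the second factor is kept instead of being bounded by 1: near a singular point its
  smallness has to compensate a large P2.\<close>

lemma pruefer_diff_bound:
  fixes x y P1 P2 V1 V2 :: real
  assumes "P2 \<le> P1" "V2 \<le> V1" and K: "\<bar>P2 - V2\<bar> * \<bar>x + y\<bar> \<le> K"
  shows "(P2 * (sin y)\<^sup>2 + V2 * (cos y)\<^sup>2) - (P1 * (sin x)\<^sup>2 + V1 * (cos x)\<^sup>2)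
     \<le> K * \<bar>y - x\<bar> - ((P1 - P2) * (sin x)\<^sup>2 + (V1 - V2) * (cos x)\<^sup>2)"
proof -
  have "(P2 * (sin y)\<^sup>2 + V2 * (cos y)\<^sup>2) - (P1 * (sin x)\<^sup>2 + V1 * (cos x)\<^sup>2)
     = (P2 - V2) * ((sin y)\<^sup>2 - (sin x)\<^sup>2) - ((P1 - P2) * (sin x)\<^sup>2 + (V1 - V2) * (cos x)\<^sup>2)"
    by (simp add: cos_squared_eq algebra_simps)
  moreover have "(P2 - V2) * ((sin y)\<^sup>2 - (sin x)\<^sup>2) \<le> K * \<bar>y - x\<bar>"
  proof -
    have "(P2 - V2) * ((sin y)\<^sup>2 - (sin x)\<^sup>2) \<le> \<bar>(P2 - V2) * (sin (y - x) * sin (x + y))\<bar>"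
      unfolding sin_sq_diff by (simp add: add.commute)
    also have "\<dots> = \<bar>P2 - V2\<bar> * (\<bar>sin (x + y)\<bar> * \<bar>sin (y - x)\<bar>)" by (simp add: abs_mult)
    also have "\<dots> \<le> \<bar>P2 - V2\<bar> * (\<bar>x + y\<bar> * \<bar>y - x\<bar>)"
      by (intro mult_left_mono mult_mono abs_sin_x_le_abs_x) auto
    also have "\<dots> \<le> K * \<bar>y - x\<bar>" using mult_right_mono[OF K, of "\<bar>y - x\<bar>"] by (simp add: mult.assoc)
    finally show ?thesis .
  qed
  ultimately show ?thesis by linarith
qed

text \<open>The difference \<delta> = \<beta> - \<alpha> satisfies \<delta>' \<le> K |\<delta>| - e
  with e \<ge> 0, so it cannot become positive. Derivatives are asked for only to the right of a,
  since a may be a singular point. Strictness arises near a, where cos \<alpha> does not vanish and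
  V2 < V1 makes e positive, and it is never lost afterwards.\<close>

lemma angle_comparison:
  fixes \<alpha> \<beta> P1 P2 V1 V2 :: "real \<Rightarrow> real"
  assumes ab: "a < b" and cont: "continuous_on {a..b} \<alpha>" "continuous_on {a..b} \<beta>"
    and d\<alpha>: "\<And>s. a < s \<Longrightarrow> s \<le> b \<Longrightarrow>
      (\<alpha> has_real_derivative P1 s * (sin (\<alpha> s))\<^sup>2 + V1 s * (cos (\<alpha> s))\<^sup>2) (at s)"
    and d\<beta>: "\<And>s. a < s \<Longrightarrow> s \<le> b \<Longrightarrow>
      (\<beta> has_real_derivative P2 s * (sin (\<beta> s))\<^sup>2 + V2 s * (cos (\<beta> s))\<^sup>2) (at s)"
    and le: "\<And>s. a < s \<Longrightarrow> s \<le> b \<Longrightarrow> P2 s \<le> P1 s" "\<And>s. a < s \<Longrightarrow> s \<le> b \<Longrightarrow> V2 s \<le> V1 s"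
    and K: "\<And>s. a < s \<Longrightarrow> s \<le> b \<Longrightarrow> \<bar>P2 s - V2 s\<bar> * \<bar>\<alpha> s + \<beta> s\<bar> \<le> K"
    and init: "\<beta> a \<le> \<alpha> a"
  shows "\<beta> b \<le> \<alpha> b"
    and "\<lbrakk>\<And>s. a < s \<Longrightarrow> s \<le> b \<Longrightarrow> V2 s < V1 s; cos (\<alpha> a) \<noteq> 0\<rbrakk> \<Longrightarrow> \<beta> b < \<alpha> b"
proof -
  define \<delta> where "\<delta> = (\<lambda>s. \<beta> s - \<alpha> s)"
  define D where "D = (\<lambda>s. (P2 s * (sin (\<beta> s))\<^sup>2 + V2 s * (cos (\<beta> s))\<^sup>2) - (P1 s * (sin (\<alpha> s))\<^sup>2 + V1 s * (cos (\<alpha> s))\<^sup>2))"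
  define e where "e = (\<lambda>s. (P1 s - P2 s) * (sin (\<alpha> s))\<^sup>2 + (V1 s - V2 s) * (cos (\<alpha> s))\<^sup>2)"
  have cd: "continuous_on {a..b} \<delta>" unfolding \<delta>_def by (intro continuous_intros cont)
  have dd: "(\<delta> has_real_derivative D s) (at s)" if "a < s" "s \<le> b" for s
    unfolding \<delta>_def D_def by (rule derivative_intros d\<alpha> d\<beta> that)+
  have Db: "D s \<le> K * \<bar>\<delta> s\<bar> - e s" if "a < s" "s \<le> b" for s
    unfolding D_def \<delta>_def e_def by (rule pruefer_diff_bound[OF le(1)[OF that] le(2)[OF that] K[OF that]])
  have e0: "e s \<ge> 0" if "a < s" "s \<le> b" for s
    unfolding e_def using le[OF that] by (intro add_nonneg_nonneg mult_nonneg_nonneg) auto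
  have K0: "K \<ge> 0" using K[of b] ab by (smt (verit) abs_ge_zero mult_nonneg_nonneg)
  have neg: "\<delta> s \<le> 0" if s: "a \<le> s" "s \<le> b" for s
  proof (rule ccontr)
    assume "\<not> \<delta> s \<le> 0"
    then have p: "\<delta> s > 0" by simp
    have d0: "\<delta> a \<le> 0" using init by (simp add: \<delta>_def)
    define Z where "Z = {t \<in> {a..s}. \<delta> t \<in> {..0}}"
    have "continuous_on {a..s} \<delta>" using cd s by (auto intro: continuous_on_subset)
    then have "closed Z" unfolding Z_def by (intro continuous_closed_preimage_constant continuous_on_closed_Collect_le continuous_closed_preimage[unfolded vimage_def Int_def mem_Collect_eq, simplified]) auto
    then have cl: "compact Z" unfolding compact_eq_bounded_closed
      by (metis (no_types, lifting) Z_def bounded_closed_interval bounded_subset mem_Collect_eq subsetI atLeastAtMost_iff)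
    have "a \<in> Z" using d0 s by (auto simp: Z_def)
    \<comment> \<open>The last point before s with \<delta> \<le> 0. Beyond it |\<delta>| =
      \<delta>, and \<delta> exp (- K s) cannot grow.\<close>
    then obtain c where c: "c \<in> Z" "\<And>t. t \<in> Z \<Longrightarrow> t \<le> c" using compact_attains_sup[OF cl] by auto
    have cs: "a \<le> c" "c < s" "\<delta> c \<le> 0" using c(1) p by (auto simp: Z_def less_le)
    have pos: "\<delta> t > 0" if "c < t" "t \<le> s" for t
      using c(2)[of t] that cs by (force simp: Z_def not_le[symmetric])
    have "\<delta> s * exp (- K * s) \<le> \<delta> c * exp (- K * c)"
    proof (rule deriv_nonpos_imp_nonincreasing_open[where f = "\<lambda>s. \<delta> s * exp (- K * s)"])
      show "c \<le> s" using cs by simp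
      show "continuous_on {c..s} (\<lambda>s. \<delta> s * exp (- K * s))"
        by (intro continuous_intros continuous_on_subset[OF cd]) (use cs s in auto)
      fix t assume t: "c < t" "t < s"
      then have tb: "a < t" "t \<le> b" using cs s by auto
      have "((\<lambda>s. \<delta> s * exp (- K * s)) has_real_derivative (D t - K * \<delta> t) * exp (- K * t)) (at t)"
        by (rule derivative_eq_intros dd tb refl | simp)+ (simp add: algebra_simps)
      moreover have "(D t - K * \<delta> t) * exp (- K * t) \<le> 0"
        using Db[OF tb] e0[OF tb] pos[of t] t by (intro mult_nonpos_nonneg) auto
      ultimately show "\<exists>y. ((\<lambda>s. \<delta> s * exp (- K * s)) has_real_derivative y) (at t) \<and> y \<le> 0" by blast
    qed
    moreover have "\<delta> c * exp (- K * c) \<le> 0" using cs by (simp add: mult_nonpos_nonneg)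
    moreover have "\<delta> s * exp (- K * s) > 0" using p by simp
    ultimately show False by linarith
  qed
  show "\<beta> b \<le> \<alpha> b" using neg[of b] ab by (simp add: \<delta>_def)
  assume V: "\<And>s. a < s \<Longrightarrow> s \<le> b \<Longrightarrow> V2 s < V1 s" and cosa: "cos (\<alpha> a) \<noteq> 0"
  \<comment> \<open>Now \<delta> \<le> 0 is known, so |\<delta>| = - \<delta> and the integrating
    factor has the opposite exponent.\<close>
  have step: "((\<lambda>s. \<delta> s * exp (K * s)) has_real_derivative (D t + K * \<delta> t) * exp (K * t)) (at t) \<and>
       (D t + K * \<delta> t) * exp (K * t) \<le> - e t * exp (K * t)" if tb: "a < t" "t \<le> b" for t
  proof
    show "((\<lambda>s. \<delta> s * exp (K * s)) has_real_derivative (D t + K * \<delta> t) * exp (K * t)) (at t)"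
      by (rule derivative_eq_intros dd tb refl | simp)+ (simp add: algebra_simps)
    show "(D t + K * \<delta> t) * exp (K * t) \<le> - e t * exp (K * t)"
      using Db[OF tb] neg[of t] tb by (intro mult_right_mono) auto
  qed
  have "\<forall>\<^sub>F t in at a within {a..b}. cos (\<alpha> t) \<noteq> 0"
  proof -
    have "continuous_on {a..b} (\<lambda>t. cos (\<alpha> t))" by (intro continuous_intros cont)
    then have "((\<lambda>t. cos (\<alpha> t)) \<longlongrightarrow> cos (\<alpha> a)) (at a within {a..b})" using ab by (auto simp: continuous_on)
    then show ?thesis using cosa by (rule tendsto_imp_eventually_ne)
  qed
  then obtain d where d: "d > 0" "\<And>t. t \<in> {a..b} \<Longrightarrow> t \<noteq> a \<Longrightarrow> dist t a < d \<Longrightarrow> cos (\<alpha> t) \<noteq> 0"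
    unfolding eventually_at by blast
  define c where "c = min b (a + d / 2)"
  have c: "a < c" "c \<le> b" using ab d by (auto simp: c_def)
  have "\<delta> c * exp (K * c) < \<delta> a * exp (K * a)"
  proof (rule DERIV_neg_imp_decreasing_open[OF c(1)])
    show "continuous_on {a..c} (\<lambda>s. \<delta> s * exp (K * s))"
      by (intro continuous_intros continuous_on_subset[OF cd]) (use c in auto)
    fix t assume t: "a < t" "t < c"
    then have tb: "a < t" "t \<le> b" using c by auto
    have "cos (\<alpha> t) \<noteq> 0" using d(2)[of t] t tb d(1) by (auto simp: dist_real_def c_def)
    then have "e t > 0" unfolding e_def using V[OF tb] le(1)[OF tb] by (intro add_nonneg_pos mult_pos_pos) auto
    then have "- e t * exp (K * t) < 0" by simp
    then show "\<exists>y. ((\<lambda>s. \<delta> s * exp (K * s)) has_real_derivative y) (at t) \<and> y < 0"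
      using step[OF tb] by fastforce
  qed
  also have "\<dots> \<le> 0" using neg[of a] ab by (simp add: mult_nonpos_nonneg)
  finally have 1: "\<delta> c * exp (K * c) < 0" .
  have "\<delta> b * exp (K * b) \<le> \<delta> c * exp (K * c)"
  proof (rule DERIV_nonpos_imp_nonincreasing[OF c(2)])
    fix t assume t: "c \<le> t" "t \<le> b"
    then have tb: "a < t" "t \<le> b" using c by auto
    have "- e t * exp (K * t) \<le> 0" using e0[OF tb] by simp
    then show "\<exists>y. ((\<lambda>s. \<delta> s * exp (K * s)) has_real_derivative y) (at t) \<and> y \<le> 0"
      using step[OF tb] by fastforce
  qed
  then have "\<delta> b * exp (K * b) < 0" using 1 by simp
  then have "\<delta> b < 0" by (simp add: mult_less_0_iff)
  then show "\<beta> b < \<alpha> b" by (simp add: \<delta>_def)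
qed

text \<open>The underlying solution is f = cos (w x), q = - sqrt l sin (w x) with w = sqrt l c. At x
  = n \<pi> / w the flux q vanishes, so the angle is a multiple of \<pi> there; since it increases
  strictly, it has reached at least n \<pi>. It serves as a lower barrier that grows with l.\<close>

lemma constant_coefficient_angle:
  fixes c l :: real
  assumes c: "c > 0" and l: "l > 0"
  obtains B :: "real \<Rightarrow> real" where
    "\<And>x. (B has_real_derivative c * (sin (B x))\<^sup>2 + l * c * (cos (B x))\<^sup>2) (at x) \<or> x < 0"
    "B 0 = 0" "\<And>n::nat. B (real n * pi / (sqrt l * c)) \<ge> real n * pi" "\<And>x. isCont B x"
proof -
  define w where "w = sqrt l * c"
  have w: "w > 0" using c l by (simp add: w_def)
  have sl: "sqrt l > 0" "sqrt l * sqrt l = l" using l by auto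
  have slw: "sqrt l * w = l * c" using sl by (simp add: w_def flip: mult.assoc)
  define f where "f = (\<lambda>x. cos (w * x))"
  define q where "q = (\<lambda>x. - sqrt l * sin (w * x))"
  define f' where "f' = (\<lambda>x. c * q x)"
  define q' where "q' = (\<lambda>x. - (l * c * f x))"
  have df: "(f has_real_derivative f' x) (at x)" for x
    unfolding f_def f'_def q_def by (rule derivative_eq_intros refl | simp)+ (simp add: w_def)
  have dq: "(q has_real_derivative q' x) (at x)" for x
    unfolding f_def q'_def q_def
    by (rule derivative_eq_intros refl | simp)+ (use slw in algebra)
  have pos: "(f x)\<^sup>2 + (q x)\<^sup>2 > 0" for x
  proof (cases "f x = 0")
    case True
    then have "sin (w * x) \<noteq> 0" unfolding f_def using sin_cos_squared_add3[of "w * x"] by auto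
    then show ?thesis using True sl by (simp add: q_def)
  qed (simp add: add_pos_nonneg)
  define g where "g = (\<lambda>x. (q x * f' x - f x * q' x) / ((f x)\<^sup>2 + (q x)\<^sup>2))"
  have geq: "g x = (c * (q x)\<^sup>2 + l * c * (f x)\<^sup>2) / ((f x)\<^sup>2 + (q x)\<^sup>2)" for x
    by (simp add: g_def f'_def q'_def power2_eq_square algebra_simps)
  have gpos: "g x > 0" for x
  proof -
    have "c * (q x)\<^sup>2 + l * c * (f x)\<^sup>2 > 0"
    proof (cases "f x = 0")
      case True
      then show ?thesis using pos[of x] c by simp
    next
      case False
      then show ?thesis using c l by (intro add_nonneg_pos) auto
    qed
    then show ?thesis unfolding geq using pos[of x] by simp
  qed
  have cfq: "continuous_on S f" "continuous_on S q" "continuous_on S f'" "continuous_on S q'" for S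
    unfolding f'_def q'_def unfolding f_def q_def by (intro continuous_intros)+
  have gcont: "continuous_on UNIV g" unfolding g_def
    by (intro continuous_intros cfq) (metis less_irrefl pos)
  define B where "B = (\<lambda>x. x * integral {0..1} (\<lambda>t. g (t * x)))"
  have dB: "(B has_real_derivative g x) (at x)" for x
    unfolding B_def by (rule primitive_has_derivative[OF gcont])
  have B0: "B 0 = 0" by (simp add: B_def)
  have rel: "f x * sin (B x) + q x * cos (B x) = 0" if "x \<ge> 0" for x
    by (rule pruefer_angle[of 0 x f f' q q' B])
      (use that df dq dB pos cfq B0 in \<open>auto simp: g_def q_def\<close>)
  have ode: "(B has_real_derivative c * (sin (B x))\<^sup>2 + l * c * (cos (B x))\<^sup>2) (at x)" if x: "x \<ge> 0" for x
  proof -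
    have "g x = c * (sin (B x))\<^sup>2 + l * c * (cos (B x))\<^sup>2"
      unfolding geq by (rule pruefer_rate[OF rel[OF x]]) (metis pos less_irrefl)
    then show ?thesis using dB[of x] by simp
  qed
  have mono: "B x < B y" if "x < y" for x y
    using DERIV_pos_imp_increasing[OF that, of B] dB gpos by blast
  have int: "\<exists>i::int. B (real n * pi / w) = of_int i * pi" for n
  proof -
    have x: "real n * pi / w \<ge> 0" using w by simp
    have "q (real n * pi / w) = 0" using w by (simp add: q_def sin_npi)
    then have "f (real n * pi / w) * sin (B (real n * pi / w)) = 0" using rel[OF x] by simp
    moreover have "f (real n * pi / w) \<noteq> 0" using pos[of "real n * pi / w"] \<open>q _ = 0\<close> by auto
    ultimately have "sin (B (real n * pi / w)) = 0" by simp
    then show ?thesis by (simp add: sin_zero_iff_int2)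
  qed
  have grow: "B (real n * pi / w) \<ge> real n * pi" for n
  proof (induction n)
    case (Suc n)
    obtain i where i: "B (real (Suc n) * pi / w) = of_int i * pi" using int by blast
    have "B (real n * pi / w) < B (real (Suc n) * pi / w)"
      using w by (intro mono divide_strict_right_mono mult_strict_right_mono) auto
    then have "real n * pi < of_int i * pi" using Suc i by linarith
    then have "real n < of_int i" by (simp only: mult_less_cancel_right_pos[OF pi_gt_zero])
    then have "int (Suc n) \<le> i" by linarith
    then have "real (Suc n) \<le> of_int i" by (metis of_int_le_iff of_int_of_nat_eq)
    then show ?case unfolding i by (intro mult_right_mono) auto
  qed (simp add: B0)
  show ?thesis
    by (rule that[of B]) (use ode B0 grow dB in \<open>auto simp: w_def not_less intro: DERIV_isCont\<close>)
qed

text \<open>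
  The bounds tame the singularity of \<open>P\<close> at the left end point: they make the Pruefer equation
  Lipschitz along the solutions, so that a comparison can start at \<open>0\<close>.
\<close>

definition angle_datum :: "nat \<Rightarrow> real \<Rightarrow> (real \<Rightarrow> real) \<Rightarrow> (real \<Rightarrow> real) \<Rightarrow> (real \<Rightarrow> real) \<Rightarrow> bool" where
  "angle_datum m b \<alpha> P V \<longleftrightarrow> continuous_on {0..b} \<alpha> \<and> \<alpha> 0 = 0 \<and>
     (\<forall>s. 0 < s \<and> s \<le> b \<longrightarrow>
        (\<alpha> has_real_derivative P s * (sin (\<alpha> s))\<^sup>2 + V s * (cos (\<alpha> s))\<^sup>2) (at s)) \<and>
     (\<exists>C. \<forall>s. 0 < s \<and> s \<le> b \<longrightarrow>
        0 \<le> P s \<and> P s * s ^ (m + 1) \<le> C \<and> \<bar>V s\<bar> \<le> C \<and> \<bar>\<alpha> s\<bar> \<le> C * s ^ (m + 1))"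

text \<open>P2 may blow up like s^-(m+1), but both angles are O(s^(m+1)), so the product that acts
  as a Lipschitz constant in \<open>angle_comparison\<close> stays bounded. The angles start at 0,
  where the cosine is 1, which is what strictness asks for.\<close>

lemma angle_datum_comparison:
  assumes d1: "angle_datum m b \<alpha> P1 V1" and d2: "angle_datum m b \<beta> P2 V2" and b: "0 < b"
    and P: "\<And>s. 0 < s \<Longrightarrow> s \<le> b \<Longrightarrow> P2 s \<le> P1 s" and V: "\<And>s. 0 < s \<Longrightarrow> s \<le> b \<Longrightarrow> V2 s \<le> V1 s"
  shows "\<beta> b \<le> \<alpha> b" "(\<And>s. 0 < s \<Longrightarrow> s \<le> b \<Longrightarrow> V2 s < V1 s) \<Longrightarrow> \<beta> b < \<alpha> b"
proof -
  obtain C1 where C1: "\<And>s. 0 < s \<Longrightarrow> s \<le> b \<Longrightarrow>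
        0 \<le> P1 s \<and> P1 s * s ^ (m + 1) \<le> C1 \<and> \<bar>V1 s\<bar> \<le> C1 \<and> \<bar>\<alpha> s\<bar> \<le> C1 * s ^ (m + 1)"
    using d1 unfolding angle_datum_def by blast
  obtain C2 where C2: "\<And>s. 0 < s \<Longrightarrow> s \<le> b \<Longrightarrow>
        0 \<le> P2 s \<and> P2 s * s ^ (m + 1) \<le> C2 \<and> \<bar>V2 s\<bar> \<le> C2 \<and> \<bar>\<beta> s\<bar> \<le> C2 * s ^ (m + 1)"
    using d2 unfolding angle_datum_def by blast
  have Cp: "0 \<le> C1" "0 \<le> C2" using C1[of b] C2[of b] b by linarith+
  have K: "\<bar>P2 s - V2 s\<bar> * \<bar>\<alpha> s + \<beta> s\<bar> \<le> (C2 + C2 * b ^ (m + 1)) * (C1 + C2)" if s: "0 < s" "s \<le> b" for s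
  proof -
    have "\<bar>\<alpha> s + \<beta> s\<bar> \<le> \<bar>\<alpha> s\<bar> + \<bar>\<beta> s\<bar>" by (rule abs_triangle_ineq)
    also have "\<dots> \<le> (C1 + C2) * s ^ (m + 1)" using C1[OF s] C2[OF s] by (simp only: distrib_right) linarith
    finally have 1: "\<bar>\<alpha> s + \<beta> s\<bar> \<le> (C1 + C2) * s ^ (m + 1)" .
    have "\<bar>P2 s - V2 s\<bar> * s ^ (m + 1) \<le> (P2 s + C2) * s ^ (m + 1)"
      using C2[OF s] s by (intro mult_right_mono) auto
    also have "\<dots> = P2 s * s ^ (m + 1) + C2 * s ^ (m + 1)" by (simp only: distrib_right)
    also have "\<dots> \<le> C2 + C2 * b ^ (m + 1)"
      using C2[OF s] s Cp by (intro add_mono mult_left_mono power_mono) auto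
    finally have 2: "\<bar>P2 s - V2 s\<bar> * s ^ (m + 1) \<le> C2 + C2 * b ^ (m + 1)" .
    have "\<bar>P2 s - V2 s\<bar> * \<bar>\<alpha> s + \<beta> s\<bar> \<le> \<bar>P2 s - V2 s\<bar> * ((C1 + C2) * s ^ (m + 1))"
      by (rule mult_left_mono[OF 1]) simp
    also have "\<dots> = (\<bar>P2 s - V2 s\<bar> * s ^ (m + 1)) * (C1 + C2)" by (simp add: ac_simps)
    also have "\<dots> \<le> (C2 + C2 * b ^ (m + 1)) * (C1 + C2)" using Cp by (intro mult_right_mono[OF 2]) simp
    finally show ?thesis .
  qed
  note d = d1[unfolded angle_datum_def] d2[unfolded angle_datum_def]
  show "\<beta> b \<le> \<alpha> b" by (rule angle_comparison(1)[OF b _ _ _ _ P V K]) (use d in auto)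
  show "\<beta> b < \<alpha> b" if st: "\<And>s. 0 < s \<Longrightarrow> s \<le> b \<Longrightarrow> V2 s < V1 s"
    by (rule angle_comparison(2)[OF b _ _ _ _ P V K _ st]) (use d in auto)
qed

text \<open>In a new variable x = M(s) both coefficients acquire the factor dx/ds = \<mu>. As \<mu>
  is bounded above and away from 0, M(s) is comparable with s and all orders at 0 are preserved.
  This pulls a limit problem, given in the mass coordinate, back to s.\<close>

lemma angle_datum_reparam:
  assumes d: "angle_datum m (M b) \<beta> P V" and b: "0 < b" and M0: "M 0 = 0"
    and dM: "\<And>s. 0 \<le> s \<Longrightarrow> s \<le> b \<Longrightarrow> (M has_real_derivative \<mu> s) (at s)"
    and \<mu>: "continuous_on {0..b} \<mu>" "\<And>s. 0 \<le> s \<Longrightarrow> s \<le> b \<Longrightarrow> 0 < \<mu> s"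
  shows "angle_datum m b (\<lambda>s. \<beta> (M s)) (\<lambda>s. \<mu> s * P (M s)) (\<lambda>s. \<mu> s * V (M s))"
proof -
  obtain K where K: "K > 0" "\<And>s. s \<in> {0..b} \<Longrightarrow> \<bar>\<mu> s\<bar> \<le> K" using continuous_on_Icc_bounded[OF \<mu>(1)] by blast
  have "continuous_on {0..b} (\<lambda>s. 1 / \<mu> s)" using \<mu> by (intro continuous_intros) fastforce+
  from continuous_on_Icc_bounded[OF this]
  obtain K' where K': "K' > 0" "\<And>s. s \<in> {0..b} \<Longrightarrow> \<bar>1 / \<mu> s\<bar> \<le> K'" by blast
  have \<mu>b: "1 / K' \<le> \<mu> s" "\<mu> s \<le> K" if "0 \<le> s" "s \<le> b" for s
    using K(2)[of s] K'(2)[of s] \<mu>(2)[of s] that K'(1) by (auto simp: field_simps)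
  have Mb: "s / K' \<le> M s" "M s \<le> K * s" if s: "0 \<le> s" "s \<le> b" for s
  proof -
    have "M 0 - 0 / K' \<le> M s - s / K'"
    proof (rule DERIV_nonneg_imp_nondecreasing[OF s(1)])
      fix x assume "0 \<le> x" "x \<le> s"
      then have x: "0 \<le> x" "x \<le> b" using s by auto
      have "((\<lambda>s. M s - s / K') has_real_derivative \<mu> x - 1 / K') (at x)"
        using K'(1) by (auto intro!: derivative_eq_intros dM x)
      then show "\<exists>y. ((\<lambda>s. M s - s / K') has_real_derivative y) (at x) \<and> 0 \<le> y" using \<mu>b[OF x] by auto
    qed
    then show "s / K' \<le> M s" using M0 by simp
    have "K * 0 - M 0 \<le> K * s - M s"
    proof (rule DERIV_nonneg_imp_nondecreasing[OF s(1)])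
      fix x assume "0 \<le> x" "x \<le> s"
      then have x: "0 \<le> x" "x \<le> b" using s by auto
      have "((\<lambda>s. K * s - M s) has_real_derivative K - \<mu> x) (at x)"
        by (auto intro!: derivative_eq_intros dM x)
      then show "\<exists>y. ((\<lambda>s. K * s - M s) has_real_derivative y) (at x) \<and> 0 \<le> y" using \<mu>b[OF x] by auto
    qed
    then show "M s \<le> K * s" using M0 by simp
  qed
  have Mpos: "0 < M s" if "0 < s" "s \<le> b" for s
  proof -
    have "0 < s / K'" using that K'(1) by simp
    then show ?thesis using Mb(1)[of s] that by linarith
  qed
  have Mmono: "M s \<le> M b" if s: "0 \<le> s" "s \<le> b" for s
  proof (rule DERIV_nonneg_imp_nondecreasing[OF s(2)])
    fix x assume "s \<le> x" "x \<le> b"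
    then show "\<exists>y. (M has_real_derivative y) (at x) \<and> 0 \<le> y" using dM[of x] \<mu>(2)[of x] s by fastforce
  qed
  have cM: "continuous_on {0..b} M" using dM by (auto intro!: DERIV_isCont continuous_at_imp_continuous_on)
  have Mnn: "0 \<le> M s" if "0 \<le> s" "s \<le> b" for s using Mpos[of s] M0 that by (cases "s = 0") auto
  obtain C where C: "\<And>y. 0 < y \<Longrightarrow> y \<le> M b \<Longrightarrow>
        0 \<le> P y \<and> P y * y ^ (m + 1) \<le> C \<and> \<bar>V y\<bar> \<le> C \<and> \<bar>\<beta> y\<bar> \<le> C * y ^ (m + 1)"
    using d unfolding angle_datum_def by blast
  have Cp: "0 \<le> C" using C[of "M b"] Mpos[of b] b by linarith
  define C' where "C' = max (max (K * (K' ^ (m + 1) * C)) (K * C)) (C * K ^ (m + 1))"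
  show ?thesis unfolding angle_datum_def
  proof (intro conjI exI[of _ C'] allI impI)
    show "continuous_on {0..b} (\<lambda>s. \<beta> (M s))"
      by (rule continuous_on_compose2[OF _ cM]) (use d Mnn Mmono in \<open>auto simp: angle_datum_def\<close>)
    show "\<beta> (M 0) = 0" using d M0 by (simp add: angle_datum_def)
    fix s assume "0 < s \<and> s \<le> b"
    then have s: "0 < s" "s \<le> b" by auto
    have y: "0 < M s" "M s \<le> M b" using Mpos[OF s] Mmono[of s] s by auto
    note C = C[OF y]
    have "(\<beta> has_real_derivative P (M s) * (sin (\<beta> (M s)))\<^sup>2 + V (M s) * (cos (\<beta> (M s)))\<^sup>2) (at (M s))"
      using d y unfolding angle_datum_def by blast
    from DERIV_chain2[OF this dM] s
    show "((\<lambda>s. \<beta> (M s)) has_real_derivative \<mu> s * P (M s) * (sin (\<beta> (M s)))\<^sup>2 + \<mu> s * V (M s) * (cos (\<beta> (M s)))\<^sup>2) (at s)"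
      by (simp add: algebra_simps)
    show "0 \<le> \<mu> s * P (M s)" using C \<mu>(2)[of s] s by simp
    have "s \<le> K' * M s" using Mb(1)[of s] s K'(1) by (simp add: field_simps)
    then have "s ^ (m + 1) \<le> (K' * M s) ^ (m + 1)" using s by (intro power_mono) auto
    then have "P (M s) * s ^ (m + 1) \<le> P (M s) * (K' ^ (m + 1) * M s ^ (m + 1))"
      using C by (intro mult_left_mono) (simp_all only: power_mult_distrib)
    also have "\<dots> = K' ^ (m + 1) * (P (M s) * M s ^ (m + 1))" by (simp only: ac_simps)
    also have "\<dots> \<le> K' ^ (m + 1) * C" using C K'(1) by (intro mult_left_mono) auto
    finally have 1: "P (M s) * s ^ (m + 1) \<le> K' ^ (m + 1) * C" .
    have "\<mu> s * (P (M s) * s ^ (m + 1)) \<le> K * (K' ^ (m + 1) * C)"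
      using \<mu>b[of s] \<mu>(2)[of s] s C K(1) by (intro mult_mono 1) auto
    then show "\<mu> s * P (M s) * s ^ (m + 1) \<le> C'" unfolding C'_def by (simp add: mult.assoc)
    have "\<mu> s * \<bar>V (M s)\<bar> \<le> K * C" using C \<mu>b[of s] \<mu>(2)[of s] s K(1) by (intro mult_mono) auto
    then show "\<bar>\<mu> s * V (M s)\<bar> \<le> C'" unfolding C'_def using \<mu>(2)[of s] s by (simp add: abs_mult)
    have "\<bar>\<beta> (M s)\<bar> \<le> C * M s ^ (m + 1)" using C by blast
    also have "\<dots> \<le> C * (K * s) ^ (m + 1)" using Mb(2)[of s] y s Cp by (intro mult_left_mono power_mono) auto
    also have "\<dots> = (C * K ^ (m + 1)) * s ^ (m + 1)" by (simp only: power_mult_distrib ac_simps)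
    also have "\<dots> \<le> C' * s ^ (m + 1)" unfolding C'_def using s by (intro mult_right_mono) auto
    finally show "\<bar>\<beta> (M s)\<bar> \<le> C' * s ^ (m + 1)" .
  qed
qed

section \<open>Regular solutions of singular problems and their angles\<close>

lemma continuous_on_Icc_lower_bound:
  fixes r :: "real \<Rightarrow> real"
  assumes "continuous_on {a..b} r" "\<And>x. x \<in> {a..b} \<Longrightarrow> r x > 0"
  obtains c where "c > 0" "\<And>x. x \<in> {a..b} \<Longrightarrow> c \<le> r x"
proof (cases "a \<le> b")
  case True
  obtain x where "x \<in> {a..b}" "\<And>y. y \<in> {a..b} \<Longrightarrow> r x \<le> r y"
    using continuous_attains_inf[of "{a..b}" r] assms(1) True by auto
  then show ?thesis using that assms(2) by blast
next
  case False
  then show ?thesis using that[of 1] by simp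
qed

text \<open>
  A family (in the spectral parameter \<open>l\<close>) of solutions of \<open>(s\<^sup>m\<^sup>+\<^sup>1 H f')' = - l s\<^sup>m H k f\<close> that are
  regular at the singular point \<open>s = 0\<close>; \<open>Q\<close> is the derivative of \<open>f\<close> in \<open>s\<close>.
\<close>

locale radial_sol =
  fixes m :: nat and H k :: "real \<Rightarrow> real" and f Q :: "real \<Rightarrow> real \<Rightarrow> real"
  assumes H_cont: "continuous_on UNIV H" and k_cont: "continuous_on UNIV k"
    and H_pos: "H s > 0" and k_pos: "k s > 0"
    and f_at_0: "f 0 l = 1"
    and f_deriv: "((\<lambda>s. f s l) has_real_derivative Q s l) (at s)"
    and flux_deriv: "((\<lambda>s. s ^ (m + 1) * H s * Q s l) has_real_derivative - (l * s ^ m * H s * k s * f s l)) (at s)"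
    and f_cont: "continuous_on UNIV (\<lambda>p. f (fst p) (snd p))"
    and Q_cont: "continuous_on UNIV (\<lambda>p. Q (fst p) (snd p))"
begin

definition q :: "real \<Rightarrow> real \<Rightarrow> real" where "q s l = s ^ (m + 1) * H s * Q s l"

definition P :: "real \<Rightarrow> real" where "P s = 1 / (s ^ (m + 1) * H s)"

definition V :: "real \<Rightarrow> real" where "V s = s ^ m * H s * k s"

text \<open>The derivative of the angle divided by s^m, with the powers of s cancelled by hand via P
  q^2 = s^(m+1) H Q^2. In this form it is continuous at s = 0, although P is not.\<close>

definition rate :: "real \<Rightarrow> real \<Rightarrow> real" where
  "rate s l = (s * H s * (Q s l)\<^sup>2 + l * H s * k s * (f s l)\<^sup>2) / ((f s l)\<^sup>2 + (q s l)\<^sup>2)"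

definition angle :: "real \<Rightarrow> real \<Rightarrow> real" where
  "angle s l = s * integral {0..1} (\<lambda>t. (t * s) ^ m * rate (t * s) l)"

lemma q_deriv: "((\<lambda>s. q s l) has_real_derivative - (l * V s * f s l)) (at s)"
  using flux_deriv[of l s] by (simp add: q_def[abs_def] V_def mult.assoc)

lemma q_at_0: "q 0 l = 0" by (simp add: q_def)

lemma Q_eq: "s \<noteq> 0 \<Longrightarrow> Q s l = P s * q s l"
  using H_pos[of s] by (simp add: P_def q_def)

lemma P_pos: "s > 0 \<Longrightarrow> P s > 0" and V_pos: "s > 0 \<Longrightarrow> V s > 0"
  using H_pos[of s] k_pos[of s] by (simp_all add: P_def V_def)

lemma H_cont_on [continuous_intros]: "continuous_on A g \<Longrightarrow> continuous_on A (\<lambda>x. H (g x))"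
  by (rule continuous_on_compose2[OF H_cont]) auto

lemma k_cont_on [continuous_intros]: "continuous_on A g \<Longrightarrow> continuous_on A (\<lambda>x. k (g x))"
  by (rule continuous_on_compose2[OF k_cont]) auto

lemma f_cont_on [continuous_intros]:
  assumes "continuous_on A g" "continuous_on A h" shows "continuous_on A (\<lambda>x. f (g x) (h x))"
  using continuous_on_compose2[OF f_cont continuous_on_Pair[OF assms]] by simp

lemma Q_cont_on [continuous_intros]:
  assumes "continuous_on A g" "continuous_on A h" shows "continuous_on A (\<lambda>x. Q (g x) (h x))"
  using continuous_on_compose2[OF Q_cont continuous_on_Pair[OF assms]] by simp

lemma q_cont_on [continuous_intros]:
  assumes "continuous_on A g" "continuous_on A h" shows "continuous_on A (\<lambda>x. q (g x) (h x))"
  unfolding q_def by (intro continuous_intros assms)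

text \<open>Uniqueness for the system holds only away from the singular point. Vanishing data at s
  spread to all t s with 0 < t \<le> 1; then f vanishes at 0 by continuity, against the
  normalisation f 0 l = 1.\<close>

lemma nonzero: "(f s l)\<^sup>2 + (q s l)\<^sup>2 > 0"
proof (rule ccontr)
  assume "\<not> ?thesis"
  then have z: "f s l = 0" "q s l = 0"
    by (smt (verit) zero_le_power2 zero_less_power2)+
  have s0: "s \<noteq> 0" using z f_at_0 by auto
  have zero: "f (t * s) l = 0" if t: "0 < t" "t \<le> 1" for t
  proof -
    define a where "a = min (t * s) s"
    define b where "b = max (t * s) s"
    have ab: "a \<le> s" "s \<le> b" "a \<le> t * s" "t * s \<le> b" by (auto simp: a_def b_def)
    have ne: "x \<noteq> 0" if "x \<in> {a..b}" for x
    proof (cases "s > 0")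
      case True
      then have "a > 0" using t by (auto simp: a_def)
      then show ?thesis using that by auto
    next
      case False
      then have "b < 0" using t s0 by (auto simp: b_def mult_pos_neg)
      then show ?thesis using that by auto
    qed
    show ?thesis
    proof (rule linear_system_zero[of a b "\<lambda>x. f x l" P "\<lambda>x. q x l" "\<lambda>x. l * V x" s])
      show "((\<lambda>x. f x l) has_real_derivative P x * q x l) (at x)" if "a \<le> x" "x \<le> b" for x
        using f_deriv[of l x] Q_eq[of x l] ne[of x] that by simp
      show "continuous_on {a..b} P" unfolding P_def
        by (intro continuous_intros) (use ne H_pos in \<open>auto simp: less_imp_neq[THEN not_sym]\<close>)
      show "continuous_on {a..b} (\<lambda>x. l * V x)" unfolding V_def by (intro continuous_intros)
    qed (use ab z q_deriv in auto)
  qed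
  have "((\<lambda>t. f (t * s) l) \<longlongrightarrow> f (0 * s) l) (at_right 0)"
  proof -
    have "continuous_on UNIV (\<lambda>t. f (t * s) l)" by (intro continuous_intros)
    then have "((\<lambda>t. f (t * s) l) \<longlongrightarrow> f (0 * s) l) (at 0 within UNIV)"
      unfolding continuous_on_def by blast
    then show ?thesis by (rule tendsto_within_subset) simp
  qed
  moreover have "\<forall>\<^sub>F t in at_right 0. f (t * s) l = 0"
    using eventually_at_right_real[of 0 1] by (rule eventually_mono) (use zero in auto)
  then have "((\<lambda>t. f (t * s) l) \<longlongrightarrow> 0) (at_right 0)" by (rule tendsto_eventually)
  ultimately have "f (0 * s) l = 0" by (rule tendsto_unique[OF trivial_limit_at_right_real])
  then show False by (simp add: f_at_0)
qed

lemma rate_cont_on [continuous_intros]: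
  assumes "continuous_on A g" "continuous_on A h" shows "continuous_on A (\<lambda>x. rate (g x) (h x))"
  unfolding rate_def by (intro continuous_intros assms) (metis less_irrefl nonzero)

lemma angle_deriv: "((\<lambda>s. angle s l) has_real_derivative s ^ m * rate s l) (at s)"
  unfolding angle_def by (rule primitive_has_derivative) (intro continuous_intros)

lemma angle_cont_l: "continuous_on UNIV (\<lambda>l. angle s l)"
  unfolding angle_def interval_cbox
  by (intro continuous_intros integral_continuous_on_param)
     (auto simp: split_beta intro!: continuous_intros)

lemma angle_at_0: "angle 0 l = 0" by (simp add: angle_def)

lemma angle_cont_s: "continuous_on A (\<lambda>s. angle s l)"
  by (rule DERIV_continuous_on[OF has_field_derivative_at_within[OF angle_deriv]])

lemma rate_mult: "s ^ m * rate s l = (q s l * Q s l - f s l * - (l * V s * f s l)) / ((f s l)\<^sup>2 + (q s l)\<^sup>2)"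
  by (simp add: rate_def q_def V_def power2_eq_square algebra_simps add_divide_distrib)

lemma angle_relation:
  assumes "s \<ge> 0" shows "f s l * sin (angle s l) + q s l * cos (angle s l) = 0"
proof (rule pruefer_angle[of 0 s "\<lambda>s. f s l" "\<lambda>s. Q s l" "\<lambda>s. q s l" "\<lambda>s. - (l * V s * f s l)" "\<lambda>s. angle s l"])
  show "((\<lambda>s. angle s l) has_real_derivative
      (q x l * Q x l - f x l * - (l * V x * f x l)) / ((f x l)\<^sup>2 + (q x l)\<^sup>2)) (at x)" for x
    using angle_deriv[of l x] unfolding rate_mult .
  show "continuous_on {0..s} (\<lambda>s. - (l * V s * f s l))" unfolding V_def by (intro continuous_intros)
qed (use assms in \<open>auto intro!: f_deriv q_deriv nonzero continuous_intros simp: q_at_0 angle_at_0\<close>)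

lemma angle_ode:
  assumes "s > 0"
  shows "((\<lambda>s. angle s l) has_real_derivative
     P s * (sin (angle s l))\<^sup>2 + l * V s * (cos (angle s l))\<^sup>2) (at s)"
proof -
  have "s ^ m * rate s l = (P s * (q s l)\<^sup>2 + l * V s * (f s l)\<^sup>2) / ((f s l)\<^sup>2 + (q s l)\<^sup>2)"
    unfolding rate_mult using Q_eq[of s l] assms by (simp add: power2_eq_square algebra_simps)
  also have "\<dots> = P s * (sin (angle s l))\<^sup>2 + l * V s * (cos (angle s l))\<^sup>2"
    by (rule pruefer_rate[OF angle_relation]) (use assms nonzero[of s l] in auto)
  finally show ?thesis using angle_deriv[of l s] by simp
qed

text \<open>The angle is the integral of s^m times a bounded function, hence O(s^(m+1)), which is
  just what the order of the pole of P demands.\<close>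

lemma angle_datum: "angle_datum m b (\<lambda>s. angle s l) P (\<lambda>s. l * V s)"
proof -
  have "continuous_on {0..b} (\<lambda>s. 1 / H s)"
    by (intro continuous_intros) (metis H_pos less_irrefl)
  from continuous_on_Icc_bounded[OF this] obtain A where
    A: "A > 0" "\<And>s. s \<in> {0..b} \<Longrightarrow> \<bar>1 / H s\<bar> \<le> A" by blast
  have "continuous_on {0..b} (\<lambda>s. l * V s)" unfolding V_def by (intro continuous_intros)
  from continuous_on_Icc_bounded[OF this] obtain B where
    B: "B > 0" "\<And>s. s \<in> {0..b} \<Longrightarrow> \<bar>l * V s\<bar> \<le> B" by blast
  have "continuous_on {0..b} (\<lambda>s. rate s l)" by (intro continuous_intros)
  from continuous_on_Icc_bounded[OF this] obtain C where
    C: "C > 0" "\<And>s. s \<in> {0..b} \<Longrightarrow> \<bar>rate s l\<bar> \<le> C" by blast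
  define M where "M = max A (max B C)"
  show ?thesis unfolding angle_datum_def
  proof (intro conjI exI[of _ M] allI impI)
    fix s assume "0 < s \<and> s \<le> b"
    then have s: "0 < s" "s \<le> b" by auto
    show "0 \<le> P s" using P_pos[OF s(1)] by simp
    show "P s * s ^ (m + 1) \<le> M" using A(2)[of s] s H_pos[of s] by (auto simp: P_def M_def)
    show "\<bar>l * V s\<bar> \<le> M" using B(2)[of s] s by (auto simp: M_def)
    have "\<bar>integral {0..1} (\<lambda>t. (t * s) ^ m * rate (t * s) l)\<bar> \<le> (s ^ m * C) * (1 - 0)"
      unfolding real_norm_def[symmetric]
    proof (rule integral_bound)
      fix t :: real assume t: "t \<in> {0..1}"
      then have ts: "0 \<le> t * s" "t * s \<le> s" using s by (auto simp: mult_le_cancel_right1)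
      have "\<bar>rate (t * s) l\<bar> \<le> C" using order_trans[OF ts(2) s(2)] ts(1) by (intro C(2)) auto
      have "norm ((t * s) ^ m * rate (t * s) l) = (t * s) ^ m * \<bar>rate (t * s) l\<bar>"
        using ts by (simp add: abs_mult)
      also have "\<dots> \<le> s ^ m * C" using ts \<open>\<bar>rate (t * s) l\<bar> \<le> C\<close> s C(1) by (intro mult_mono power_mono) auto
      finally show "norm ((t * s) ^ m * rate (t * s) l) \<le> s ^ m * C" .
    qed (auto intro!: continuous_intros)
    then have "\<bar>angle s l\<bar> \<le> s * (s ^ m * C)"
      using s by (simp add: angle_def abs_mult)
    also have "\<dots> = C * s ^ (m + 1)" by (simp add: ac_simps)
    also have "\<dots> \<le> M * s ^ (m + 1)" using s by (intro mult_right_mono) (auto simp: M_def)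
    finally show "\<bar>angle s l\<bar> \<le> M * s ^ (m + 1)" .
  qed (auto simp: angle_at_0 intro: angle_cont_s angle_ode)
qed

text \<open>Raising l enlarges the coefficient l V and leaves P alone, so the problem is compared
  with itself.\<close>

lemma angle_strict_mono:
  assumes b: "b > 0" and l: "l1 < l2"
  shows "angle b l1 < angle b l2"
  by (rule angle_datum_comparison(2)[OF angle_datum angle_datum b])
     (use l V_pos in \<open>auto simp: mult_right_mono mult_strict_right_mono less_imp_le\<close>)

lemma q_l_0: "q s 0 = 0"
proof -
  have "\<forall>x. ((\<lambda>s. q s 0) has_real_derivative 0) (at x)" using q_deriv[of 0] by simp
  then have "q s 0 = q 0 0" using DERIV_isconst_all by blast
  then show ?thesis by (simp add: q_at_0)
qed

lemma angle_l_0: "angle s 0 = 0"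
proof -
  have "s ^ m * rate s 0 = 0" for s unfolding rate_mult by (simp add: q_l_0)
  then show ?thesis unfolding angle_def by (simp only: integral_0 mult_zero_right)
qed

lemma angle_nonneg: "b > 0 \<Longrightarrow> l \<ge> 0 \<Longrightarrow> angle b l \<ge> 0"
  using angle_strict_mono[of b 0 l] angle_l_0[of b] by (cases "l = 0") auto

text \<open>Between b/2 and b the problem is nonsingular and its coefficients dominate the constants
  c and l c. The comparison angle starts at 0 in b/2, below the nonnegative given one, and grows
  without bound with l.\<close>

lemma angle_unbounded:
  assumes b: "b > 0" shows "\<exists>l\<ge>0. angle b l \<ge> y"
proof -
  have "continuous_on {b/2..b} P" unfolding P_def using b H_pos
    by (intro continuous_intros) (auto simp: less_imp_neq[THEN not_sym])
  then obtain c1 where c1: "c1 > 0" "\<And>s. s \<in> {b/2..b} \<Longrightarrow> c1 \<le> P s"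
    using continuous_on_Icc_lower_bound[of "b/2" b P] P_pos b by (metis atLeastAtMost_iff half_gt_zero less_le_trans)
  have "continuous_on {b/2..b} V" unfolding V_def by (intro continuous_intros)
  then obtain c2 where c2: "c2 > 0" "\<And>s. s \<in> {b/2..b} \<Longrightarrow> c2 \<le> V s"
    using continuous_on_Icc_lower_bound[of "b/2" b V] V_pos b by (metis atLeastAtMost_iff half_gt_zero less_le_trans)
  define c where "c = min c1 c2"
  have c: "c > 0" "\<And>s. b/2 \<le> s \<Longrightarrow> s \<le> b \<Longrightarrow> c \<le> P s" "\<And>s. b/2 \<le> s \<Longrightarrow> s \<le> b \<Longrightarrow> c \<le> V s"
    using c1 c2 by (auto simp: c_def min_le_iff_disj)
  obtain n :: nat where n: "y < real n * pi" using reals_Archimedean3[OF pi_gt_zero] by blast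
  \<comment> \<open>The shift keeps n' positive even for n = 0, hence also w and l.\<close>
  define n' where "n' = Suc n"
  have n': "y < real n' * pi" using n pi_gt_zero unfolding n'_def of_nat_Suc distrib_right by linarith
  \<comment> \<open>Chosen so that sqrt l * c * (b/2) = n' \<pi>: over the length b/2 the comparison
    angle makes n' half turns.\<close>
  define w where "w = real n' * pi / (c * b / 2)"
  define l where "l = w\<^sup>2"
  have w: "w > 0" using c b by (simp add: w_def n'_def)
  have l: "l > 0" "sqrt l = w" using w by (auto simp: l_def)
  obtain B where B: "\<And>x. (B has_real_derivative c * (sin (B x))\<^sup>2 + l * c * (cos (B x))\<^sup>2) (at x) \<or> x < 0"
    "B 0 = 0" "\<And>n::nat. B (real n * pi / (sqrt l * c)) \<ge> real n * pi" "\<And>x. isCont B x"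
    using constant_coefficient_angle[OF c(1) l(1)] by blast
  have n'_eq: "real n' * pi / (sqrt l * c) = b / 2"
  proof -
    have "real n' * pi = w * (c * b / 2)" using c b by (simp add: w_def)
    then show ?thesis using w c unfolding l by (simp add: field_simps)
  qed
  have Bb: "real n' * pi \<le> B (b / 2)" using B(3)[of n'] unfolding n'_eq .
  define \<beta> where "\<beta> = (\<lambda>s. B (s - b/2))"
  have cB: "continuous_on A \<beta>" for A unfolding \<beta>_def
    by (rule continuous_on_compose2[of UNIV B]) (auto intro!: continuous_intros continuous_at_imp_continuous_on B(4))
  have "continuous_on {b/2..b} (\<lambda>s. \<bar>c - l * c\<bar> * \<bar>angle s l + \<beta> s\<bar>)"
    by (intro continuous_intros cB angle_cont_s)
  from continuous_on_Icc_bounded[OF this] obtain K where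
    K: "\<And>s. s \<in> {b/2..b} \<Longrightarrow> \<bar>\<bar>c - l * c\<bar> * \<bar>angle s l + \<beta> s\<bar>\<bar> \<le> K" by blast
  have "\<beta> b \<le> angle b l"
  proof (rule angle_comparison(1)[where a = "b/2" and \<alpha> = "\<lambda>s. angle s l" and ?P1.0 = P and ?V1.0 = "\<lambda>s. l * V s"
        and ?P2.0 = "\<lambda>_. c" and ?V2.0 = "\<lambda>_. l * c" and K = K])
    fix s assume s: "b / 2 < s" "s \<le> b"
    show "((\<lambda>s. angle s l) has_real_derivative P s * (sin (angle s l))\<^sup>2 + l * V s * (cos (angle s l))\<^sup>2) (at s)"
      using angle_ode s b by simp
    have dB: "(B has_real_derivative c * (sin (B (s - b/2)))\<^sup>2 + l * c * (cos (B (s - b/2)))\<^sup>2) (at (s - b/2))"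
      using B(1)[of "s - b/2"] s by auto
    have ds: "((\<lambda>s. s - b/2) has_real_derivative 1) (at s)" by (auto intro!: derivative_eq_intros)
    show "(\<beta> has_real_derivative c * (sin (\<beta> s))\<^sup>2 + l * c * (cos (\<beta> s))\<^sup>2) (at s)"
      unfolding \<beta>_def using DERIV_chain2[where f = B and g = "\<lambda>s. s - b/2", OF dB ds] by simp
    show "c \<le> P s" "l * c \<le> l * V s" using c s l by (auto intro!: mult_left_mono)
    show "\<bar>c - l * c\<bar> * \<bar>angle s l + \<beta> s\<bar> \<le> K" using K[of s] s by auto
  qed (use b B(2) l in \<open>auto intro!: cB[unfolded \<beta>_def] angle_cont_s angle_nonneg simp: \<beta>_def\<close>)
  moreover have "\<beta> b = B (b/2)" by (simp add: \<beta>_def field_simps)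
  ultimately show ?thesis using Bb n' l by (intro exI[of _ l]) auto
qed

text \<open>The flux equation integrated from 0 and divided by s^(m+1), extended to s = 0 by
  continuity. The right hand side is a weighted average of H k f over the segment from 0 to s, the
  form from which regularity at the pole is read off.\<close>

lemma Q_integral: "H s * Q s l = - l * integral {0..1} (\<lambda>t. t ^ m * (H (t * s) * k (t * s) * f (t * s) l))"
proof -
  define R where "R = (\<lambda>s. - l * integral {0..1} (\<lambda>t. t ^ m * (H (t * s) * k (t * s) * f (t * s) l)))"
  define g where "g = (\<lambda>x. - l * V x * f x l)"
  have cg: "continuous_on UNIV g" unfolding g_def V_def by (intro continuous_intros)
  have eq: "s * integral {0..1} (\<lambda>t. g (t * s)) = s ^ (m + 1) * R s" for s
  proof -
    have "integral {0..1} (\<lambda>t. g (t * s))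
        = integral {0..1} (\<lambda>t. (- l * s ^ m) * (t ^ m * (H (t * s) * k (t * s) * f (t * s) l)))"
      by (rule integral_cong) (simp add: g_def V_def power_mult_distrib ac_simps)
    then show ?thesis by (simp add: R_def)
  qed
  have "((\<lambda>s. q s l - s * integral {0..1} (\<lambda>t. g (t * s))) has_real_derivative - (l * V x * f x l) - g x) (at x)" for x
    by (rule DERIV_diff[OF q_deriv primitive_has_derivative[OF cg]])
  then have "\<forall>x. ((\<lambda>s. q s l - s * integral {0..1} (\<lambda>t. g (t * s))) has_real_derivative 0) (at x)"
    by (simp add: g_def)
  from DERIV_isconst_all[OF this, of _ 0] have qR: "q s l = s ^ (m + 1) * R s" for s
    by (simp add: q_at_0 eq del: power_Suc)
  have ne: "H s * Q s l = R s" if "s \<noteq> 0" for s using that qR[of s] by (simp add: q_def)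
  have cont: "continuous_on UNIV (\<lambda>s. H s * Q s l)" "continuous_on UNIV R"
    unfolding R_def interval_cbox
    by (intro continuous_intros integral_continuous_on_param | auto simp: split_beta intro!: continuous_intros)+
  have "H s * Q s l = R s"
  proof (cases "s = 0")
    case True
    have "((\<lambda>s. H s * Q s l) \<longlongrightarrow> H 0 * Q 0 l) (at 0)" "(R \<longlongrightarrow> R 0) (at 0)"
      using cont unfolding continuous_on_def by auto
    moreover have "\<forall>\<^sub>F s in at 0. H s * Q s l = R s" unfolding eventually_at_filter using ne by simp
    ultimately have "(R \<longlongrightarrow> H 0 * Q 0 l) (at 0)" "(R \<longlongrightarrow> R 0) (at 0)"
      using tendsto_cong by fast+
    then show ?thesis using True tendsto_unique[OF at_neq_bot] by blast
  qed (rule ne)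
  then show ?thesis by (simp add: R_def)
qed

text \<open>The product f q vanishes at 0 and has derivative P q^2 - l V f^2, which is positive for
  l < 0.\<close>

lemma negative_parameter:
  assumes s: "s > 0" and l: "l < 0"
  shows "f s l * q s l > 0"
proof -
  have "f 0 l * q 0 l < f s l * q s l"
  proof (rule DERIV_pos_imp_increasing_open[OF s])
    fix x assume x: "0 < x" "x < s"
    have "((\<lambda>s. f s l * q s l) has_real_derivative Q x l * q x l + - (l * V x * f x l) * f x l) (at x)"
      by (rule DERIV_mult[OF f_deriv q_deriv])
    also have "Q x l * q x l + - (l * V x * f x l) * f x l = P x * (q x l)\<^sup>2 + (- l) * V x * (f x l)\<^sup>2"
      using Q_eq[of x l] x by (simp add: power2_eq_square algebra_simps)
    finally have d: "((\<lambda>s. f s l * q s l) has_real_derivative P x * (q x l)\<^sup>2 + (- l) * V x * (f x l)\<^sup>2) (at x)" .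
    have "0 < P x * (q x l)\<^sup>2 + (- l) * V x * (f x l)\<^sup>2"
    proof (cases "f x l = 0")
      case True
      then have "(q x l)\<^sup>2 > 0" using nonzero[of x l] by simp
      then show ?thesis using True P_pos[of x] x by simp
    next
      case False
      then show ?thesis using P_pos[of x] V_pos[of x] x l by (intro add_nonneg_pos mult_pos_pos) auto
    qed
    then show "\<exists>y. ((\<lambda>s. f s l * q s l) has_real_derivative y) (at x) \<and> 0 < y" using d by blast
  qed (intro continuous_intros)
  then show ?thesis by (simp add: q_at_0)
qed

end

section \<open>Gluing two regular solutions: eigenvalues as levels of the total angle\<close>

lemma level_listing:
  fixes \<Theta> :: "real \<Rightarrow> real"
  assumes cont: "continuous_on UNIV \<Theta>" and mono: "\<And>x y. x < y \<Longrightarrow> \<Theta> x < \<Theta> y"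
    and zero: "\<Theta> 0 = 0" and unb: "\<And>y. \<exists>x\<ge>0. y \<le> \<Theta> x"
  obtains a where "strict_mono a" "a 0 = (0::real)" "\<And>j. \<Theta> (a j) = real j * pi" "\<And>j. a j \<ge> 0"
    "\<And>x. x \<ge> 0 \<Longrightarrow> (\<exists>i::int. \<Theta> x = of_int i * pi) \<longleftrightarrow> x \<in> range a"
proof -
  have le: "\<Theta> x \<le> \<Theta> y \<longleftrightarrow> x \<le> y" for x y using mono by (metis not_le less_le_not_le order_less_le)
  have inj: "\<Theta> x = \<Theta> y \<Longrightarrow> x = y" for x y using le by (metis order_antisym order_refl)
  have "\<exists>x\<ge>0. \<Theta> x = real j * pi" for j
  proof -
    obtain x where x: "x \<ge> 0" "real j * pi \<le> \<Theta> x" using unb by blast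
    then have "\<exists>t\<ge>0. t \<le> x \<and> \<Theta> t = real j * pi"
      by (intro IVT') (auto simp: zero intro: continuous_on_subset[OF cont])
    then show ?thesis by blast
  qed
  then obtain a where a: "\<And>j. a j \<ge> 0" "\<And>j. \<Theta> (a j) = real j * pi" by metis
  have "strict_mono a"
  proof (rule strict_monoI)
    fix i j :: nat assume "i < j"
    then have "\<not> \<Theta> (a j) \<le> \<Theta> (a i)" unfolding a by simp
    then show "a i < a j" by (simp add: le)
  qed
  moreover have "a 0 = 0" using inj[of "a 0" 0] a(2)[of 0] zero by simp
  moreover have "(\<exists>i::int. \<Theta> x = of_int i * pi) \<longleftrightarrow> x \<in> range a" if "x \<ge> 0" for x
  proof
    assume "\<exists>i::int. \<Theta> x = of_int i * pi"
    then obtain i :: int where i: "\<Theta> x = of_int i * pi" by blast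
    have "0 \<le> \<Theta> x" using le[of 0 x] that zero by simp
    then have "0 \<le> i" unfolding i using pi_gt_zero by (simp add: zero_le_mult_iff not_le[symmetric])
    then have "\<Theta> x = \<Theta> (a (nat i))" unfolding a i by simp
    then show "x \<in> range a" using inj by blast
  next
    assume "x \<in> range a"
    then show "\<exists>i::int. \<Theta> x = of_int i * pi" using a(2) by (metis imageE of_int_of_nat_eq)
  qed
  ultimately show ?thesis using that a by blast
qed

text \<open>L belongs to the pole z = 0, where the weight has order 0 in s, and R to infinity, with
  order m. The two variables run towards each other; b1 and b2 are the coordinates of the meeting
  point.\<close>

locale matching = L: radial_sol 0 H1 k1 f1 Q1 + R: radial_sol m H2 k2 f2 Q2
  for m H1 k1 f1 Q1 H2 k2 f2 Q2 +
  fixes b1 b2 :: real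
  assumes b_pos: "b1 > 0" "b2 > 0"
begin

text \<open>The Wronskian of the two regular solutions at the meeting point. The variable of R has
  the opposite direction, so its flux changes sign and the usual difference becomes a sum.\<close>

definition disc :: "real \<Rightarrow> real" where
  "disc l = f1 b1 l * R.q b2 l + L.q b1 l * f2 b2 l"

definition total_angle :: "real \<Rightarrow> real" where
  "total_angle l = L.angle b1 l + R.angle b2 l"

lemma total_angle_mono: "x < y \<Longrightarrow> total_angle x < total_angle y"
  unfolding total_angle_def using L.angle_strict_mono R.angle_strict_mono b_pos by (simp add: add_strict_mono)

text \<open>In polar form the discriminant is - C1 C2 sin (\<alpha> + \<beta>), with nonzero radii
  C1 and C2.\<close>

lemma disc_iff: "disc l = 0 \<longleftrightarrow> (\<exists>i::int. total_angle l = of_int i * pi)"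
proof -
  obtain C1 where C1: "f1 b1 l = C1 * cos (L.angle b1 l)" "L.q b1 l = - (C1 * sin (L.angle b1 l))"
     "C1\<^sup>2 = (f1 b1 l)\<^sup>2 + (L.q b1 l)\<^sup>2" using pruefer_polar[OF L.angle_relation] b_pos by (metis less_imp_le)
  obtain C2 where C2: "f2 b2 l = C2 * cos (R.angle b2 l)" "R.q b2 l = - (C2 * sin (R.angle b2 l))"
     "C2\<^sup>2 = (f2 b2 l)\<^sup>2 + (R.q b2 l)\<^sup>2" using pruefer_polar[OF R.angle_relation] b_pos by (metis less_imp_le)
  have "C1 \<noteq> 0" "C2 \<noteq> 0" using C1(3) C2(3) L.nonzero[of b1 l] R.nonzero[of b2 l] by auto
  moreover have "disc l = - C1 * C2 * sin (total_angle l)"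
    unfolding disc_def C1(1,2) C2(1,2) total_angle_def sin_add by algebra
  ultimately show ?thesis by (simp add: sin_zero_iff_int2)
qed

text \<open>Multiplication of the discriminant by both fluxes gives a sum of two terms, each a
  product f q, positive for l < 0, times a nonzero square.\<close>

lemma disc_negative: "l < 0 \<Longrightarrow> disc l \<noteq> 0"
proof
  assume l: "l < 0" and d: "disc l = 0"
  have p: "f1 b1 l * L.q b1 l > 0" "f2 b2 l * R.q b2 l > 0"
    using L.negative_parameter R.negative_parameter b_pos l by auto
  have "(f1 b1 l * L.q b1 l) * (R.q b2 l)\<^sup>2 + (L.q b1 l)\<^sup>2 * (f2 b2 l * R.q b2 l) = 0"
    using arg_cong[OF d, of "\<lambda>x. x * (L.q b1 l * R.q b2 l)"] unfolding disc_def by algebra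
  moreover have "L.q b1 l \<noteq> 0" "R.q b2 l \<noteq> 0" using p by auto
  then have "(f1 b1 l * L.q b1 l) * (R.q b2 l)\<^sup>2 + (L.q b1 l)\<^sup>2 * (f2 b2 l * R.q b2 l) > 0"
    using p by (intro add_pos_pos mult_pos_pos[OF p(1)] mult_pos_pos[OF _ p(2)]) auto
  ultimately show False by simp
qed

lemma listing:
  obtains a where "increasing_listing a {l. disc l = 0}" "a 0 = 0" "\<And>j. a j \<ge> 0"
    "\<And>j. total_angle (a j) = real j * pi"
proof -
  obtain a where a: "strict_mono a" "a 0 = (0::real)" "\<And>j. total_angle (a j) = real j * pi" "\<And>j. a j \<ge> 0"
    "\<And>x. x \<ge> 0 \<Longrightarrow> (\<exists>i::int. total_angle x = of_int i * pi) \<longleftrightarrow> x \<in> range a"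
  proof (rule level_listing[of total_angle])
    show "continuous_on UNIV total_angle" unfolding total_angle_def
      by (intro continuous_intros L.angle_cont_l R.angle_cont_l)
    show "total_angle 0 = 0" by (simp add: total_angle_def L.angle_l_0 R.angle_l_0)
    fix y
    obtain x where "x \<ge> 0" "y \<le> L.angle b1 x" using L.angle_unbounded[OF b_pos(1)] by blast
    then show "\<exists>x\<ge>0. y \<le> total_angle x"
      using R.angle_nonneg[OF b_pos(2), of x] by (intro exI[of _ x]) (auto simp: total_angle_def)
  qed (use total_angle_mono in auto)
  have "range a = {l. disc l = 0}"
    using a(4,5) disc_iff disc_negative by (auto simp: not_less[symmetric]) (metis not_less)+
  then show ?thesis using that a unfolding increasing_listing_def by blast
qed

end

section \<open>Existence of the regular solution\<close>

lemma integral_power_01: "integral {0..1} (\<lambda>t::real. t ^ n) = 1 / (real n + 1)"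
proof -
  have "((\<lambda>t::real. t ^ n) has_integral 1 ^ (n + 1) / (real n + 1) - 0 ^ (n + 1) / (real n + 1)) {0..1}"
  proof (rule fundamental_theorem_of_calculus)
    fix x :: real
    have "((\<lambda>t. t ^ (n + 1) / (real n + 1)) has_real_derivative (real (n + 1) * x ^ n) / (real n + 1)) (at x)"
      by (rule derivative_eq_intros refl | simp)+
    then show "((\<lambda>t. t ^ (n + 1) / (real n + 1)) has_vector_derivative x ^ n) (at x within {0..1})"
      by (simp add: has_real_derivative_iff_has_vector_derivative[symmetric] has_field_derivative_at_within add.commute)
  qed simp
  then show ?thesis by (simp add: integral_unique)
qed

text \<open>Picard iteration, arranged as a power series in - l with coefficients c_n(s), each
  obtained from the previous one by solving the flux equation. The inner integration from 0, divided
  by s^(m+1) H, is the rescaled integral \<open>E\<close>, which is regular at the singular point.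
  The series converges locally uniformly in (s, l), whence the joint continuity.\<close>

lemma radial_sol_exists:
  assumes H_cont: "continuous_on UNIV H" and k_cont: "continuous_on UNIV k"
    and H_pos: "\<And>s. H s > 0" and k_pos: "\<And>s. k s > 0"
  obtains f Q where "radial_sol m H k f Q"
proof -
  note [continuous_intros] = continuous_on_compose2[OF H_cont _ subset_UNIV]
     continuous_on_compose2[OF k_cont _ subset_UNIV]
  have Hne: "H s \<noteq> 0" for s using H_pos[of s] by simp
  define E where "E = (\<lambda>g s. integral {0..1} (\<lambda>t. t ^ m * (H (t * s) * k (t * s) * g (t * s))) / H s)"
  define I where "I = (\<lambda>g (s::real). s * integral {0..1} (\<lambda>t. g (t * s) :: real))"
  define c where "c = rec_nat (\<lambda>_. 1) (\<lambda>_ g. I (E g))"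
  have c0: "c 0 s = 1" and cS: "c (Suc n) = I (E (c n))" for n s by (simp_all add: c_def)
  have contE: "continuous_on UNIV (E g)" if "continuous_on UNIV g" for g
  proof -
    note [continuous_intros] = continuous_on_compose2[OF that _ subset_UNIV]
    show ?thesis unfolding E_def interval_cbox using Hne
      by (intro continuous_intros integral_continuous_on_param | auto simp: split_beta intro!: continuous_intros)+
  qed
  have dI: "(I g has_real_derivative g s) (at s)" if "continuous_on UNIV g" for g s
    unfolding I_def by (rule primitive_has_derivative[OF that])
  have contI: "continuous_on UNIV (I g)" if "continuous_on UNIV g" for g
    using dI[OF that] by (auto intro!: continuous_at_imp_continuous_on DERIV_isCont)
  have contc: "continuous_on UNIV (c n)" for n
  proof (induction n)
    case 0
    have "c 0 = (\<lambda>_. 1)" using c0 by auto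
    then show ?case by simp
  next
    case (Suc n)
    then show ?case unfolding cS by (intro contI contE)
  qed
  have dc: "(c (Suc n) has_real_derivative E (c n) s) (at s)" for n s
    unfolding cS by (rule dI[OF contE[OF contc]])
  have dE: "((\<lambda>s. s ^ (m + 1) * H s * E (c n) s) has_real_derivative s ^ m * (H s * k s * c n s)) (at s)" for n s
  proof -
    define g where "g = (\<lambda>s. s ^ m * (H s * k s * c n s))"
    have "continuous_on UNIV g" unfolding g_def by (intro continuous_intros contc)
    from dI[OF this] have "(I g has_real_derivative g s) (at s)" for s .
    moreover have "I g = (\<lambda>s. s ^ (m + 1) * H s * E (c n) s)"
    proof
      fix s
      have "integral {0..1} (\<lambda>t. g (t * s))
          = integral {0..1} (\<lambda>t. s ^ m * (t ^ m * (H (t * s) * k (t * s) * c n (t * s))))"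
        by (rule integral_cong) (simp add: g_def power_mult_distrib ac_simps)
      then show "I g s = s ^ (m + 1) * H s * E (c n) s" using Hne[of s] by (simp add: I_def E_def)
    qed
    ultimately show ?thesis by (simp add: g_def)
  qed
  \<comment> \<open>B is the product of bounds for H k and for 1/H. The outer integration
    contributes 1/(n + 1) at each step, which turns the geometric growth into the exponential
    series.\<close>
  have bounds: "\<exists>B>0. \<forall>n s. \<bar>s\<bar> \<le> R \<longrightarrow> \<bar>c n s\<bar> \<le> (B * \<bar>s\<bar>) ^ n / fact n \<and> \<bar>E (c n) s\<bar> \<le> B * ((B * \<bar>s\<bar>) ^ n / fact n)" for R
  proof -
    have "continuous_on {-R..R} (\<lambda>s. H s * k s)" by (intro continuous_intros)
    from continuous_on_Icc_bounded[OF this] obtain B1 where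
      B1: "B1 > 0" "\<And>s. s \<in> {-R..R} \<Longrightarrow> \<bar>H s * k s\<bar> \<le> B1" by blast
    have "continuous_on {-R..R} (\<lambda>s. 1 / H s)" by (intro continuous_intros) (auto simp: Hne)
    from continuous_on_Icc_bounded[OF this] obtain B2 where
      B2: "B2 > 0" "\<And>s. s \<in> {-R..R} \<Longrightarrow> \<bar>1 / H s\<bar> \<le> B2" by blast
    define B where "B = B1 * B2"
    have B: "B > 0" using B1 B2 by (simp add: B_def)
    have absb: "\<bar>t * s\<bar> \<le> \<bar>s\<bar>" if "t \<in> {0..1}" for t s :: real
      using that by (simp add: abs_mult mult_left_le_one_le)
    have Eb: "\<bar>E (c n) s\<bar> \<le> B * ((B * \<bar>s\<bar>) ^ n / fact n)"
      if s: "\<bar>s\<bar> \<le> R" and IH: "\<And>s. \<bar>s\<bar> \<le> R \<Longrightarrow> \<bar>c n s\<bar> \<le> (B * \<bar>s\<bar>) ^ n / fact n" for n s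
    proof -
      have "norm (integral {0..1} (\<lambda>t. t ^ m * (H (t * s) * k (t * s) * c n (t * s))))
          \<le> (1 * (B1 * ((B * \<bar>s\<bar>) ^ n / fact n))) * (1 - 0)"
      proof (rule integral_bound)
        fix t :: real assume t: "t \<in> {0..1}"
        have ts: "\<bar>t * s\<bar> \<le> R" using absb[OF t, of s] s by linarith
        then have tsI: "t * s \<in> {-R..R}" by auto
        have "\<bar>c n (t * s)\<bar> \<le> (B * \<bar>t * s\<bar>) ^ n / fact n" by (rule IH[OF ts])
        also have "\<dots> \<le> (B * \<bar>s\<bar>) ^ n / fact n" using B absb[OF t, of s]
          by (intro divide_right_mono power_mono mult_left_mono) auto
        finally have 1: "\<bar>c n (t * s)\<bar> \<le> (B * \<bar>s\<bar>) ^ n / fact n" .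
        have "norm (t ^ m * (H (t * s) * k (t * s) * c n (t * s))) = t ^ m * (\<bar>H (t * s) * k (t * s)\<bar> * \<bar>c n (t * s)\<bar>)"
          using t by (simp add: abs_mult)
        also have "\<dots> \<le> 1 * (B1 * ((B * \<bar>s\<bar>) ^ n / fact n))"
          using t B1(1) by (intro mult_mono B1(2)[OF tsI] 1 power_le_one) auto
        finally show "norm (t ^ m * (H (t * s) * k (t * s) * c n (t * s))) \<le> 1 * (B1 * ((B * \<bar>s\<bar>) ^ n / fact n))" .
      qed (auto intro!: continuous_intros continuous_on_compose2[OF contc])
      then have 1: "\<bar>integral {0..1} (\<lambda>t. t ^ m * (H (t * s) * k (t * s) * c n (t * s)))\<bar> \<le> B1 * ((B * \<bar>s\<bar>) ^ n / fact n)"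
        by simp
      have "\<bar>E (c n) s\<bar> = \<bar>integral {0..1} (\<lambda>t. t ^ m * (H (t * s) * k (t * s) * c n (t * s)))\<bar> * \<bar>1 / H s\<bar>"
        by (simp add: E_def abs_mult)
      also have "\<dots> \<le> B1 * ((B * \<bar>s\<bar>) ^ n / fact n) * B2"
        using B2(1) B B1 s by (intro mult_mono[OF 1] B2(2)) auto
      finally show ?thesis by (simp add: B_def ac_simps)
    qed
    have cb: "\<bar>c n s\<bar> \<le> (B * \<bar>s\<bar>) ^ n / fact n" if "\<bar>s\<bar> \<le> R" for n s using that
    proof (induction n arbitrary: s)
      case (Suc n)
      have b: "\<bar>E (c n) (t * s)\<bar> \<le> B * ((B * \<bar>s\<bar>) ^ n / fact n) * t ^ n" if t: "t \<in> {0..1}" for t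
      proof -
        have "\<bar>t * s\<bar> \<le> R" using absb[OF t, of s] Suc.prems by linarith
        from Eb[OF this Suc.IH] show ?thesis using t by (simp add: abs_mult power_mult_distrib ac_simps)
      qed
      have "norm (integral {0..1} (\<lambda>t. E (c n) (t * s))) \<le> integral {0..1} (\<lambda>t. B * ((B * \<bar>s\<bar>) ^ n / fact n) * t ^ n)"
      proof (rule integral_norm_bound_integral)
        show "(\<lambda>t. E (c n) (t * s)) integrable_on {0..1}"
          by (intro integrable_continuous_interval continuous_on_compose2[OF contE[OF contc]] continuous_intros) auto
      qed (use b in \<open>auto intro!: integrable_continuous_interval continuous_intros\<close>)
      also have "\<dots> = B * ((B * \<bar>s\<bar>) ^ n / fact n) * (1 / (real n + 1))"
        by (simp add: integral_power_01)
      finally have "\<bar>c (Suc n) s\<bar> \<le> \<bar>s\<bar> * (B * ((B * \<bar>s\<bar>) ^ n / fact n) * (1 / (real n + 1)))"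
        unfolding cS I_def abs_mult by (intro mult_left_mono) auto
      also have "\<dots> = (B * \<bar>s\<bar>) ^ Suc n / fact (Suc n)" by (simp add: field_simps)
      finally show ?case .
    qed (simp add: c0)
    show ?thesis using B cb Eb by blast
  qed
  define F where "F = (\<lambda>n (s::real) (l::real). (- l) ^ n * c n s)"
  define G where "G = (\<lambda>n (s::real) (l::real). (- l) ^ n * E (c n) s)"
  define f where "f = (\<lambda>s l. \<Sum>n. F n s l)"
  define Q where "Q = (\<lambda>s l. - l * (\<Sum>n. G n s l))"
  have Mb: "\<exists>M N. summable M \<and> summable N \<and>
      (\<forall>n s l. \<bar>s\<bar> \<le> R \<longrightarrow> \<bar>l\<bar> \<le> R \<longrightarrow> \<bar>F n s l\<bar> \<le> M n \<and> \<bar>G n s l\<bar> \<le> N n)" for R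
  proof -
    obtain B where B: "B > 0" "\<And>n s. \<bar>s\<bar> \<le> R \<Longrightarrow> \<bar>c n s\<bar> \<le> (B * \<bar>s\<bar>) ^ n / fact n"
      "\<And>n s. \<bar>s\<bar> \<le> R \<Longrightarrow> \<bar>E (c n) s\<bar> \<le> B * ((B * \<bar>s\<bar>) ^ n / fact n)" using bounds[of R] by blast
    define M where "M = (\<lambda>n. (R * (B * R)) ^ n / fact n)"
    have sM: "summable M" unfolding M_def using summable_exp[of "R * (B * R)"] by (simp add: divide_inverse mult.commute)
    have aux: "\<bar>l\<bar> ^ n * ((B * \<bar>s\<bar>) ^ n / fact n) \<le> M n" if "\<bar>s\<bar> \<le> R" "\<bar>l\<bar> \<le> R" for s l n
    proof -
      have "(\<bar>l\<bar> * (B * \<bar>s\<bar>)) ^ n / fact n \<le> M n" unfolding M_def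
        using that B(1) by (intro divide_right_mono power_mono mult_mono) auto
      then show ?thesis by (simp add: power_mult_distrib)
    qed
    have FG: "\<bar>F n s l\<bar> \<le> M n" "\<bar>G n s l\<bar> \<le> B * M n" if sl: "\<bar>s\<bar> \<le> R" "\<bar>l\<bar> \<le> R" for n s l
    proof -
      have "\<bar>F n s l\<bar> \<le> \<bar>l\<bar> ^ n * ((B * \<bar>s\<bar>) ^ n / fact n)"
        unfolding F_def abs_mult power_abs abs_minus_cancel using B(2)[OF sl(1)] by (intro mult_left_mono) auto
      then show "\<bar>F n s l\<bar> \<le> M n" using aux[OF sl] by (rule order_trans)
      have "\<bar>G n s l\<bar> \<le> \<bar>l\<bar> ^ n * (B * ((B * \<bar>s\<bar>) ^ n / fact n))"
        unfolding G_def abs_mult power_abs abs_minus_cancel using B(3)[OF sl(1)] by (intro mult_left_mono) auto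
      also have "\<dots> = B * (\<bar>l\<bar> ^ n * ((B * \<bar>s\<bar>) ^ n / fact n))" by (simp only: ac_simps)
      also have "\<dots> \<le> B * M n" using aux[OF sl] B(1) by (intro mult_left_mono) auto
      finally show "\<bar>G n s l\<bar> \<le> B * M n" .
    qed
    show ?thesis
      by (intro exI[of _ M] exI[of _ "\<lambda>n. B * M n"] conjI allI impI FG sM summable_mult[OF sM])
  qed
  have joint: "continuous_on UNIV (\<lambda>p. \<Sum>n. K n (fst p) (snd p))"
    if cK: "\<And>n. continuous_on UNIV (\<lambda>p. K n (fst p) (snd p))"
      and bK: "\<And>R. \<exists>M. summable M \<and> (\<forall>n s l. \<bar>s\<bar> \<le> R \<longrightarrow> \<bar>l\<bar> \<le> R \<longrightarrow> \<bar>K n s l\<bar> \<le> M n)"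
    for K :: "nat \<Rightarrow> real \<Rightarrow> real \<Rightarrow> real"
  proof -
    have loc: "continuous_on (ball 0 R) (\<lambda>p. \<Sum>n. K n (fst p) (snd p))" for R :: real
    proof -
      obtain M where M: "summable M" "\<And>n s l. \<bar>s\<bar> \<le> R \<Longrightarrow> \<bar>l\<bar> \<le> R \<Longrightarrow> \<bar>K n s l\<bar> \<le> M n" using bK by blast
      have "uniform_limit (ball 0 R) (\<lambda>n p. \<Sum>i<n. K i (fst p) (snd p)) (\<lambda>p. \<Sum>n. K n (fst p) (snd p)) sequentially"
      proof (rule Weierstrass_m_test[OF _ M(1)])
        fix n and p :: "real \<times> real" assume "p \<in> ball 0 R"
        then have "norm p < R" by simp
        then have "\<bar>fst p\<bar> \<le> R" "\<bar>snd p\<bar> \<le> R" using norm_fst_le[of "fst p" "snd p"] norm_snd_le[of "snd p" "fst p"] by auto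
        then show "norm (K n (fst p) (snd p)) \<le> M n" using M(2) by simp
      qed
      then show ?thesis
        by (rule uniform_limit_theorem[rotated])
           (auto intro!: always_eventually continuous_intros continuous_on_subset[OF cK])
    qed
    show ?thesis
    proof (rule continuous_at_imp_continuous_on, rule ballI)
      fix p :: "real \<times> real"
      show "isCont (\<lambda>p. \<Sum>n. K n (fst p) (snd p)) p"
        by (rule continuous_on_interior[OF loc[of "norm p + 1"]]) simp
    qed
  qed
  have sep: "\<exists>M. summable M \<and> (\<forall>n s l. \<bar>s\<bar> \<le> R \<longrightarrow> \<bar>l\<bar> \<le> R \<longrightarrow> \<bar>F n s l\<bar> \<le> M n)"
    "\<exists>M. summable M \<and> (\<forall>n s l. \<bar>s\<bar> \<le> R \<longrightarrow> \<bar>l\<bar> \<le> R \<longrightarrow> \<bar>G n s l\<bar> \<le> M n)" for R using Mb[of R] by blast+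
  have f_cont: "continuous_on UNIV (\<lambda>p. f (fst p) (snd p))" unfolding f_def
    by (rule joint[OF _ sep(1)]) (auto simp: F_def intro!: continuous_intros continuous_on_compose2[OF contc])
  have G_cont: "continuous_on UNIV (\<lambda>p. \<Sum>n. G n (fst p) (snd p))"
    by (rule joint[OF _ sep(2)]) (auto simp: G_def intro!: continuous_intros continuous_on_compose2[OF contE[OF contc]])
  have Q_cont: "continuous_on UNIV (\<lambda>p. Q (fst p) (snd p))" unfolding Q_def
    by (intro continuous_intros G_cont)
  have sumF: "summable (\<lambda>n. F n s l)" and sumG: "summable (\<lambda>n. G n s l)" for s l
  proof -
    obtain M N where "summable M" "summable N"
        "\<And>n. \<bar>F n s l\<bar> \<le> M n" "\<And>n. \<bar>G n s l\<bar> \<le> N n"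
      using Mb[of "max \<bar>s\<bar> \<bar>l\<bar>"] by (metis max.cobounded1 max.cobounded2)
    then show "summable (\<lambda>n. F n s l)" "summable (\<lambda>n. G n s l)"
      by (auto intro: summable_comparison_test')
  qed
  \<comment> \<open>The constant term is split off because the derivative of the term n + 1 of
    \<open>F\<close> is - l times the term n of \<open>G\<close>.\<close>
  have f_shift: "f s l = 1 + (\<Sum>n. F (Suc n) s l)" for s l
    unfolding f_def using suminf_split_head[OF sumF[of s l]] by (simp add: F_def c0)
  have term_diff: "((\<lambda>s. \<Sum>n. A n s) has_real_derivative (\<Sum>n. A' n s)) (at s)"
    if dA: "\<And>n s. (A n has_real_derivative A' n s) (at s)" and sA: "summable (\<lambda>n. A n s)"
      and bA: "\<exists>M. summable M \<and> (\<forall>n x. \<bar>x\<bar> \<le> \<bar>s\<bar> + 1 \<longrightarrow> \<bar>A' n x\<bar> \<le> M n)"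
    for A A' :: "nat \<Rightarrow> real \<Rightarrow> real" and s
  proof -
    define S where "S = {- \<bar>s\<bar> - 1..\<bar>s\<bar> + 1}"
    obtain M where M: "summable M" "\<And>n x. \<bar>x\<bar> \<le> \<bar>s\<bar> + 1 \<Longrightarrow> \<bar>A' n x\<bar> \<le> M n" using bA by blast
    show ?thesis
    proof (rule has_field_derivative_series'(2)[of S])
      show "uniformly_convergent_on S (\<lambda>n x. \<Sum>i<n. A' i x)"
        by (rule Weierstrass_m_test'[OF _ M(1)]) (use M(2) in \<open>auto simp: S_def\<close>)
      show "s \<in> interior S" by (auto simp: S_def interior_atLeastAtMost_real)
      then show "s \<in> S" using interior_subset by blast
      show "summable (\<lambda>n. A n s)" by (rule sA)
    qed (auto simp: S_def intro: has_field_derivative_at_within dA)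
  qed
  have f_deriv: "((\<lambda>s. f s l) has_real_derivative Q s l) (at s)" for s l
  proof -
    obtain N where N: "summable N" "\<And>n x. \<bar>x\<bar> \<le> max (\<bar>s\<bar> + 1) \<bar>l\<bar> \<Longrightarrow> \<bar>G n x l\<bar> \<le> N n"
      using Mb[of "max (\<bar>s\<bar> + 1) \<bar>l\<bar>"] by (metis max.cobounded2)
    have "((\<lambda>s. \<Sum>n. F (Suc n) s l) has_real_derivative (\<Sum>n. (- l) * G n s l)) (at s)"
    proof (rule term_diff)
      show "((\<lambda>s. F (Suc n) s l) has_real_derivative - l * G n s l) (at s)" for n s
        unfolding F_def G_def by (rule derivative_eq_intros dc refl | simp)+
      show "summable (\<lambda>n. F (Suc n) s l)" using sumF[of s l] by (subst summable_Suc_iff)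
      show "\<exists>M. summable M \<and> (\<forall>n x. \<bar>x\<bar> \<le> \<bar>s\<bar> + 1 \<longrightarrow> \<bar>- l * G n x l\<bar> \<le> M n)"
        by (rule exI[of _ "\<lambda>n. \<bar>l\<bar> * N n"]) (auto simp: abs_mult intro!: summable_mult N mult_left_mono)
    qed
    then have "((\<lambda>s. 1 + (\<Sum>n. F (Suc n) s l)) has_real_derivative 0 + (\<Sum>n. (- l) * G n s l)) (at s)"
      by (intro DERIV_add DERIV_const)
    then show ?thesis unfolding f_shift Q_def using suminf_mult[OF sumG, of "- l" s l] by simp
  qed
  have flux: "((\<lambda>s. s ^ (m + 1) * H s * Q s l) has_real_derivative - (l * s ^ m * H s * k s * f s l)) (at s)" for s l
  proof -
    define r where "r = max (\<bar>s\<bar> + 1) \<bar>l\<bar>"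
    obtain M where M: "summable M" "\<And>n x. \<bar>x\<bar> \<le> r \<Longrightarrow> \<bar>F n x l\<bar> \<le> M n"
      using Mb[of r] by (metis max.cobounded2 r_def)
    have "continuous_on {-r..r} (\<lambda>s. s ^ m * (H s * k s))" by (intro continuous_intros)
    from continuous_on_Icc_bounded[OF this] obtain B1 where
      B1: "B1 > 0" "\<And>s. s \<in> {-r..r} \<Longrightarrow> \<bar>s ^ m * (H s * k s)\<bar> \<le> B1" by blast
    have "((\<lambda>s. \<Sum>n. s ^ (m + 1) * H s * G n s l) has_real_derivative (\<Sum>n. s ^ m * (H s * k s) * F n s l)) (at s)"
    proof (rule term_diff)
      fix n s
      have "((\<lambda>s. (- l) ^ n * (s ^ (m + 1) * H s * E (c n) s)) has_real_derivative (- l) ^ n * (s ^ m * (H s * k s * c n s))) (at s)"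
        by (rule DERIV_cmult[OF dE])
      then show "((\<lambda>s. s ^ (m + 1) * H s * G n s l) has_real_derivative s ^ m * (H s * k s) * F n s l) (at s)"
        unfolding F_def G_def by (simp only: ac_simps)
    next
      show "summable (\<lambda>n. s ^ (m + 1) * H s * G n s l)" by (rule summable_mult[OF sumG])
      show "\<exists>M. summable M \<and> (\<forall>n x. \<bar>x\<bar> \<le> \<bar>s\<bar> + 1 \<longrightarrow> \<bar>x ^ m * (H x * k x) * F n x l\<bar> \<le> M n)"
      proof (intro exI[of _ "\<lambda>n. B1 * M n"] conjI allI impI)
        fix n x assume "\<bar>x\<bar> \<le> \<bar>s\<bar> + 1"
        then have x: "\<bar>x\<bar> \<le> r" "x \<in> {-r..r}" by (auto simp: r_def)
        show "\<bar>x ^ m * (H x * k x) * F n x l\<bar> \<le> B1 * M n"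
          unfolding abs_mult[of "x ^ m * (H x * k x)"] using B1(1) by (intro mult_mono B1(2)[OF x(2)] M(2)[OF x(1)]) auto
      qed (rule summable_mult[OF M(1)])
    qed
    from DERIV_cmult[OF this, of "- l"]
    have "((\<lambda>s. - l * (\<Sum>n. s ^ (m + 1) * H s * G n s l)) has_real_derivative - l * (\<Sum>n. s ^ m * (H s * k s) * F n s l)) (at s)" .
    then show ?thesis unfolding Q_def f_def suminf_mult[OF sumG] suminf_mult[OF sumF] by (simp only: ac_simps mult_minus_left mult_minus_right)
  qed
  have "f 0 l = 1" for l
  proof -
    have "F (Suc n) 0 l = 0" for n by (simp add: F_def cS I_def)
    then show ?thesis unfolding f_shift by simp
  qed
  then have "radial_sol m H k f Q"
    by unfold_locales (use H_cont k_cont H_pos k_pos f_deriv flux f_cont Q_cont in auto)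
  then show ?thesis by (rule that)
qed

section \<open>Bessel functions\<close>

text \<open>At t = x^2/4 this is what remains of J_n(x) after division by (x/2)^n: the
  Bessel-Clifford function at - t. It is entire and does not vanish at 0, as befits a solution
  normalised there.\<close>

definition bessel_series :: "nat \<Rightarrow> real \<Rightarrow> real" where
  "bessel_series n t = (\<Sum>j. (- 1) ^ j / (fact j * fact (j + n)) * t ^ j)"

definition bessel_coeff :: "nat \<Rightarrow> nat \<Rightarrow> real" where
  "bessel_coeff n j = (- 1) ^ j / (fact j * fact (j + n))"

lemma bessel_coeff_summable: "summable (\<lambda>j. bessel_coeff n j * t ^ j)"
proof (rule summable_comparison_test')
  show "summable (\<lambda>j. inverse (fact j) * \<bar>t\<bar> ^ j)" using summable_exp[of "\<bar>t\<bar>"] by simp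
  fix j :: nat
  have "fact j * 1 \<le> fact j * (fact (j + n) :: real)" by (intro mult_left_mono fact_ge_1) auto
  then have "1 / (fact j * fact (j + n)) \<le> (inverse (fact j) :: real)"
    by (simp add: inverse_eq_divide frac_le)
  then show "norm (bessel_coeff n j * t ^ j) \<le> inverse (fact j) * \<bar>t\<bar> ^ j"
    using mult_right_mono[of _ _ "\<bar>t\<bar> ^ j"] by (fastforce simp: bessel_coeff_def abs_mult power_abs)
qed

lemma bessel_series_coeff: "bessel_series n t = (\<Sum>j. bessel_coeff n j * t ^ j)"
  by (simp add: bessel_series_def bessel_coeff_def)

definition bessel_series' :: "nat \<Rightarrow> real \<Rightarrow> real" where
  "bessel_series' n t = (\<Sum>j. diffs (bessel_coeff n) j * t ^ j)"

definition bessel_series'' :: "nat \<Rightarrow> real \<Rightarrow> real" where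
  "bessel_series'' n t = (\<Sum>j. diffs (diffs (bessel_coeff n)) j * t ^ j)"

lemma bessel_series_deriv: "(bessel_series n has_real_derivative bessel_series' n t) (at t)"
  unfolding bessel_series_coeff[abs_def] bessel_series'_def
  by (rule termdiffs_strong_converges_everywhere) (rule bessel_coeff_summable)

lemma diffs_bessel_summable: "summable (\<lambda>j. diffs (bessel_coeff n) j * t ^ j)"
  by (rule termdiff_converges_all) (rule bessel_coeff_summable)

lemma bessel_series'_deriv: "(bessel_series' n has_real_derivative bessel_series'' n t) (at t)"
  unfolding bessel_series'_def[abs_def] bessel_series''_def
  by (rule termdiffs_strong_converges_everywhere) (rule diffs_bessel_summable)

text \<open>Comparison of coefficients reduces the equation to the recursion (n + 1 + j) (j + 1)
  a_(j+1) = - a_j.\<close>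

lemma bessel_series_ode: "(real n + 1) * bessel_series' n t + t * bessel_series'' n t = - bessel_series n t"
proof -
  have s2: "summable (\<lambda>j. diffs (diffs (bessel_coeff n)) j * t ^ j)"
    by (rule termdiff_converges_all) (rule diffs_bessel_summable)
  have "t * bessel_series'' n t = (\<Sum>j. t * (diffs (diffs (bessel_coeff n)) j * t ^ j))"
    unfolding bessel_series''_def by (rule suminf_mult[symmetric, OF s2])
  \<comment> \<open>The factor j kills the term j = 0, so multiplication by t is an index
    shift.\<close>
  also have "\<dots> = (\<Sum>j. real j * diffs (bessel_coeff n) j * t ^ j)"
  proof -
    have "summable (\<lambda>j. real j * diffs (bessel_coeff n) j * t ^ j)"
      by (subst summable_Suc_iff[symmetric]) (use summable_mult[OF s2, of t] in \<open>simp add: diffs_def ac_simps\<close>)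
    from suminf_split_head[OF this] show ?thesis by (simp add: diffs_def ac_simps)
  qed
  finally have t2: "t * bessel_series'' n t = (\<Sum>j. real j * diffs (bessel_coeff n) j * t ^ j)" .
  have "summable (\<lambda>j. real j * diffs (bessel_coeff n) j * t ^ j)"
    by (subst summable_Suc_iff[symmetric]) (use summable_mult[OF s2, of t] in \<open>simp add: diffs_def ac_simps\<close>)
  then have "(real n + 1) * bessel_series' n t + t * bessel_series'' n t
     = (\<Sum>j. (real n + 1) * (diffs (bessel_coeff n) j * t ^ j) + real j * diffs (bessel_coeff n) j * t ^ j)"
    unfolding t2 bessel_series'_def
    by (subst suminf_mult[symmetric, OF diffs_bessel_summable])
       (rule suminf_add[OF summable_mult[OF diffs_bessel_summable]])
  also have "\<dots> = (\<Sum>j. - (bessel_coeff n j * t ^ j))"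
  proof (rule suminf_cong)
    fix j
    have "(real n + 1 + real j) * diffs (bessel_coeff n) j = - bessel_coeff n j"
    proof -
      define A where "A = (fact j * fact (j + n) :: real)"
      define p where "p = (real n + 1 + real j) * (real j + 1)"
      have p: "p \<noteq> 0" by (simp add: p_def add_eq_0_iff)
      have F: "fact (Suc j) * fact (Suc j + n) = A * p" by (simp add: A_def p_def algebra_simps)
      have "bessel_coeff n (Suc j) = - ((- 1) ^ j / (A * p))" unfolding bessel_coeff_def F by simp
      moreover have "bessel_coeff n j = (- 1) ^ j / A" by (simp add: bessel_coeff_def A_def)
      ultimately have "p * bessel_coeff n (Suc j) = - bessel_coeff n j" using p by simp
      then show ?thesis by (simp add: diffs_def p_def mult.assoc add.commute)
    qed
    moreover have "(real n + 1) * (diffs (bessel_coeff n) j * t ^ j) + real j * diffs (bessel_coeff n) j * t ^ j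
      = ((real n + 1 + real j) * diffs (bessel_coeff n) j) * t ^ j" by (simp add: algebra_simps)
    ultimately show "(real n + 1) * (diffs (bessel_coeff n) j * t ^ j) + real j * diffs (bessel_coeff n) j * t ^ j
      = - (bessel_coeff n j * t ^ j)" by simp
  qed
  also have "\<dots> = - bessel_series n t"
    unfolding bessel_series_coeff by (rule suminf_minus[OF bessel_coeff_summable])
  finally show ?thesis .
qed

lemma bessel_J_series: "bessel_J n x = (x / 2) ^ n * bessel_series n (x\<^sup>2 / 4)"
proof -
  have "bessel_J n x = (\<Sum>j. (x / 2) ^ n * (bessel_coeff n j * (x\<^sup>2 / 4) ^ j))"
    unfolding bessel_J_def
  proof (rule suminf_cong)
    fix j
    have "(x / 2) ^ (2 * j + n) = (x\<^sup>2 / 4) ^ j * (x / 2) ^ n"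
      by (simp only: power_add power_mult) (simp add: power_divide)
    then show "(- 1) ^ j / (fact j * fact (j + n)) * (x / 2) ^ (2 * j + n) = (x / 2) ^ n * (bessel_coeff n j * (x\<^sup>2 / 4) ^ j)"
      unfolding bessel_coeff_def by (simp only: ac_simps)
  qed
  also have "\<dots> = (x / 2) ^ n * bessel_series n (x\<^sup>2 / 4)"
    unfolding bessel_series_coeff by (rule suminf_mult[OF bessel_coeff_summable])
  finally show ?thesis .
qed

lemma bessel_series_at_0: "bessel_series n 0 = 1 / fact n"
proof -
  have "bessel_series n 0 = bessel_coeff n 0" unfolding bessel_series_coeff by (rule powser_zero)
  then show ?thesis by (simp add: bessel_coeff_def)
qed

text \<open>The problem with constant coefficients is the Bessel equation of order \<open>m\<close> in \<open>2 \<surd>(l \<kappa> s)\<close>.\<close>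

lemma bessel_radial_sol:
  assumes "\<eta> > 0" "\<kappa> > 0"
  shows "radial_sol m (\<lambda>_. \<eta>) (\<lambda>_. \<kappa>) (\<lambda>s l. fact m * bessel_series m (l * \<kappa> * s))
     (\<lambda>s l. fact m * (l * \<kappa>) * bessel_series' m (l * \<kappa> * s))"
proof
  have c: "continuous_on UNIV (bessel_series m)" "continuous_on UNIV (bessel_series' m)"
    using bessel_series_deriv bessel_series'_deriv by (auto intro!: continuous_at_imp_continuous_on DERIV_isCont)
  show "continuous_on UNIV (\<lambda>p. fact m * bessel_series m (snd p * \<kappa> * fst p))"
    by (intro continuous_intros continuous_on_compose2[OF c(1)]) auto
  show "continuous_on UNIV (\<lambda>p. fact m * (snd p * \<kappa>) * bessel_series' m (snd p * \<kappa> * fst p))"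
    by (intro continuous_intros continuous_on_compose2[OF c(2)]) auto
  have lin: "((\<lambda>s. l * \<kappa> * s) has_real_derivative l * \<kappa>) (at s)" for l s
    by (auto intro!: derivative_eq_intros)
  have d1: "((\<lambda>s. bessel_series m (l * \<kappa> * s)) has_real_derivative bessel_series' m (l * \<kappa> * s) * (l * \<kappa>)) (at s)" for l s
    by (rule DERIV_chain2[where f = "bessel_series m" and g = "\<lambda>s. l * \<kappa> * s", OF bessel_series_deriv lin])
  have d2: "((\<lambda>s. bessel_series' m (l * \<kappa> * s)) has_real_derivative bessel_series'' m (l * \<kappa> * s) * (l * \<kappa>)) (at s)" for l s
    by (rule DERIV_chain2[where f = "bessel_series' m" and g = "\<lambda>s. l * \<kappa> * s", OF bessel_series'_deriv lin])
  show "((\<lambda>s. fact m * bessel_series m (l * \<kappa> * s)) has_real_derivative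
      fact m * (l * \<kappa>) * bessel_series' m (l * \<kappa> * s)) (at s)" for l s
    using DERIV_cmult[OF d1[of l s], of "fact m"] by (simp add: ac_simps)
  show "((\<lambda>s. s ^ (m + 1) * \<eta> * (fact m * (l * \<kappa>) * bessel_series' m (l * \<kappa> * s))) has_real_derivative
      - (l * s ^ m * \<eta> * \<kappa> * (fact m * bessel_series m (l * \<kappa> * s)))) (at s)" for s l
  proof -
    have "((\<lambda>s. (\<eta> * fact m * (l * \<kappa>)) * (s ^ (m + 1) * bessel_series' m (l * \<kappa> * s))) has_real_derivative
       (\<eta> * fact m * (l * \<kappa>)) * (real (m + 1) * s ^ m * bessel_series' m (l * \<kappa> * s) +
         (bessel_series'' m (l * \<kappa> * s) * (l * \<kappa>)) * s ^ (m + 1))) (at s)"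
      by (rule DERIV_cmult[OF DERIV_mult[OF _ d2]]) (rule derivative_eq_intros refl | simp)+
    also have "(\<eta> * fact m * (l * \<kappa>)) * (real (m + 1) * s ^ m * bessel_series' m (l * \<kappa> * s) +
         (bessel_series'' m (l * \<kappa> * s) * (l * \<kappa>)) * s ^ (m + 1)) =
       (\<eta> * fact m * (l * \<kappa>)) * s ^ m * ((real m + 1) * bessel_series' m (l * \<kappa> * s) +
         (l * \<kappa> * s) * bessel_series'' m (l * \<kappa> * s))"
      by (simp add: algebra_simps)
    also have "\<dots> = - (l * s ^ m * \<eta> * \<kappa> * (fact m * bessel_series m (l * \<kappa> * s)))"
      unfolding bessel_series_ode by simp
    finally show ?thesis by (simp only: ac_simps)
  qed
qed (use assms in \<open>auto simp: bessel_series_at_0\<close>)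

section \<open>The limit problem and the numbering of the zeros\<close>

locale bessel_limit =
  fixes m :: nat and \<rho> :: real
  assumes rho_pos: "\<rho> > 0"

text \<open>
  The limit problem (\<open>\<rho> = 1\<close>) lives on two flat discs glued along their boundary, with
  \<open>h = min(1, 2(1-x))\<^sup>m\<close>. For general \<open>\<rho>\<close> the coefficients are distorted by \<open>\<rho>\<close>, which scales
  the eigenvalues by \<open>\<rho>\<^sup>-\<^sup>2\<close>.
\<close>

sublocale bessel_limit \<subseteq> matching m "\<lambda>_. 1 / \<rho>" "\<lambda>_. \<rho>\<^sup>2" "\<lambda>s l. fact 0 * bessel_series 0 (l * \<rho>\<^sup>2 * s)"
  "\<lambda>s l. fact 0 * (l * \<rho>\<^sup>2) * bessel_series' 0 (l * \<rho>\<^sup>2 * s)"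
  "\<lambda>_. 2 ^ m / \<rho>" "\<lambda>_. \<rho>\<^sup>2" "\<lambda>s l. fact m * bessel_series m (l * \<rho>\<^sup>2 * s)"
  "\<lambda>s l. fact m * (l * \<rho>\<^sup>2) * bessel_series' m (l * \<rho>\<^sup>2 * s)" "1 / 2" "1 / 2"
  by (intro matching.intro bessel_radial_sol matching_axioms.intro) (use rho_pos in auto)

text \<open>The derivative of the product of the two series. At t = z^2/4 and z > 0 this product is
  2^m z^-m J_0(z) J_m(z).\<close>

definition bessel_product' :: "nat \<Rightarrow> real \<Rightarrow> real" where
  "bessel_product' m t = bessel_series' 0 t * bessel_series m t + bessel_series' m t * bessel_series 0 t"

text \<open>At the meeting point 1/2 the weights of the two sides agree, because (1/2)^(m+1) 2^m =
  1/2. Up to a factor that vanishes only at l = 0, the discriminant depends on l \<rho>^2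
  alone.\<close>

lemma (in bessel_limit) disc_eq: "disc l = fact m * (l * \<rho>) / 2 * bessel_product' m (l * \<rho>\<^sup>2 / 2)"
proof -
  have "disc l = bessel_series 0 (l * \<rho>\<^sup>2 / 2) * ((1/2) ^ (m+1) * (2 ^ m / \<rho>) * (fact m * (l * \<rho>\<^sup>2) * bessel_series' m (l * \<rho>\<^sup>2 / 2)))
    + (1/2) * (1 / \<rho>) * ((l * \<rho>\<^sup>2) * bessel_series' 0 (l * \<rho>\<^sup>2 / 2)) * (fact m * bessel_series m (l * \<rho>\<^sup>2 / 2))"
    unfolding disc_def L.q_def R.q_def by simp
  also have "(1/2) ^ (m+1) * (2 ^ m / \<rho>) = 1 / (2 * \<rho>)" by (simp add: power_divide)
  finally show ?thesis using rho_pos by (simp add: bessel_product'_def field_simps power2_eq_square)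
qed

text \<open>For x > 0 the function under \<open>deriv\<close> is a constant times the product of the
  two series at x^2/4, so the chain rule adds only the nonzero factor x/2.\<close>

lemma xi_zeros_iff: "xi_zeros m = {x. x > 0 \<and> bessel_product' m (x\<^sup>2 / 4) = 0}"
proof -
  have d: "deriv (\<lambda>z. z powi (- int m) * bessel_J 0 z * bessel_J m z) x = (1/2) ^ m * (bessel_product' m (x\<^sup>2 / 4) * (x / 2))"
    if x: "x > 0" for x
  proof (rule DERIV_imp_deriv)
    have sq: "((\<lambda>z. z\<^sup>2 / 4) has_real_derivative x / 2) (at x)"
      by (rule derivative_eq_intros refl | simp)+
    have "((\<lambda>z. (1/2) ^ m * (bessel_series 0 (z\<^sup>2/4) * bessel_series m (z\<^sup>2/4))) has_real_derivative
       (1/2) ^ m * (bessel_series' 0 (x\<^sup>2/4) * (x/2) * bessel_series m (x\<^sup>2/4) + bessel_series' m (x\<^sup>2/4) * (x/2) * bessel_series 0 (x\<^sup>2/4))) (at x)"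
      by (intro DERIV_cmult DERIV_mult DERIV_chain2[where g = "\<lambda>z. z\<^sup>2/4", OF bessel_series_deriv sq])
    also have "bessel_series' 0 (x\<^sup>2/4) * (x/2) * bessel_series m (x\<^sup>2/4) + bessel_series' m (x\<^sup>2/4) * (x/2) * bessel_series 0 (x\<^sup>2/4)
       = bessel_product' m (x\<^sup>2/4) * (x/2)" by (simp add: bessel_product'_def algebra_simps add_divide_distrib)
    finally show "((\<lambda>z. z powi (- int m) * bessel_J 0 z * bessel_J m z) has_real_derivative
       (1/2) ^ m * (bessel_product' m (x\<^sup>2 / 4) * (x / 2))) (at x)"
    proof (rule has_field_derivative_transform_within_open[of _ _ _ "{0<..}"])
      fix z :: real assume "z \<in> {0<..}"
      then have "z powi (- int m) * (z / 2) ^ m = (1/2) ^ m"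
        by (simp add: power_int_minus power_divide field_simps)
      then show "(1/2) ^ m * (bessel_series 0 (z\<^sup>2/4) * bessel_series m (z\<^sup>2/4)) = z powi (- int m) * bessel_J 0 z * bessel_J m z"
        unfolding bessel_J_series by (simp add: ac_simps)
    qed (use x in auto)
  qed
  show ?thesis by (auto simp: xi_zeros_def d)
qed

text \<open>An eigenvalue l corresponds to the zero x = sqrt (2 l), since l/2 = x^2/4. The
  eigenvalue 0 has no positive zero as partner, so \<open>a 0\<close> is dropped and
  \<open>xi m 1\<close> belongs to \<open>a 1\<close>. The hypothesis spells out the discriminant of
  \<open>bessel_limit\<close> at \<rho> = 1, as the interpretation exists only inside
  proofs.\<close>

lemma xi_listing:
  assumes a: "increasing_listing a {l. matching.disc m (\<lambda>_. 1 / 1) (\<lambda>s l. fact 0 * bessel_series 0 (l * 1\<^sup>2 * s))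
      (\<lambda>s l. fact 0 * (l * 1\<^sup>2) * bessel_series' 0 (l * 1\<^sup>2 * s)) (\<lambda>_. 2 ^ m / 1)
      (\<lambda>s l. fact m * bessel_series m (l * 1\<^sup>2 * s)) (\<lambda>s l. fact m * (l * 1\<^sup>2) * bessel_series' m (l * 1\<^sup>2 * s)) (1 / 2) (1 / 2) l = 0}"
    and a0: "a 0 = 0"
  shows "increasing_listing (\<lambda>i. xi m (Suc i)) (xi_zeros m)" "j \<ge> 1 \<Longrightarrow> (xi m j)\<^sup>2 / 2 = a j"
proof -
  interpret B: bessel_limit m 1 by unfold_locales simp
  have ra: "range a = {l. B.disc l = 0}" and ma: "strict_mono a" using a unfolding increasing_listing_def by auto
  have pos: "a (Suc i) > 0" for i using strict_monoD[OF ma, of 0 "Suc i"] a0 by simp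
  define r where "r = (\<lambda>i. sqrt (2 * a (Suc i)))"
  have r: "increasing_listing r (xi_zeros m)" unfolding increasing_listing_def
  proof
    show "strict_mono r" unfolding r_def using strict_monoD[OF ma] by (auto intro!: strict_monoI)
    show "range r = xi_zeros m"
    proof (intro equalityI subsetI)
      fix x assume "x \<in> range r"
      then obtain i where i: "x = r i" by blast
      have "B.disc (a (Suc i)) = 0" using ra by blast
      then have "bessel_product' m (a (Suc i) / 2) = 0" unfolding B.disc_eq using pos[of i] by simp
      then show "x \<in> xi_zeros m" unfolding xi_zeros_iff i using pos[of i] by (simp add: r_def)
    next
      fix x assume "x \<in> xi_zeros m"
      then have x: "x > 0" "bessel_product' m (x\<^sup>2 / 4) = 0" by (auto simp: xi_zeros_iff)
      then have "B.disc (x\<^sup>2 / 2) = 0" unfolding B.disc_eq by simp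
      then obtain i where i: "x\<^sup>2 / 2 = a i" using ra by blast
      then have "i \<noteq> 0" using a0 x by (metis divide_eq_0_iff less_irrefl power_not_zero zero_neq_numeral)
      then obtain n where "i = Suc n" using not0_implies_Suc by blast
      then have "2 * a (Suc n) = x\<^sup>2" using i by simp
      then have "x = r n" unfolding r_def using x by simp
      then show "x \<in> range r" by blast
    qed
  qed
  have xi: "xi m (Suc i) = r i" for i unfolding xi_def the_increasing_listing[OF r] by simp
  show "increasing_listing (\<lambda>i. xi m (Suc i)) (xi_zeros m)" unfolding xi using r by (simp add: eta_contract_eq)
  show "(xi m j)\<^sup>2 / 2 = a j" if "j \<ge> 1"
    using xi[of "j - 1"] that pos[of "j - 1"] by (simp add: r_def)
qed

section \<open>Smooth functions and radial profiles\<close>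

lemma C_k_SucI:
  assumes "\<And>x. (f has_derivative f' x) (at x)" "\<And>v. C_k k (\<lambda>x. f' x v)"
  shows "C_k (Suc k) f"
proof -
  have "frechet_derivative f (at x) = f' x" for x using frechet_derivative_at[OF assms(1)] by simp
  then show ?thesis using assms by (auto simp: differentiable_def)
qed

lemma C_k_has_derivative: "C_k (Suc k) f \<Longrightarrow> (f has_derivative frechet_derivative f (at x)) (at x)"
  by (simp add: frechet_derivative_works[symmetric])

lemma C_k_frechet: "C_k (Suc k) f \<Longrightarrow> C_k k (\<lambda>x. frechet_derivative f (at x) v)"
  by simp

declare C_k.simps(2) [simp del]

lemma C_k_Suc_imp: "C_k (Suc k) f \<Longrightarrow> C_k k f"
proof (induction k arbitrary: f)
  case 0
  then show ?case
    using C_k_has_derivative has_derivative_continuous by (force intro!: continuous_at_imp_continuous_on)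
next
  case (Suc k)
  show ?case
    by (rule C_k_SucI[OF C_k_has_derivative[OF Suc.prems]]) (intro Suc.IH C_k_frechet Suc.prems)
qed

lemma C_k_continuous: "C_k k f \<Longrightarrow> continuous_on UNIV f"
  by (induction k) (auto dest: C_k_Suc_imp)

lemma C_k_const [intro]: "C_k k (\<lambda>_. c)"
  by (induction k arbitrary: c) (auto intro!: C_k_SucI has_derivative_const)

lemma C_k_bounded_linear: "bounded_linear f \<Longrightarrow> C_k k f"
  by (cases k) (auto intro!: C_k_SucI C_k_const bounded_linear_imp_has_derivative linear_continuous_on)

lemma C_k_add: "C_k k f \<Longrightarrow> C_k k g \<Longrightarrow> C_k k (\<lambda>x. f x + g x)"
proof (induction k arbitrary: f g)
  case (Suc k)
  show ?case
    by (rule C_k_SucI[OF has_derivative_add[OF C_k_has_derivative[OF Suc.prems(1)] C_k_has_derivative[OF Suc.prems(2)]]])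
       (intro Suc.IH C_k_frechet Suc.prems)
qed (auto intro: continuous_on_add)

lemma C_k_compose_linear: "bounded_linear L \<Longrightarrow> C_k k f \<Longrightarrow> C_k k (\<lambda>x. L (f x))"
proof (induction k arbitrary: f)
  case (Suc k)
  show ?case
    by (rule C_k_SucI[OF bounded_linear.has_derivative[OF Suc.prems(1) C_k_has_derivative[OF Suc.prems(2)]]])
       (intro Suc.IH C_k_frechet Suc.prems)
qed (auto intro: bounded_linear.continuous_on)

lemma C_k_bilinear:
  assumes "bounded_bilinear B"
  shows "C_k k f \<Longrightarrow> C_k k g \<Longrightarrow> C_k k (\<lambda>x. B (f x) (g x))"
proof (induction k arbitrary: f g)
  case 0
  then show ?case using bounded_bilinear.continuous_on[OF assms] by auto
next
  case (Suc k)
  show ?case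
    by (rule C_k_SucI[OF bounded_bilinear.FDERIV[OF assms C_k_has_derivative[OF Suc.prems(1)] C_k_has_derivative[OF Suc.prems(2)]]])
       (intro C_k_add Suc.IH C_k_frechet[OF Suc.prems(1)] C_k_frechet[OF Suc.prems(2)]
          C_k_Suc_imp[OF Suc.prems(1)] C_k_Suc_imp[OF Suc.prems(2)])
qed

lemmas C_k_mult = C_k_bilinear[OF bounded_bilinear_mult]

lemma C_k_exp:
  fixes f :: "'a::euclidean_space \<Rightarrow> real"
  shows "C_k k f \<Longrightarrow> C_k k (\<lambda>x. exp (f x))"
proof (induction k)
  case (Suc k)
  show ?case
    by (rule C_k_SucI[OF has_derivative_exp[OF C_k_has_derivative[OF Suc.prems]]])
       (intro C_k_mult Suc.IH C_k_frechet[OF Suc.prems] C_k_Suc_imp[OF Suc.prems])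
qed (auto intro: continuous_on_exp)

text \<open>The derivative is a product of the inverse itself, twice, and of f', so the claim for k
  yields that for k + 1.\<close>

lemma C_k_inverse:
  fixes f :: "'a::euclidean_space \<Rightarrow> real"
  assumes "\<And>x. f x \<noteq> 0"
  shows "C_k k f \<Longrightarrow> C_k k (\<lambda>x. inverse (f x))"
proof (induction k)
  case (Suc k)
  have d: "((\<lambda>x. inverse (f x)) has_derivative (\<lambda>v. (- 1) * (inverse (f x) * frechet_derivative f (at x) v * inverse (f x)))) (at x)" for x
    using Deriv.has_derivative_inverse[OF assms C_k_has_derivative[OF Suc.prems], of x] by simp
  show ?case
    by (rule C_k_SucI[OF d]) (intro C_k_mult C_k_const Suc.IH C_k_frechet[OF Suc.prems] C_k_Suc_imp[OF Suc.prems])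
qed (auto intro!: continuous_intros assms)

lemma C_k_ln:
  fixes f :: "'a::euclidean_space \<Rightarrow> real"
  assumes "\<And>x. f x > 0" "C_k k f"
  shows "C_k k (\<lambda>x. ln (f x))"
proof (cases k)
  case 0
  then show ?thesis using assms by (auto intro!: continuous_on_ln) (metis less_irrefl)
next
  case (Suc n)
  have d: "((\<lambda>x. ln (f x)) has_derivative (\<lambda>v. frechet_derivative f (at x) v * inverse (f x))) (at x)" for x
    using has_derivative_ln[OF assms(1) C_k_has_derivative[OF assms(2)[unfolded Suc]], of x] by simp
  have "f x \<noteq> 0" for x using assms(1)[of x] by simp
  then show ?thesis unfolding Suc
    by (intro C_k_SucI[OF d] C_k_mult C_k_inverse C_k_frechet[OF assms(2)[unfolded Suc]]
        C_k_Suc_imp[OF assms(2)[unfolded Suc]])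
qed

lemma C_k_power:
  fixes f :: "'a::euclidean_space \<Rightarrow> 'b::real_normed_field"
  shows "C_k k f \<Longrightarrow> C_k k (\<lambda>x. f x ^ n)"
  by (induction n) (auto intro: C_k_mult)

lemma C_k_norm_sq: "C_k k (\<lambda>z. (cmod z)\<^sup>2)"
proof -
  have "(\<lambda>z. (cmod z)\<^sup>2) = (\<lambda>z. Re z * Re z + Im z * Im z)"
    by (simp add: cmod_power2 flip: power2_eq_square)
  then show ?thesis
    by (simp add: C_k_add C_k_mult C_k_bounded_linear bounded_linear_Re bounded_linear_Im)
qed

text \<open>Each differentiation under the integral produces a further factor \<kappa> t, so the
  induction runs over arbitrary weights a. In the applications \<kappa> is the square root: with s =
  |z|^2 a radial g is then evaluated at t s, which makes averages over s smooth functions of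
  z.\<close>

lemma C_k_radial_integral:
  fixes g :: "complex \<Rightarrow> real" and \<kappa> a :: "real \<Rightarrow> real"
  assumes \<kappa>: "continuous_on {0..1} \<kappa>"
  shows "continuous_on {0..1} a \<Longrightarrow> C_k k g \<Longrightarrow> C_k k (\<lambda>z. integral {0..1} (\<lambda>t. a t * g (\<kappa> t *\<^sub>R z)))"
proof (induction k arbitrary: a g)
  case 0
  then have g: "continuous_on UNIV g" by simp
  have "continuous_on UNIV (\<lambda>z. integral (cbox 0 1) (\<lambda>t. a t * g (\<kappa> t *\<^sub>R z)))"
  proof (rule integral_continuous_on_param)
    show "continuous_on (UNIV \<times> cbox 0 1) (\<lambda>(z, t). a t * g (\<kappa> t *\<^sub>R z))"
      unfolding split_beta
      by (intro continuous_intros continuous_on_compose2[OF g] continuous_on_compose2[OF \<kappa>] continuous_on_compose2[OF 0(1)]) (auto simp: box_real)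
  qed
  then show ?case by simp
next
  case (Suc k)
  note g = C_k_continuous[OF Suc.prems(2)]
  \<comment> \<open>Differentiation under the integral asks for a derivative that is continuous as a
    map into the bounded linear functions; in finite dimension continuity of all directional
    derivatives suffices.\<close>
  define D where "D = (\<lambda>p. Blinfun (frechet_derivative g (at p)))"
  have D: "blinfun_apply (D p) = frechet_derivative g (at p)" for p
    unfolding D_def using has_derivative_bounded_linear[OF C_k_has_derivative[OF Suc.prems(2)]]
    by (rule bounded_linear_Blinfun_apply)
  have contD: "continuous_on UNIV D"
    by (rule continuous_on_blinfun_componentwise)
       (unfold D, rule C_k_continuous[OF C_k_frechet[OF Suc.prems(2)]])
  define fx where "fx = (\<lambda>z t. (a t * \<kappa> t) *\<^sub>R D (\<kappa> t *\<^sub>R z))"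
  have der: "((\<lambda>z. integral (cbox 0 1) (\<lambda>t. a t * g (\<kappa> t *\<^sub>R z))) has_derivative integral (cbox 0 1) (fx z)) (at z within UNIV)" for z
  proof (rule leibniz_rule)
    fix x :: complex and t :: real
    have "((\<lambda>x. a t * g (\<kappa> t *\<^sub>R x)) has_derivative (\<lambda>v. a t * frechet_derivative g (at (\<kappa> t *\<^sub>R x)) (\<kappa> t *\<^sub>R v))) (at x)"
      by (intro has_derivative_mult_right has_derivative_compose[OF _ C_k_has_derivative[OF Suc.prems(2)]])
         (auto intro!: derivative_eq_intros)
    moreover have "(\<lambda>v. a t * frechet_derivative g (at (\<kappa> t *\<^sub>R x)) (\<kappa> t *\<^sub>R v)) = blinfun_apply (fx x t)"
      unfolding fx_def D[symmetric] by (auto simp: blinfun.scaleR_left blinfun.scaleR_right)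
    ultimately show "((\<lambda>x. a t * g (\<kappa> t *\<^sub>R x)) has_derivative blinfun_apply (fx x t)) (at x within UNIV)" by simp
  next
    fix x :: complex
    show "(\<lambda>t. a t * g (\<kappa> t *\<^sub>R x)) integrable_on cbox 0 1"
      by (intro integrable_continuous continuous_intros continuous_on_compose2[OF g]) (use Suc.prems \<kappa> in \<open>auto simp: box_real\<close>)
    show "continuous_on (UNIV \<times> cbox 0 1) (\<lambda>(x, t). fx x t)"
      unfolding split_beta fx_def
      by (intro continuous_intros continuous_on_compose2[OF contD] continuous_on_compose2[OF \<kappa>] continuous_on_compose2[OF Suc.prems(1)]) (auto simp: box_real)
  qed auto
  have app: "blinfun_apply (integral (cbox 0 1) (fx z)) v = integral {0..1} (\<lambda>t. (a t * \<kappa> t) * frechet_derivative g (at (\<kappa> t *\<^sub>R z)) v)" for z v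
  proof -
    have "fx z integrable_on cbox 0 1" unfolding fx_def
      by (intro integrable_continuous continuous_intros continuous_on_compose2[OF contD]) (use Suc.prems \<kappa> in \<open>auto simp: box_real\<close>)
    then have "blinfun_apply (integral (cbox 0 1) (fx z)) v = integral (cbox 0 1) (\<lambda>t. blinfun_apply (fx z t) v)"
      by (rule blinfun_apply_integral)
    then show ?thesis by (simp add: fx_def blinfun.scaleR_left D)
  qed
  show ?case
  proof (rule C_k_SucI)
    show "((\<lambda>z. integral {0..1} (\<lambda>t. a t * g (\<kappa> t *\<^sub>R z))) has_derivative blinfun_apply (integral (cbox 0 1) (fx z))) (at z)" for z
      using der[of z] by simp
    show "C_k k (\<lambda>z. blinfun_apply (integral (cbox 0 1) (fx z)) v)" for v
      unfolding app by (rule Suc.IH) (auto intro!: continuous_intros Suc.prems(1) \<kappa> C_k_frechet[OF Suc.prems(2)])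
  qed
qed

text \<open>The gain of one derivative by radial integration replaces elliptic regularity at the poles.\<close>

lemma C_k_radial_bootstrap:
  fixes f K :: "complex \<Rightarrow> real"
  assumes "\<And>z. (f has_derivative (\<lambda>v. 2 * (z \<bullet> v) * K z)) (at z)" "C_k k K"
  shows "C_k (Suc k) f"
  by (rule C_k_SucI[OF assms(1)])
     (intro C_k_mult C_k_const assms(2) C_k_bounded_linear bounded_linear_inner_left)

section \<open>Smooth functions and Wirtinger derivatives\<close>

lemma smooth_C_k: "smooth f \<Longrightarrow> C_k k f" by (simp add: smooth_def)

lemma smooth_continuous: "smooth f \<Longrightarrow> continuous_on UNIV f"
  using smooth_C_k[of f 0] by simp

lemma smooth_has_derivative: "smooth f \<Longrightarrow> (f has_derivative frechet_derivative f (at x)) (at x)"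
  by (rule C_k_has_derivative[OF smooth_C_k])

lemma smooth_frechet: "smooth f \<Longrightarrow> smooth (\<lambda>x. frechet_derivative f (at x) v)"
  unfolding smooth_def by (auto intro: C_k_frechet)

lemma smooth_const: "smooth (\<lambda>_. c)"
  and smooth_add: "smooth f \<Longrightarrow> smooth g \<Longrightarrow> smooth (\<lambda>x. f x + g x)"
  and smooth_bounded_linear: "bounded_linear K \<Longrightarrow> smooth K"
  and smooth_compose_linear: "bounded_linear L \<Longrightarrow> smooth f \<Longrightarrow> smooth (\<lambda>x. L (f x))"
  for f g :: "'a::euclidean_space \<Rightarrow> 'b::real_normed_vector"
  and K :: "'a \<Rightarrow> 'b" and L :: "'b \<Rightarrow> 'c::real_normed_vector"
  unfolding smooth_def by (auto intro: C_k_const C_k_add C_k_bounded_linear C_k_compose_linear)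

lemma smooth_mult: "smooth f \<Longrightarrow> smooth g \<Longrightarrow> smooth (\<lambda>x. f x * g x)"
  for f g :: "'a::euclidean_space \<Rightarrow> 'b::real_normed_algebra"
  unfolding smooth_def by (auto intro: C_k_mult)

lemma smooth_power: "smooth f \<Longrightarrow> smooth (\<lambda>x. f x ^ n)"
  for f :: "'a::euclidean_space \<Rightarrow> 'b::real_normed_field"
  unfolding smooth_def by (auto intro: C_k_power)

lemma smooth_exp: "smooth f \<Longrightarrow> smooth (\<lambda>x. exp (f x))"
  and smooth_inverse: "(\<And>x. f x \<noteq> 0) \<Longrightarrow> smooth f \<Longrightarrow> smooth (\<lambda>x. inverse (f x))"
  and smooth_ln: "(\<And>x. f x > 0) \<Longrightarrow> smooth f \<Longrightarrow> smooth (\<lambda>x. ln (f x))"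
  for f :: "'a::euclidean_space \<Rightarrow> real"
  unfolding smooth_def by (auto intro: C_k_exp C_k_inverse C_k_ln)

lemma smooth_divide: "(\<And>x. g x \<noteq> 0) \<Longrightarrow> smooth f \<Longrightarrow> smooth g \<Longrightarrow> smooth (\<lambda>x. f x / g x)"
  for f g :: "'a::euclidean_space \<Rightarrow> real"
  unfolding divide_inverse by (intro smooth_mult smooth_inverse)

lemma smooth_norm_sq: "smooth (\<lambda>z. (cmod z)\<^sup>2)" unfolding smooth_def by (auto intro: C_k_norm_sq)

lemmas smooth_of_real = smooth_compose_linear[OF bounded_linear_of_real]
lemmas smooth_cnj = smooth_compose_linear[OF bounded_linear_cnj]

lemma smooth_ident: "smooth (\<lambda>z. z)" by (rule smooth_bounded_linear[OF bounded_linear_ident])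

lemma smooth_minus: "smooth f \<Longrightarrow> smooth (\<lambda>x. - f x)"
  for f :: "'a::euclidean_space \<Rightarrow> 'b::real_normed_vector"
  by (rule smooth_compose_linear[OF bounded_linear_minus[OF bounded_linear_ident]])

lemma smooth_radial_integral:
  fixes g :: "complex \<Rightarrow> real" and \<kappa> a :: "real \<Rightarrow> real"
  shows "continuous_on {0..1} \<kappa> \<Longrightarrow> continuous_on {0..1} a \<Longrightarrow> smooth g
     \<Longrightarrow> smooth (\<lambda>z. integral {0..1} (\<lambda>t. a t * g (\<kappa> t *\<^sub>R z)))"
  unfolding smooth_def by (auto intro: C_k_radial_integral)

lemma smooth_d_z: "smooth f \<Longrightarrow> smooth (d_z f)" and smooth_d_zbar: "smooth f \<Longrightarrow> smooth (d_zbar f)"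
proof -
  assume f: "smooth f"
  have "d_z f = (\<lambda>p. (1/2) * (frechet_derivative f (at p) 1 + (- \<i>) * frechet_derivative f (at p) \<i>))"
    by (auto simp: d_z_def)
  then show "smooth (d_z f)" using f by (simp only:) (intro smooth_mult smooth_add smooth_const smooth_frechet)
  have "d_zbar f = (\<lambda>p. (1/2) * (frechet_derivative f (at p) 1 + \<i> * frechet_derivative f (at p) \<i>))"
    by (auto simp: d_zbar_def)
  then show "smooth (d_zbar f)" using f by (simp only:) (intro smooth_mult smooth_add smooth_const smooth_frechet)
qed

lemma d_z_eq: "(f has_derivative D) (at p) \<Longrightarrow> d_z f p = (D 1 - \<i> * D \<i>) / 2"
  and d_zbar_eq: "(f has_derivative D) (at p) \<Longrightarrow> d_zbar f p = (D 1 + \<i> * D \<i>) / 2"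
  unfolding d_z_def d_zbar_def using frechet_derivative_at by metis+

lemma d_z_cong:
  assumes "\<forall>\<^sub>F x in nhds p. f x = g x"
  shows "d_z f p = d_z g p" "d_zbar f p = d_zbar g p"
proof -
  have "(f has_derivative D) (at p) \<longleftrightarrow> (g has_derivative D) (at p)" for D
  proof -
    have x: "f p = g p" using assms by (rule eventually_nhds_x_imp_x)
    have "\<forall>\<^sub>F x in at p. f x = g x" using assms by (simp add: eventually_nhds_conv_at)
    moreover from this have "\<forall>\<^sub>F x in at p. g x = f x" by (rule eventually_mono) simp
    ultimately show ?thesis using x by (auto intro: has_derivative_transform_eventually)
  qed
  then have "frechet_derivative f (at p) = frechet_derivative g (at p)"
    unfolding frechet_derivative_def by simp
  then show "d_z f p = d_z g p" "d_zbar f p = d_zbar g p" by (simp_all add: d_z_def d_zbar_def)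
qed

section \<open>Radial functions in the variable s = |z|^2\<close>

lemma norm_sq_has_derivative: "((\<lambda>z. (cmod z)\<^sup>2) has_derivative (\<lambda>v. 2 * (z \<bullet> v))) (at z)"
proof -
  have "((\<lambda>z. z \<bullet> z) has_derivative (\<lambda>v. z \<bullet> v + v \<bullet> z)) (at z)"
    by (rule has_derivative_inner[OF has_derivative_ident has_derivative_ident])
  then show ?thesis by (simp add: power2_norm_eq_inner inner_commute)
qed

lemma radial_has_derivative:
  assumes "(F has_vector_derivative F') (at ((cmod z)\<^sup>2))"
  shows "((\<lambda>p. F ((cmod p)\<^sup>2)) has_derivative (\<lambda>v. (2 * (z \<bullet> v)) *\<^sub>R F')) (at z)"
  using has_derivative_compose[OF norm_sq_has_derivative assms[unfolded has_vector_derivative_def]] .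

lemma d_zbar_radial:
  assumes "(F has_vector_derivative F') (at ((cmod z)\<^sup>2))"
  shows "d_zbar (\<lambda>p. F ((cmod p)\<^sup>2)) z = z * F'"
proof -
  have "z * F' = (complex_of_real (Re z) + \<i> * complex_of_real (Im z)) * F'"
    by (simp flip: complex_eq)
  then show ?thesis
    unfolding d_zbar_eq[OF radial_has_derivative[OF assms]]
    by (simp add: inner_complex_def scaleR_conv_of_real algebra_simps)
qed

text \<open>With s = |z|^2 the right hand side is (s g)'. Together with \<open>d_zbar_radial\<close>
  this turns the operator d_z (h d_zbar) on radial functions into the Sturm-Liouville expression (s
  h F')'.\<close>

lemma d_z_times_radial:
  fixes g :: "real \<Rightarrow> complex" and g' :: complex
  assumes "(g has_vector_derivative g') (at ((cmod z)\<^sup>2))"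
  shows "d_z (\<lambda>p. p * g ((cmod p)\<^sup>2)) z = g ((cmod z)\<^sup>2) + (cmod z)\<^sup>2 * g'"
proof -
  have d: "((\<lambda>p. p * g ((cmod p)\<^sup>2)) has_derivative
     (\<lambda>v. z * ((2 * (z \<bullet> v)) *\<^sub>R g') + v * g ((cmod z)\<^sup>2))) (at z)"
    by (rule has_derivative_mult[of "\<lambda>p. p" "\<lambda>v. v" z UNIV, OF has_derivative_ident radial_has_derivative[OF assms]])
  have sq: "(complex_of_real (cmod z))\<^sup>2 = z * (complex_of_real (Re z) - \<i> * complex_of_real (Im z))"
    using complex_norm_square[of z] by (simp add: complex_eq_iff)
  show ?thesis unfolding d_z_eq[OF d]
    by (simp add: sq inner_complex_def scaleR_conv_of_real algebra_simps add_divide_distrib diff_divide_distrib)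
qed

definition radial :: "(complex \<Rightarrow> 'a) \<Rightarrow> bool" where
  "radial f \<longleftrightarrow> (\<forall>z. f z = f (complex_of_real (cmod z)))"

lemma S1_invariant_radial: "S1_invariant a \<longleftrightarrow> radial (fst a)"
proof
  assume a: "S1_invariant a"
  show "radial (fst a)" unfolding radial_def
  proof
    fix z
    have "z = cis (Arg z) * complex_of_real (cmod z)"
      using rcis_cmod_Arg[of z] by (simp add: rcis_def mult.commute)
    then show "fst a z = fst a (complex_of_real (cmod z))" using a unfolding S1_invariant_def by metis
  qed
next
  assume a: "radial (fst a)"
  show "S1_invariant a" unfolding S1_invariant_def
  proof (intro allI)
    fix t z
    show "fst a (cis t * z) = fst a z"
      using a[unfolded radial_def, rule_format, of "cis t * z"] a[unfolded radial_def, rule_format, of z]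
      by (simp add: norm_mult)
  qed
qed

text \<open>The coordinate is \<open>s = |z|\<^sup>2\<close>. Since \<open>sqrt (- s) = - sqrt s\<close>, a radial function has an even profile.\<close>

definition profile :: "(complex \<Rightarrow> 'a) \<Rightarrow> real \<Rightarrow> 'a" where
  "profile f s = f (complex_of_real (sqrt s))"

lemma radial_profile: "radial f \<Longrightarrow> f z = profile f ((cmod z)\<^sup>2)"
  unfolding radial_def profile_def by simp

lemma profile_continuous: "continuous_on UNIV f \<Longrightarrow> continuous_on UNIV (profile f)"
  unfolding profile_def by (rule continuous_on_compose2[where g = f]) (auto intro!: continuous_intros)

lemma profile_deriv:
  assumes f: "(f has_derivative D) (at (complex_of_real (sqrt s)))" and s: "s > 0"
  shows "(profile f has_vector_derivative (1 / (2 * sqrt s)) *\<^sub>R D 1) (at s)"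
proof -
  have "(sqrt has_derivative (\<lambda>t. t * (inverse (sqrt s) / 2))) (at s)"
  proof -
    have "(*) (inverse (sqrt s) / 2) = (\<lambda>t. t * (inverse (sqrt s) / 2))" by auto
    then show ?thesis using DERIV_real_sqrt[OF s] unfolding has_field_derivative_def by metis
  qed
  then have "((\<lambda>s. complex_of_real (sqrt s)) has_derivative (\<lambda>t. complex_of_real (t * (inverse (sqrt s) / 2)))) (at s)"
    by (rule has_derivative_of_real)
  from has_derivative_compose[OF this f]
  have "(profile f has_derivative (\<lambda>t. D (complex_of_real (t * (inverse (sqrt s) / 2))))) (at s)"
    unfolding profile_def[abs_def] .
  moreover have Dr: "D (complex_of_real r) = r *\<^sub>R D 1" for r
    using linear_scale[OF has_derivative_linear[OF f], of r 1] by (simp add: scaleR_conv_of_real)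
  moreover have "(\<lambda>t. D (complex_of_real (t * (inverse (sqrt s) / 2)))) = (\<lambda>t. t *\<^sub>R (1 / (2 * sqrt s)) *\<^sub>R D 1)"
  proof -
    have "inverse (sqrt s) / 2 = 1 / (2 * sqrt s)" by (simp add: field_simps)
    then show ?thesis by (simp only: Dr scaleR_scaleR)
  qed
  ultimately show ?thesis unfolding has_vector_derivative_def by simp
qed

text \<open>Smoothness in the plane gives at once only e = D / (2 sqrt s) with D bounded near 0, the
  radial derivative of f. This suffices: the flux s h e is then O(sqrt s) and tends to 0 at the
  pole.\<close>

lemma radial_second_order:
  fixes f :: "complex \<Rightarrow> complex" and h :: "complex \<Rightarrow> real"
  assumes f: "smooth f" "radial f" and h: "smooth h" "radial h"
  obtains e where
    "\<And>s. s > 0 \<Longrightarrow> (profile f has_vector_derivative e s) (at s)"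
    "\<And>s. s > 0 \<Longrightarrow> ((\<lambda>s. (s * profile h s) *\<^sub>R e s) has_vector_derivative
        d_z (\<lambda>p. complex_of_real (h p) * d_zbar f p) (complex_of_real (sqrt s))) (at s)"
    "((\<lambda>s. (s * profile h s) *\<^sub>R e s) \<longlongrightarrow> 0) (at_right 0)"
proof -
  define D where "D = (\<lambda>p. frechet_derivative f (at p) 1)"
  have sD: "smooth D" unfolding D_def by (rule smooth_frechet[OF f(1)])
  define e where "e = (\<lambda>s. (1 / (2 * sqrt s)) *\<^sub>R profile D s)"
  have e: "(profile f has_vector_derivative e s) (at s)" if "s > 0" for s
    using profile_deriv[OF smooth_has_derivative[OF f(1)] that] by (simp add: e_def D_def profile_def)
  have q: "((\<lambda>s. (s * profile h s) *\<^sub>R e s) has_vector_derivative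
        d_z (\<lambda>p. complex_of_real (h p) * d_zbar f p) (complex_of_real (sqrt s))) (at s)" if s: "s > 0" for s
  proof -
    let ?z = "complex_of_real (sqrt s)"
    have zs: "(cmod ?z)\<^sup>2 = s" "?z \<noteq> 0" using s by auto
    define g where "g = (\<lambda>s. profile h s *\<^sub>R e s)"
    obtain H' where H': "(profile h has_vector_derivative H') (at s)"
      using profile_deriv[OF smooth_has_derivative[OF h(1)] s] by blast
    obtain D' where D': "(profile D has_vector_derivative D') (at s)"
      using profile_deriv[OF smooth_has_derivative[OF sD] s] by blast
    obtain r' where r': "((\<lambda>s. 1 / (2 * sqrt s)) has_real_derivative r') (at s)"
    proof -
      have "((\<lambda>s. 1 / (2 * sqrt s)) has_real_derivative (0 * (2 * sqrt s) - 1 * (2 * (inverse (sqrt s) / 2))) / ((2 * sqrt s) * (2 * sqrt s))) (at s)"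
        by (intro DERIV_divide DERIV_const DERIV_cmult DERIV_real_sqrt s) (use s in simp)
      then show ?thesis using that by blast
    qed
    have "(e has_vector_derivative (1 / (2 * sqrt s)) *\<^sub>R D' + r' *\<^sub>R profile D s) (at s)"
      unfolding e_def by (rule has_vector_derivative_scaleR[OF r' D'])
    from has_vector_derivative_scaleR[OF H'[unfolded has_real_derivative_iff_has_vector_derivative[symmetric]] this]
    obtain g' where g': "(g has_vector_derivative g') (at s)" unfolding g_def by blast
    have dz: "complex_of_real (h p) * d_zbar f p = p * g ((cmod p)\<^sup>2)" if p: "p \<noteq> 0" for p
    proof -
      have "(profile f has_vector_derivative e ((cmod p)\<^sup>2)) (at ((cmod p)\<^sup>2))" using p by (intro e) auto
      have ff: "f = (\<lambda>p. profile f ((cmod p)\<^sup>2))" using radial_profile[OF f(2)] by (rule ext)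
      have "d_zbar f p = p * e ((cmod p)\<^sup>2)"
        by (rule trans[OF arg_cong[OF ff, of "\<lambda>g. d_zbar g p"] d_zbar_radial]) fact
      then show ?thesis using radial_profile[OF h(2), of p] by (simp add: g_def scaleR_conv_of_real)
    qed
    \<comment> \<open>The radial form of the flux is available only away from 0, which is enough
      because d_z is local.\<close>
    have "d_z (\<lambda>p. complex_of_real (h p) * d_zbar f p) ?z = d_z (\<lambda>p. p * g ((cmod p)\<^sup>2)) ?z"
    proof (rule d_z_cong)
      have "\<forall>\<^sub>F p in nhds ?z. p \<noteq> 0" using zs(2) by (intro t1_space_nhds)
      then show "\<forall>\<^sub>F p in nhds ?z. complex_of_real (h p) * d_zbar f p = p * g ((cmod p)\<^sup>2)"
        by (rule eventually_mono) (rule dz)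
    qed
    also have "\<dots> = g s + s * g'" using d_z_times_radial[of g g' ?z] g' unfolding zs(1) by blast
    finally have "d_z (\<lambda>p. complex_of_real (h p) * d_zbar f p) ?z = g s + s *\<^sub>R g'"
      by (simp add: scaleR_conv_of_real)
    moreover have "((\<lambda>s. s *\<^sub>R g s) has_vector_derivative s *\<^sub>R g' + 1 *\<^sub>R g s) (at s)"
      by (rule has_vector_derivative_scaleR[OF _ g']) simp
    moreover have "(\<lambda>s. s *\<^sub>R g s) = (\<lambda>s. (s * profile h s) *\<^sub>R e s)" by (simp add: g_def)
    ultimately show ?thesis by (simp add: add.commute)
  qed
  have "((\<lambda>s. (s * profile h s) *\<^sub>R e s) \<longlongrightarrow> 0) (at_right 0)"
  proof -
    have "continuous_on UNIV (\<lambda>s. (sqrt s * profile h s / 2) *\<^sub>R profile D s)"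
      by (intro continuous_intros profile_continuous smooth_continuous h sD) auto
    then have "((\<lambda>s. (sqrt s * profile h s / 2) *\<^sub>R profile D s) \<longlongrightarrow> (sqrt 0 * profile h 0 / 2) *\<^sub>R profile D 0) (at 0 within UNIV)"
      unfolding continuous_on_def by blast
    then have l: "((\<lambda>s. (sqrt s * profile h s / 2) *\<^sub>R profile D s) \<longlongrightarrow> 0) (at_right 0)"
      by (simp add: tendsto_within_subset[where S = UNIV])
    have "\<forall>\<^sub>F s in at_right (0::real). s > 0" by (simp add: eventually_at_right_less)
    then have "\<forall>\<^sub>F s in at_right 0. (sqrt s * profile h s / 2) *\<^sub>R profile D s = (s * profile h s) *\<^sub>R e s"
    proof (rule eventually_mono)
      fix s :: real assume "s > 0"
      then have "s / sqrt s = sqrt s" by (simp add: real_div_sqrt)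
      then have "s * profile h s / sqrt s = sqrt s * profile h s" by (metis times_divide_eq_left)
      then show "(sqrt s * profile h s / 2) *\<^sub>R profile D s = (s * profile h s) *\<^sub>R e s"
        by (simp add: e_def field_simps)
    qed
    then show ?thesis using l by (rule Lim_transform_eventually[rotated])
  qed
  then show ?thesis using that e q by blast
qed

section \<open>Integration on the projective line\<close>

text \<open>Both orders of the coordinates are provided, so that later each partial derivative can
  be integrated first in its own direction.\<close>

lemma lborel_complex:
  "(lborel :: complex measure) = distr lborel borel (\<lambda>p::real \<times> real. Complex (fst p) (snd p))"
  "(lborel :: complex measure) = distr lborel borel (\<lambda>p::real \<times> real. Complex (snd p) (fst p))"
proof -
  have meas: "(\<lambda>p::real \<times> real. Complex (fst p) (snd p)) \<in> borel_measurable borel"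
    "(\<lambda>p::real \<times> real. Complex (snd p) (fst p)) \<in> borel_measurable borel"
    by (intro borel_measurable_continuous_onI continuous_intros)+
  have box1: "(\<lambda>p. Complex (fst p) (snd p)) -` box l u = box (Re l, Im l) (Re u, Im u)"
    and box2: "(\<lambda>p. Complex (snd p) (fst p)) -` box l u = box (Im l, Re l) (Im u, Re u)" for l u
    by (auto simp: box_def Basis_prod_def Basis_complex_def)
  have em1: "emeasure lborel (box (a, b) (c, d)) = ennreal ((c - a) * (d - b))"
    if "a \<le> c" "b \<le> d" for a b c d :: real
  proof -
    have "emeasure lborel (box (a, b) (c, d)) = (\<Prod>x\<in>Basis. ((c, d) - (a, b)) \<bullet> x)"
      by (rule emeasure_lborel_box) (use that in \<open>auto simp: Basis_prod_def\<close>)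
    also have "(\<Prod>x\<in>Basis. ((c, d) - (a, b)) \<bullet> x) = (c - a) * (d - b)"
      by (simp add: Basis_prod_def prod.union_disjoint disjnt_iff)
    finally show ?thesis .
  qed
  show "(lborel :: complex measure) = distr lborel borel (\<lambda>p::real \<times> real. Complex (fst p) (snd p))"
  proof (rule lborel_eqI)
    fix l u :: complex assume le: "\<And>b. b \<in> Basis \<Longrightarrow> l \<bullet> b \<le> u \<bullet> b"
    then have r: "Re l \<le> Re u" "Im l \<le> Im u" using le[of 1] le[of \<i>] by (simp_all add: Basis_complex_def)
    show "emeasure (distr lborel borel (\<lambda>p::real \<times> real. Complex (fst p) (snd p))) (box l u) = (\<Prod>b\<in>Basis. (u - l) \<bullet> b)"
      using meas by (simp add: emeasure_distr box1 em1[OF r] Basis_complex_def)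
  qed simp
  show "(lborel :: complex measure) = distr lborel borel (\<lambda>p::real \<times> real. Complex (snd p) (fst p))"
  proof (rule lborel_eqI)
    fix l u :: complex assume le: "\<And>b. b \<in> Basis \<Longrightarrow> l \<bullet> b \<le> u \<bullet> b"
    then have r: "Re l \<le> Re u" "Im l \<le> Im u" using le[of 1] le[of \<i>] by (simp_all add: Basis_complex_def)
    show "emeasure (distr lborel borel (\<lambda>p::real \<times> real. Complex (snd p) (fst p))) (box l u) = (\<Prod>b\<in>Basis. (u - l) \<bullet> b)"
      using meas by (simp add: emeasure_distr box2 em1[OF r(2,1)] Basis_complex_def mult.commute)
  qed simp
qed

section \<open>The theorem of Stokes in the plane\<close>

definition square :: "real \<Rightarrow> complex set" where
  "square R = cbox (Complex (- R) (- R)) (Complex R R)"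

lemma square_integral:
  fixes u :: "complex \<Rightarrow> complex"
  assumes u: "continuous_on UNIV u"
  shows "(LINT z|lborel. indicator (square R) z *\<^sub>R u z)
      = integral {-R..R} (\<lambda>x. integral {-R..R} (\<lambda>y. u (Complex x y)))" (is "?L = ?A")
    and "(LINT z|lborel. indicator (square R) z *\<^sub>R u z)
      = integral {-R..R} (\<lambda>y. integral {-R..R} (\<lambda>x. u (Complex x y)))" (is "?L = ?B")
proof -
  have meas: "(\<lambda>z. indicator (square R) z *\<^sub>R u z) \<in> borel_measurable borel"
    by (intro borel_measurable_scaleR borel_measurable_indicator borel_measurable_continuous_onI u)
       (simp add: square_def)
  have c: "continuous_on A (\<lambda>p::real \<times> real. Complex (fst p) (snd p))"
    "continuous_on A (\<lambda>p::real \<times> real. Complex (snd p) (fst p))" for A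
    by (intro continuous_intros)+
  have T: "(\<lambda>p::real \<times> real. Complex (fst p) (snd p)) \<in> borel_measurable lborel"
    "(\<lambda>p::real \<times> real. Complex (snd p) (fst p)) \<in> borel_measurable lborel"
    using borel_measurable_continuous_onI[OF c(1)] borel_measurable_continuous_onI[OF c(2)] by simp_all
  have ind: "indicator (square R) (Complex x y) = (indicator (cbox (-R,-R) (R,R)) (x, y) :: real)"
    "indicator (square R) (Complex y x) = (indicator (cbox (-R,-R) (R,R)) (x, y) :: real)" for x y
    by (auto simp: square_def indicator_def in_cbox_complex_iff cbox_Pair_eq box_real)
  have key: "(LINT p|lborel. indicator (cbox (-R,-R) (R,R)) p *\<^sub>R w p)
      = integral {-R..R} (\<lambda>x. integral {-R..R} (\<lambda>y. w (x, y)))"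
    if w: "continuous_on UNIV w" for w :: "real \<times> real \<Rightarrow> complex"
  proof -
    have "set_integrable lborel (cbox (-R,-R) (R,R)) w" unfolding set_integrable_def
      by (rule borel_integrable_compact) (auto intro: continuous_on_subset[OF w])
    from set_borel_integral_eq_integral(2)[OF this]
    have "(LINT p|lborel. indicator (cbox (-R,-R) (R,R)) p *\<^sub>R w p) = integral (cbox (-R,-R) (R,R)) w"
      by (simp add: set_lebesgue_integral_def)
    also have "\<dots> = integral (cbox (-R) R) (\<lambda>x. integral (cbox (-R) R) (\<lambda>y. w (x, y)))"
      by (rule integral_prod_continuous) (auto intro: continuous_on_subset[OF w])
    finally show ?thesis by (simp add: box_real)
  qed
  have "?L = (LINT p|lborel. indicator (cbox (-R,-R) (R,R)) p *\<^sub>R u (Complex (fst p) (snd p)))"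
    by (subst lborel_complex(1)) (simp add: integral_distr[OF T(1)[unfolded measurable_lborel1] meas] integral_distr[OF T(1) meas] ind(1)[of "fst _" "snd _", simplified])
  also have "\<dots> = ?A" by (subst key) (auto intro!: continuous_on_compose2[OF u] c)
  finally show "?L = ?A" .
  have "?L = (LINT p|lborel. indicator (cbox (-R,-R) (R,R)) p *\<^sub>R u (Complex (snd p) (fst p)))"
    by (subst lborel_complex(2)) (simp add: integral_distr[OF T(2)[unfolded measurable_lborel1] meas] integral_distr[OF T(2) meas] ind(2)[of "snd _" "fst _", simplified])
  also have "\<dots> = ?B" by (subst key) (auto intro!: continuous_on_compose2[OF u] c)
  finally show "?L = ?B" .
qed

lemma iterated_derivative_bound:
  fixes w w' :: "real \<Rightarrow> real \<Rightarrow> complex"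
  assumes R: "R > 0"
    and d: "\<And>x y. (w x has_vector_derivative w' x y) (at y)"
    and cont: "continuous_on UNIV (\<lambda>p. w' (fst p) (snd p))"
    and b: "\<And>x. \<bar>x\<bar> \<le> R \<Longrightarrow> norm (w x R) \<le> B \<and> norm (w x (- R)) \<le> B"
  shows "norm (integral {-R..R} (\<lambda>x. integral {-R..R} (\<lambda>y. w' x y))) \<le> 2 * B * (2 * R)"
proof -
  have i: "integral {-R..R} (\<lambda>y. w' x y) = w x R - w x (- R)" for x
    using R by (intro integral_unique fundamental_theorem_of_calculus) (auto intro: has_vector_derivative_at_within d)
  have "norm (integral {-R..R} (\<lambda>x. integral {-R..R} (\<lambda>y. w' x y))) \<le> (2 * B) * (R - (- R))"
  proof (rule integral_bound)
    show "continuous_on {-R..R} (\<lambda>x. integral {-R..R} (\<lambda>y. w' x y))"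
      unfolding box_real(2)[symmetric]
      by (rule integral_continuous_on_param) (auto simp: split_beta intro: continuous_on_subset[OF cont])
    fix x assume "x \<in> {-R..R}"
    then have "norm (w x R) \<le> B" "norm (w x (- R)) \<le> B" using b[of x] by auto
    then show "norm (integral {-R..R} (\<lambda>y. w' x y)) \<le> 2 * B" unfolding i
      using norm_triangle_ineq4[of "w x R" "w x (- R)"] by linarith
  qed (use R in auto)
  then show ?thesis by simp
qed

text \<open>Stokes on growing squares: the sides have length 2 R and \<eta> is at most C / R^2 on
  them, so the boundary terms are O(1/R). On squares the fundamental theorem of calculus applies in
  each variable separately; dominated convergence leads to the plane.\<close>

lemma integral_d_z_eq_0:
  fixes \<eta> :: "complex \<Rightarrow> complex"
  assumes \<eta>: "smooth \<eta>" and bound: "\<And>z. cmod z \<ge> 1 \<Longrightarrow> cmod (\<eta> z) \<le> C / (cmod z)\<^sup>2"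
    and int: "integrable lborel (d_z \<eta>)"
  shows "(LINT z|lborel. d_z \<eta> z) = 0"
proof -
  define D where "D = (\<lambda>v p. frechet_derivative \<eta> (at p) v)"
  have D: "(\<eta> has_derivative (\<lambda>v. D v p)) (at p)" for p
    unfolding D_def by (rule smooth_has_derivative[OF \<eta>])
  have cD: "continuous_on UNIV (D v)" for v
    unfolding D_def by (rule smooth_continuous[OF smooth_frechet[OF \<eta>]])
  have lin: "linear (\<lambda>v. D v p)" for p using has_derivative_linear[OF D] .
  have C0: "C \<ge> 0" using bound[of 1] norm_ge_zero[of "\<eta> 1"] by (simp del: norm_ge_zero)
  have edge: "cmod (\<eta> (Complex x y)) \<le> C / R\<^sup>2" if "R \<ge> 1" "\<bar>x\<bar> = R \<or> \<bar>y\<bar> = R" for x y R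
  proof -
    have "R \<le> cmod (Complex x y)" using that abs_Re_le_cmod[of "Complex x y"] abs_Im_le_cmod[of "Complex x y"] by auto
    then have 1: "cmod (Complex x y) \<ge> 1" "R\<^sup>2 \<le> (cmod (Complex x y))\<^sup>2" using that by (auto intro: power_mono)
    have "cmod (\<eta> (Complex x y)) \<le> C / (cmod (Complex x y))\<^sup>2" by (rule bound[OF 1(1)])
    also have "\<dots> \<le> C / R\<^sup>2" using 1 that C0 by (intro divide_left_mono) (auto intro!: mult_pos_pos zero_less_power)
    finally show ?thesis .
  qed
  have part: "norm (LINT z|lborel. indicator (square R) z *\<^sub>R D 1 z) \<le> 4 * C / R"
    "norm (LINT z|lborel. indicator (square R) z *\<^sub>R D \<i> z) \<le> 4 * C / R" if R: "R \<ge> 1" for R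
  proof -
    have eq: "2 * (C / R\<^sup>2) * (2 * R) = 4 * C / R" using R by (simp add: power2_eq_square field_simps)
    have dx: "((\<lambda>x. \<eta> (Complex x y)) has_vector_derivative D 1 (Complex x y)) (at x)" for x y
    proof -
      have "((\<lambda>x. Complex x y) has_derivative (\<lambda>t. t *\<^sub>R 1)) (at x)"
        unfolding Complex_eq by (auto intro!: derivative_eq_intros simp: scaleR_conv_of_real)
      from has_derivative_compose[OF this D] show ?thesis
        unfolding has_vector_derivative_def by (simp add: linear_scale[OF lin])
    qed
    have dy: "((\<lambda>y. \<eta> (Complex x y)) has_vector_derivative D \<i> (Complex x y)) (at y)" for x y
    proof -
      have "((\<lambda>y. Complex x y) has_derivative (\<lambda>t. t *\<^sub>R \<i>)) (at y)"
        unfolding Complex_eq by (auto intro!: derivative_eq_intros simp: scaleR_conv_of_real)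
      from has_derivative_compose[OF this D] show ?thesis
        unfolding has_vector_derivative_def by (simp add: linear_scale[OF lin])
    qed
    have "norm (integral {-R..R} (\<lambda>y. integral {-R..R} (\<lambda>x. D 1 (Complex x y)))) \<le> 2 * (C / R\<^sup>2) * (2 * R)"
      by (rule iterated_derivative_bound[where w = "\<lambda>y x. \<eta> (Complex x y)"])
         (use R in \<open>auto intro!: dx edge continuous_on_compose2[OF cD] continuous_intros\<close>)
    then show "norm (LINT z|lborel. indicator (square R) z *\<^sub>R D 1 z) \<le> 4 * C / R"
      unfolding square_integral(2)[OF cD] eq .
    have "norm (integral {-R..R} (\<lambda>x. integral {-R..R} (\<lambda>y. D \<i> (Complex x y)))) \<le> 2 * (C / R\<^sup>2) * (2 * R)"
      by (rule iterated_derivative_bound[where w = "\<lambda>x y. \<eta> (Complex x y)"])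
         (use R in \<open>auto intro!: dy edge continuous_on_compose2[OF cD] continuous_intros\<close>)
    then show "norm (LINT z|lborel. indicator (square R) z *\<^sub>R D \<i> z) \<le> 4 * C / R"
      unfolding square_integral(1)[OF cD] eq .
  qed
  have intD: "integrable lborel (\<lambda>z. indicator (square R) z *\<^sub>R D v z)" for R v
    unfolding square_def by (rule borel_integrable_compact) (auto intro: continuous_on_subset[OF cD])
  have whole: "norm (LINT z|lborel. indicator (square R) z *\<^sub>R d_z \<eta> z) \<le> 4 * C / R" if R: "R \<ge> 1" for R
  proof -
    have "(LINT z|lborel. indicator (square R) z *\<^sub>R d_z \<eta> z)
       = (LINT z|lborel. (1/2) * (indicator (square R) z *\<^sub>R D 1 z - \<i> * (indicator (square R) z *\<^sub>R D \<i> z)))"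
      by (rule Bochner_Integration.integral_cong) (auto simp: d_z_def D_def indicator_def)
    also have "\<dots> = (1/2) * ((LINT z|lborel. indicator (square R) z *\<^sub>R D 1 z) - \<i> * (LINT z|lborel. indicator (square R) z *\<^sub>R D \<i> z))"
      by (simp only: integral_mult_right_zero Bochner_Integration.integral_diff[OF intD integrable_mult_right[OF intD]])
    also have "norm \<dots> \<le> (1/2) * (4 * C / R + 4 * C / R)"
      unfolding norm_mult using part[OF R] norm_triangle_ineq4[of "(LINT z|lborel. indicator (square R) z *\<^sub>R D 1 z)" "\<i> * (LINT z|lborel. indicator (square R) z *\<^sub>R D \<i> z)"]
      by (simp add: norm_mult)
    finally show ?thesis by simp
  qed
  have lim: "(\<lambda>n. LINT z|lborel. indicator (square (real n)) z *\<^sub>R d_z \<eta> z) \<longlonglongrightarrow> (LINT z|lborel. d_z \<eta> z)"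
  proof (rule integral_dominated_convergence[where w = "\<lambda>z. norm (d_z \<eta> z)"])
    show "AE z in lborel. (\<lambda>n. indicator (square (real n)) z *\<^sub>R d_z \<eta> z) \<longlonglongrightarrow> d_z \<eta> z"
    proof (rule AE_I2, rule tendsto_eventually)
      fix z :: complex
      obtain N :: nat where N: "cmod z \<le> real N" using real_arch_simple by blast
      have "z \<in> square (real n)" if "n \<ge> N" for n
        using N that abs_Re_le_cmod[of z] abs_Im_le_cmod[of z] unfolding square_def in_cbox_complex_iff by auto
      then show "\<forall>\<^sub>F n in sequentially. indicator (square (real n)) z *\<^sub>R d_z \<eta> z = d_z \<eta> z"
        by (auto simp: eventually_sequentially intro!: exI[of _ N])
    qed
  qed (use int in \<open>auto simp: square_def indicator_def\<close>)
  have "(\<lambda>n. LINT z|lborel. indicator (square (real n)) z *\<^sub>R d_z \<eta> z) \<longlonglongrightarrow> 0"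
  proof (rule Lim_null_comparison)
    show "\<forall>\<^sub>F n in sequentially. norm (LINT z|lborel. indicator (square (real n)) z *\<^sub>R d_z \<eta> z) \<le> 4 * C / real n"
      using eventually_ge_at_top[of 1] by eventually_elim (auto intro: whole)
    show "(\<lambda>n. 4 * C / real n) \<longlonglongrightarrow> 0" by (rule lim_const_over_n)
  qed
  then show ?thesis using lim LIMSEQ_unique by blast
qed

section \<open>Radial integrals as integrals over s\<close>

text \<open>The disc |z|^2 \<le> a has area \<pi> a, and such half-lines generate the Borel sets.
  This is the origin of the factor \<pi> in the radial densities.\<close>

lemma distr_norm_sq:
  "distr lborel borel (\<lambda>z. (cmod z)\<^sup>2) = density lborel (\<lambda>s::real. ennreal (pi * indicator {0..} s))"
proof (rule measure_eqI_generator_eq[of "range (\<lambda>a. {..a::real})" UNIV])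
  have meas: "(\<lambda>z. (cmod z)\<^sup>2) \<in> borel_measurable lborel" by simp
  show "Int_stable (range (\<lambda>a. {..a::real}))" by (auto simp: Int_stable_def)
  have left: "emeasure (distr lborel borel (\<lambda>z. (cmod z)\<^sup>2)) {..a} = (if a \<ge> 0 then ennreal (pi * a) else 0)" for a
  proof (cases "a \<ge> 0")
    case True
    have "(\<lambda>z. (cmod z)\<^sup>2) -` {..a} = cball 0 (sqrt a)"
      by (auto simp: real_le_rsqrt) (metis True norm_ge_zero power_mono real_sqrt_pow2)
    then show ?thesis using True meas emeasure_cball[of "sqrt a" "0::complex"]
      by (simp add: emeasure_distr unit_ball_vol_2)
  next
    case False
    then have "(\<lambda>z. (cmod z)\<^sup>2) -` {..a} = {}" by auto (smt (verit) zero_le_power2)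
    then show ?thesis using False meas by (simp add: emeasure_distr)
  qed
  have right: "emeasure (density lborel (\<lambda>s::real. ennreal (pi * indicator {0..} s))) {..a} = (if a \<ge> 0 then ennreal (pi * a) else 0)" for a
  proof -
    have "emeasure (density lborel (\<lambda>s::real. ennreal (pi * indicator {0..} s))) {..a}
       = (\<integral>\<^sup>+ s. ennreal pi * indicator {0..a} s \<partial>lborel)"
      by (subst emeasure_density) (auto intro!: nn_integral_cong simp: indicator_def)
    also have "\<dots> = ennreal pi * emeasure lborel {0..a}" by (rule nn_integral_cmult_indicator) simp
    also have "\<dots> = (if a \<ge> 0 then ennreal (pi * a) else 0)" by (auto simp: ennreal_mult)
    finally show ?thesis .
  qed
  show "emeasure (distr lborel borel (\<lambda>z. (cmod z)\<^sup>2)) X = emeasure (density lborel (\<lambda>s::real. ennreal (pi * indicator {0..} s))) X"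
    if "X \<in> range (\<lambda>a. {..a::real})" for X using that left right by auto
  show "sets (distr lborel borel (\<lambda>z. (cmod z)\<^sup>2)) = sigma_sets UNIV (range (\<lambda>a. {..a::real}))"
    "sets (density lborel (\<lambda>s::real. ennreal (pi * indicator {0..} s))) = sigma_sets UNIV (range (\<lambda>a. {..a::real}))"
    by (simp_all add: borel_eq_atMost)
  show "range (\<lambda>n. {..real n}) \<subseteq> range (\<lambda>a. {..a::real})" by auto
  show "(\<Union>i. {..real i}) = UNIV" using real_arch_simple by auto
  show "emeasure (distr lborel borel (\<lambda>z. (cmod z)\<^sup>2)) {..real i} \<noteq> \<infinity>" for i unfolding left by simp
qed auto

lemma nn_integral_radial:
  fixes \<phi> :: "real \<Rightarrow> real"
  assumes \<phi>: "\<phi> \<in> borel_measurable borel" "\<And>s. \<phi> s \<ge> 0"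
  shows "(\<integral>\<^sup>+ z. ennreal (\<phi> ((cmod z)\<^sup>2)) \<partial>lborel) = (\<integral>\<^sup>+ s. ennreal (pi * \<phi> s) * indicator {0..} s \<partial>lborel)"
proof -
  have "(\<integral>\<^sup>+ z. ennreal (\<phi> ((cmod z)\<^sup>2)) \<partial>lborel) = (\<integral>\<^sup>+ s. ennreal (\<phi> s) \<partial>distr lborel borel (\<lambda>z. (cmod z)\<^sup>2))"
    using \<phi> by (subst nn_integral_distr) auto
  also have "\<dots> = (\<integral>\<^sup>+ s. ennreal (pi * indicator {0..} s) * ennreal (\<phi> s) \<partial>lborel)"
    unfolding distr_norm_sq using \<phi> by (subst nn_integral_density) auto
  also have "\<dots> = (\<integral>\<^sup>+ s. ennreal (pi * \<phi> s) * indicator {0..} s \<partial>lborel)"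
    using \<phi>(2) by (intro nn_integral_cong) (auto simp: indicator_def ennreal_mult)
  finally show ?thesis .
qed

text \<open>Lets the normalisation of a volume form, an integral over the plane, be used as the
  limit of a primitive in s.\<close>

lemma radial_mass_limit:
  fixes \<phi> M :: "real \<Rightarrow> real"
  assumes \<phi>: "continuous_on UNIV \<phi>" "\<And>s. \<phi> s \<ge> 0"
    and int: "integrable lborel (\<lambda>z. \<phi> ((cmod z)\<^sup>2))"
    and M: "\<And>s. (M has_real_derivative pi * \<phi> s) (at s)" "M 0 = 0"
  shows "(M \<longlongrightarrow> (LINT z|lborel. \<phi> ((cmod z)\<^sup>2))) at_top"
proof -
  have meas: "\<phi> \<in> borel_measurable borel" by (rule borel_measurable_continuous_onI[OF \<phi>(1)])
  define g where "g = (\<lambda>s. pi * \<phi> s * indicator {0..} s)"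
  have g0: "g s \<ge> 0" for s using \<phi>(2) by (simp add: g_def)
  have gm: "g \<in> borel_measurable borel" unfolding g_def using meas by simp
  have "ennreal (LINT z|lborel. \<phi> ((cmod z)\<^sup>2)) = (\<integral>\<^sup>+ z. ennreal (\<phi> ((cmod z)\<^sup>2)) \<partial>lborel)"
    using nn_integral_eq_integral[OF int] \<phi>(2) by simp
  also have "\<dots> = (\<integral>\<^sup>+ s. ennreal (g s) \<partial>lborel)"
    unfolding nn_integral_radial[OF meas \<phi>(2)]
    by (rule nn_integral_cong) (auto simp: g_def indicator_def)
  finally have eq: "(\<integral>\<^sup>+ s. ennreal (g s) \<partial>lborel) = ennreal (LINT z|lborel. \<phi> ((cmod z)\<^sup>2))" by simp
  have gi: "integrable lborel g"
    by (rule integrableI_nonneg) (use gm g0 eq in auto)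
  have gl: "(LINT s|lborel. g s) = (LINT z|lborel. \<phi> ((cmod z)\<^sup>2))"
    using nn_integral_eq_integral[OF gi] g0 eq \<phi>(2) by (simp add: integral_nonneg_AE)
  have "((\<lambda>y. LINT s|lborel. indicator {..y} s *\<^sub>R g s) \<longlongrightarrow> (LINT s|lborel. g s)) at_top"
    by (rule tendsto_integral_at_top[OF _ gi]) simp
  moreover have "\<forall>\<^sub>F y in at_top. (LINT s|lborel. indicator {..y} s *\<^sub>R g s) = M y"
  proof (rule eventually_mono[OF eventually_ge_at_top[of 0]])
    fix y :: real assume y: "0 \<le> y"
    have "(LINT s|lborel. indicator {..y} s *\<^sub>R g s) = (LINT s|lborel. pi * \<phi> s * indicator {0..y} s)"
      by (rule Bochner_Integration.integral_cong) (auto simp: g_def indicator_def)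
    also have "\<dots> = M y - M 0"
      by (rule integral_FTC_Icc_real[OF y M(1)]) (use \<phi>(1) in \<open>auto simp: continuous_on_eq_continuous_at\<close>)
    finally show "(LINT s|lborel. indicator {..y} s *\<^sub>R g s) = M y" using M(2) by simp
  qed
  ultimately show ?thesis unfolding gl using Lim_transform_eventually by fast
qed

text \<open>The set where \<phi> differs from 0 is open, and a nonempty open set is not
  negligible.\<close>

lemma continuous_AE_zero:
  fixes \<phi> :: "complex \<Rightarrow> real"
  assumes "continuous_on UNIV \<phi>" "AE z in lborel. \<phi> z = 0"
  shows "\<phi> z = 0"
proof (rule ccontr)
  assume "\<phi> z \<noteq> 0"
  define S where "S = {z. \<phi> z \<noteq> 0}"
  have "open S" unfolding S_def using assms(1) by (intro open_Collect_neq) auto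
  moreover have "S \<noteq> {}" using \<open>\<phi> z \<noteq> 0\<close> by (auto simp: S_def)
  ultimately have "\<not> negligible S" by (rule open_not_negligible)
  moreover have "S \<in> null_sets lborel"
    using assms(2) \<open>open S\<close> by (intro AE_iff_null_sets[THEN iffD2]) (auto simp: S_def)
  then have "negligible S" unfolding negligible_iff_null_sets by (rule null_sets_completionI)
  ultimately show False by simp
qed

section \<open>Wirtinger calculus under the change of chart\<close>

lemma wirtinger:
  assumes "(f has_derivative D) (at p)"
  shows "D v = d_z f p * v + d_zbar f p * cnj v"
proof -
  have lin: "linear D" by (rule has_derivative_linear[OF assms])
  have "D v = D (Re v *\<^sub>R 1 + Im v *\<^sub>R \<i>)" by (rule arg_cong[of _ _ D]) (simp add: complex_eq_iff)
  also have "\<dots> = Re v *\<^sub>R D 1 + Im v *\<^sub>R D \<i>" by (simp add: linear_add[OF lin] linear_scale[OF lin])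
  also have "\<dots> = d_z f p * v + d_zbar f p * cnj v"
    unfolding d_z_eq[OF assms] d_zbar_eq[OF assms]
    by (simp add: complex_eq_iff algebra_simps field_simps)
  finally show ?thesis .
qed

lemma wirtinger_unique:
  assumes "(f has_derivative (\<lambda>v. a * v + b * cnj v)) (at p)"
  shows "d_z f p = a" "d_zbar f p = b"
  unfolding d_z_eq[OF assms] d_zbar_eq[OF assms] by (simp_all add: complex_eq_iff)

lemma wirtinger_has_derivative:
  "smooth f \<Longrightarrow> (f has_derivative (\<lambda>v. d_z f p * v + d_zbar f p * cnj v)) (at p)"
  by (rule has_derivative_eq_rhs[OF smooth_has_derivative]) (auto simp: fun_eq_iff wirtinger[OF smooth_has_derivative])

lemma d_z_mult:
  assumes "smooth f" "smooth g"
  shows "d_z (\<lambda>p. f p * g p) p = d_z f p * g p + f p * d_z g p"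
proof (rule wirtinger_unique(1))
  show "((\<lambda>p. f p * g p) has_derivative (\<lambda>v. (d_z f p * g p + f p * d_z g p) * v + (d_zbar f p * g p + f p * d_zbar g p) * cnj v)) (at p)"
    by (rule has_derivative_eq_rhs[OF has_derivative_mult[OF wirtinger_has_derivative[OF assms(1)] wirtinger_has_derivative[OF assms(2)]]])
       (simp add: fun_eq_iff algebra_simps)
qed

lemma d_z_cnj:
  assumes "smooth f"
  shows "d_z (\<lambda>p. cnj (f p)) p = cnj (d_zbar f p)"
proof (rule wirtinger_unique(1))
  show "((\<lambda>p. cnj (f p)) has_derivative (\<lambda>v. cnj (d_zbar f p) * v + cnj (d_z f p) * cnj v)) (at p)"
    by (rule has_derivative_eq_rhs[OF has_derivative_cnj[OF wirtinger_has_derivative[OF assms]]])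
       (simp add: fun_eq_iff)
qed

lemma inverse_chart_derivative:
  assumes S: "smooth S" and z: "z \<noteq> 0"
  shows "((\<lambda>z. S (1 / z)) has_derivative
     (\<lambda>v. (- d_z S (1 / z) / z\<^sup>2) * v + (- d_zbar S (1 / z) / (cnj z)\<^sup>2) * cnj v)) (at z)"
proof -
  have "((\<lambda>z. 1 / z) has_derivative (\<lambda>v. - v / z\<^sup>2)) (at z)"
    using z by (auto intro!: derivative_eq_intros simp: power2_eq_square field_simps)
  from has_derivative_compose[OF this wirtinger_has_derivative[OF S]]
  show ?thesis by (rule has_derivative_eq_rhs) (simp add: fun_eq_iff)
qed

text \<open>The factor z^m is holomorphic and passes through; what remains is the conjugate of the
  derivative - 1/z^2 of the change of chart.\<close>

lemma d_zbar_section: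
  assumes S: "smooth S" and z: "z \<noteq> 0" and f: "\<And>z. z \<noteq> 0 \<Longrightarrow> f z = z ^ m * S (1 / z)"
  shows "d_zbar f z = - (z ^ m * d_zbar S (1 / z) / (cnj z)\<^sup>2)"
proof -
  have "\<forall>\<^sub>F p in nhds z. p \<noteq> 0" using z by (rule t1_space_nhds)
  then have "\<forall>\<^sub>F p in nhds z. f p = p ^ m * S (1 / p)" by (rule eventually_mono) (rule f)
  then have "d_zbar f z = d_zbar (\<lambda>z. z ^ m * S (1 / z)) z" by (rule d_z_cong(2))
  also have "\<dots> = - (z ^ m * d_zbar S (1 / z) / (cnj z)\<^sup>2)"
  proof (rule wirtinger_unique(2))
    have "((\<lambda>z. z ^ m) has_derivative (\<lambda>v. of_nat m * z ^ (m - 1) * v)) (at z)"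
    proof -
      have "((\<lambda>z. z ^ m) has_field_derivative of_nat m * z ^ (m - 1)) (at z)"
        by (auto intro!: derivative_eq_intros)
      then show ?thesis by (simp add: has_field_derivative_def)
    qed
    from has_derivative_mult[OF this inverse_chart_derivative[OF S z]]
    show "((\<lambda>z. z ^ m * S (1 / z)) has_derivative
       (\<lambda>v. (of_nat m * z ^ (m - 1) * S (1 / z) - z ^ m * d_z S (1 / z) / z\<^sup>2) * v
           + (- (z ^ m * d_zbar S (1 / z) / (cnj z)\<^sup>2)) * cnj v)) (at z)"
      by (rule has_derivative_eq_rhs) (simp add: fun_eq_iff algebra_simps)
  qed
  finally show ?thesis .
qed

text \<open>The mirror image of the rule for sections: here the power of the conjugate passes
  through d_z.\<close>

lemma d_z_antiholomorphic_factor: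
  assumes T: "smooth T" and z: "z \<noteq> 0" and f: "\<And>z. z \<noteq> 0 \<Longrightarrow> f z = - (T (1 / z) / cnj z ^ n)"
  shows "d_z f z = d_z T (1 / z) / (z\<^sup>2 * cnj z ^ n)"
proof -
  have "\<exists>c. ((\<lambda>p. inverse p ^ n) has_field_derivative c) (at z)"
    by (rule exI) (rule derivative_eq_intros refl z)+
  then obtain c where c: "((\<lambda>p. inverse p ^ n) has_field_derivative c) (at z)" by blast
  have "\<forall>\<^sub>F p in nhds z. p \<noteq> 0" using z by (rule t1_space_nhds)
  then have "\<forall>\<^sub>F p in nhds z. f p = cnj (inverse p ^ n) * - T (1 / p)"
    by (rule eventually_mono) (simp add: f divide_inverse power_inverse mult.commute)
  then have "d_z f z = d_z (\<lambda>p. cnj (inverse p ^ n) * - T (1 / p)) z" by (rule d_z_cong(1))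
  also have "\<dots> = d_z T (1 / z) / (z\<^sup>2 * cnj z ^ n)"
  proof (rule wirtinger_unique(1))
    have "((\<lambda>p. cnj (inverse p ^ n)) has_derivative (\<lambda>v. cnj (c * v))) (at z)"
      using c unfolding has_field_derivative_def by (rule has_derivative_cnj)
    from has_derivative_mult[OF this has_derivative_minus[OF inverse_chart_derivative[OF T z]]]
    show "((\<lambda>p. cnj (inverse p ^ n) * - T (1 / p)) has_derivative
       (\<lambda>v. (d_z T (1 / z) / (z\<^sup>2 * cnj z ^ n)) * v
           + (cnj (inverse z ^ n) * (d_zbar T (1 / z) / (cnj z)\<^sup>2) - cnj c * T (1 / z)) * cnj v)) (at z)"
      by (rule has_derivative_eq_rhs) (simp add: fun_eq_iff algebra_simps divide_inverse power_inverse)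
  qed
  finally show ?thesis .
qed

section \<open>The Laplacian as a differential operator\<close>

definition flux :: "real charts \<Rightarrow> complex charts \<Rightarrow> complex charts" where
  "flux h s = (\<lambda>p. complex_of_real (fst h p) * d_zbar (fst s) p, \<lambda>p. complex_of_real (snd h p) * d_zbar (snd s) p)"

text \<open>The operator found by integrating by parts in the adjoint relation. The factor \<pi>
  comes from the 1/\<pi> in \<open>inner_01\<close>, which \<open>inner_00\<close> does not
  contain.\<close>

definition explicit_laplacian :: "real charts \<Rightarrow> real charts \<Rightarrow> complex charts \<Rightarrow> complex charts" where
  "explicit_laplacian \<omega> h s =
     (\<lambda>z. complex_of_real (- inverse (pi * fst h z * fst \<omega> z)) * d_z (fst (flux h s)) z,
      \<lambda>w. complex_of_real (- inverse (pi * snd h w * snd \<omega> w)) * d_z (snd (flux h s)) w)"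

lemma cmod_even_power: "complex_of_real (cmod z ^ (2 * n)) = z ^ n * cnj z ^ n"
proof -
  have "complex_of_real (cmod z ^ (2 * n)) = (complex_of_real ((cmod z)\<^sup>2)) ^ n" by (simp add: power_mult)
  then show ?thesis unfolding complex_norm_square power_mult_distrib .
qed

text \<open>The closed unit discs of the two charts are compact and cover the projective line. The
  bound on the second disc, read in the first chart, is a decay of order p.\<close>

lemma two_chart_bound:
  fixes f g :: "complex \<Rightarrow> complex"
  assumes "continuous_on UNIV f" "continuous_on UNIV g"
    and fg: "\<And>z. cmod z \<ge> 1 \<Longrightarrow> cmod (f z) * cmod z ^ p \<le> cmod (g (1 / z))"
  shows "\<exists>C\<ge>0. (\<forall>z. cmod z \<le> 1 \<longrightarrow> cmod (f z) \<le> C) \<and> (\<forall>z. cmod z \<ge> 1 \<longrightarrow> cmod (f z) \<le> C / cmod z ^ p)"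
proof -
  have bd: "\<exists>B. \<forall>z. cmod z \<le> 1 \<longrightarrow> cmod (k z) \<le> B" if "continuous_on UNIV k" for k :: "complex \<Rightarrow> complex"
  proof -
    have "compact (k ` cball 0 1)"
      by (rule compact_continuous_image) (auto intro: continuous_on_subset[OF that])
    then have "bounded (k ` cball 0 1)" by (rule compact_imp_bounded)
    then obtain B where B: "\<forall>x \<in> k ` cball 0 1. norm x \<le> B" unfolding bounded_iff by (elim exE)
    have "cmod (k z) \<le> B" if "cmod z \<le> 1" for z
      by (rule B[rule_format]) (rule imageI, use that in simp)
    then show ?thesis by (intro exI[of _ B] allI impI)
  qed
  obtain A where A: "\<And>z. cmod z \<le> 1 \<Longrightarrow> cmod (f z) \<le> A" using bd[OF assms(1)] by blast
  obtain B where B: "\<And>z. cmod z \<le> 1 \<Longrightarrow> cmod (g z) \<le> B" using bd[OF assms(2)] by blast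
  define C where "C = max 0 (max A B)"
  show ?thesis
  proof (intro exI[of _ C] conjI allI impI)
    fix z assume z: "cmod z \<ge> 1"
    then have "cmod (1 / z) \<le> 1" by (simp add: norm_divide divide_le_eq)
    then have "cmod (f z) * cmod z ^ p \<le> C" using fg[OF z] B[of "1 / z"] by (simp add: C_def)
    moreover have "cmod z ^ p > 0" using z by (intro zero_less_power) linarith
    ultimately show "cmod (f z) \<le> C / cmod z ^ p" by (simp add: field_simps)
  qed (use A in \<open>force simp: C_def\<close>)+
qed

locale hermitian_pair =
  fixes m :: nat and \<omega> h :: "real charts"
  assumes vol: "volume_form \<omega>" and mass: "total_mass \<omega> = 1" and herm: "hermitian_metric m h"
begin

lemma vol_smooth: "smooth (fst \<omega>)" "smooth (snd \<omega>)" and vol_pos: "fst \<omega> z > 0" "snd \<omega> z > 0"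
  and vol_match: "z \<noteq> 0 \<Longrightarrow> fst \<omega> z = snd \<omega> (1 / z) / cmod z ^ 4"
  using vol unfolding volume_form_def by auto

lemma herm_smooth: "smooth (fst h)" "smooth (snd h)" and herm_pos: "fst h z > 0" "snd h z > 0"
  and herm_match: "z \<noteq> 0 \<Longrightarrow> snd h (1 / z) = cmod z ^ (2 * m) * fst h z"
  using herm unfolding hermitian_metric_def by auto

text \<open>A function that is not integrable has integral 0 by convention, so total mass 1 already
  contains integrability.\<close>

lemma vol_integrable: "integrable lborel (fst \<omega>)"
  using mass not_integrable_integral_eq unfolding total_mass_def by fastforce

text \<open>By the matching condition \<phi> and \<psi> are one function on the projective line,
  which is bounded by compactness.\<close>

lemma bounded_times_vol_integrable:
  fixes \<phi> \<psi> :: "complex \<Rightarrow> complex"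
  assumes "continuous_on UNIV \<phi>" "continuous_on UNIV \<psi>" "\<And>z. z \<noteq> 0 \<Longrightarrow> \<phi> z = \<psi> (1 / z)"
  shows "integrable lborel (\<lambda>z. \<phi> z * complex_of_real (fst \<omega> z))"
proof -
  have "cmod (\<phi> z) * cmod z ^ 0 \<le> cmod (\<psi> (1 / z))" if "cmod z \<ge> 1" for z
  proof -
    have "z \<noteq> 0" using that by auto
    then show ?thesis by (simp add: assms(3))
  qed
  from two_chart_bound[OF assms(1,2) this]
  obtain C where C: "C \<ge> 0" "\<And>z. cmod z \<le> 1 \<Longrightarrow> cmod (\<phi> z) \<le> C"
    "\<And>z. cmod z \<ge> 1 \<Longrightarrow> cmod (\<phi> z) \<le> C / cmod z ^ 0" by blast
  have b: "cmod (\<phi> z) \<le> C" for z using C(2,3)[of z] by (cases "cmod z \<le> 1") auto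
  show ?thesis
  proof (rule Bochner_Integration.integrable_bound)
    show "integrable lborel (\<lambda>z. C * fst \<omega> z)" using vol_integrable by simp
    show "(\<lambda>z. \<phi> z * complex_of_real (fst \<omega> z)) \<in> borel_measurable lborel"
      using borel_measurable_continuous_onI[of "\<lambda>z. \<phi> z * complex_of_real (fst \<omega> z)"]
        assms(1) smooth_continuous[OF vol_smooth(1)] by (simp add: continuous_intros)
    show "AE z in lborel. norm (\<phi> z * complex_of_real (fst \<omega> z)) \<le> norm (C * fst \<omega> z)"
      using b C(1) vol_pos(1) by (auto intro!: AE_I2 mult_right_mono simp: norm_mult abs_mult)
  qed
qed

lemma section_pairing_integrable:
  assumes t: "smooth_section m t" and v: "smooth_section m v"
  shows "integrable lborel (\<lambda>z. complex_of_real (fst h z) * fst t z * cnj (fst v z) * complex_of_real (fst \<omega> z))"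
proof (rule bounded_times_vol_integrable[where \<psi> = "\<lambda>z. complex_of_real (snd h z) * snd t z * cnj (snd v z)"])
  fix z :: complex assume z: "z \<noteq> 0"
  have "fst t z = z ^ m * snd t (1 / z)" "fst v z = z ^ m * snd v (1 / z)"
    using t v z unfolding smooth_section_def by auto
  moreover have "complex_of_real (cmod z ^ (2 * m)) = z ^ m * cnj z ^ m" by (rule cmod_even_power)
  ultimately show "complex_of_real (fst h z) * fst t z * cnj (fst v z)
     = complex_of_real (snd h (1 / z)) * snd t (1 / z) * cnj (snd v (1 / z))"
    unfolding herm_match[OF z] of_real_mult by (simp add: ac_simps)
qed (use t v in \<open>auto simp: smooth_section_def intro!: smooth_continuous smooth_mult smooth_of_real smooth_cnj herm_smooth\<close>)

lemma flux_smooth: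
  assumes "smooth_section m s" shows "smooth (fst (flux h s))" "smooth (snd (flux h s))"
  using assms unfolding flux_def smooth_section_def
  by (auto intro!: smooth_mult smooth_of_real herm_smooth smooth_d_zbar)

text \<open>The weights are z^m from the section, |z|^(-2m) from the metric and the conjugate of -
  1/z^2 from the form. The holomorphic powers cancel.\<close>

lemma flux_match:
  assumes s: "smooth_section m s" and z: "z \<noteq> 0"
  shows "fst (flux h s) z = - (snd (flux h s) (1 / z) / cnj z ^ (m + 2))"
proof -
  have "d_zbar (fst s) z = - (z ^ m * d_zbar (snd s) (1 / z) / (cnj z)\<^sup>2)"
    by (rule d_zbar_section) (use s z in \<open>auto simp: smooth_section_def\<close>)
  moreover have "complex_of_real (snd h (1 / z)) = z ^ m * cnj z ^ m * complex_of_real (fst h z)"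
    unfolding herm_match[OF z] of_real_mult cmod_even_power ..
  ultimately show ?thesis
    unfolding flux_def using z by (simp add: power_add power2_eq_square)
qed

lemma explicit_laplacian_section:
  assumes s: "smooth_section m s" shows "smooth_section m (explicit_laplacian \<omega> h s)"
  unfolding smooth_section_def
proof (intro conjI allI impI)
  have p: "pi * fst h z * fst \<omega> z \<noteq> 0" "pi * snd h z * snd \<omega> z \<noteq> 0" for z
    using herm_pos[of z] vol_pos[of z] by simp_all
  show "smooth (fst (explicit_laplacian \<omega> h s))" "smooth (snd (explicit_laplacian \<omega> h s))"
    unfolding explicit_laplacian_def fst_conv snd_conv
    by (intro smooth_mult smooth_of_real smooth_minus smooth_inverse p smooth_const herm_smooth vol_smooth smooth_d_z flux_smooth[OF s])+
  fix z :: complex assume z: "z \<noteq> 0"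
  have 1: "d_z (fst (flux h s)) z = d_z (snd (flux h s)) (1 / z) / (z\<^sup>2 * cnj z ^ (m + 2))"
    by (rule d_z_antiholomorphic_factor[OF flux_smooth(2)[OF s] z flux_match[OF s]])
  have 2: "pi * fst h z * fst \<omega> z = pi * snd h (1 / z) * snd \<omega> (1 / z) / cmod z ^ (2 * m + 4)"
    using z by (simp add: herm_match[OF z] vol_match[OF z] power_add)
  have 3: "complex_of_real (cmod z ^ (2 * m + 4)) = z ^ (m + 2) * cnj z ^ (m + 2)"
  proof -
    have e: "2 * m + 4 = 2 * (m + 2)" by simp
    show ?thesis unfolding e by (rule cmod_even_power)
  qed
  show "fst (explicit_laplacian \<omega> h s) z = z ^ m * snd (explicit_laplacian \<omega> h s) (1 / z)"
  proof -
    have "fst (explicit_laplacian \<omega> h s) z =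
      - (complex_of_real (cmod z ^ (2 * m + 4)) * complex_of_real (inverse (pi * snd h (1 / z) * snd \<omega> (1 / z)))) *
        (d_z (snd (flux h s)) (1 / z) / (z\<^sup>2 * cnj z ^ (m + 2)))"
      unfolding explicit_laplacian_def fst_conv 1 2 by (simp add: divide_inverse)
    also have "\<dots> = z ^ m * snd (explicit_laplacian \<omega> h s) (1 / z)"
      unfolding explicit_laplacian_def snd_conv 3 using z by (simp add: power_add power2_eq_square field_simps)
    finally show ?thesis .
  qed
qed

text \<open>Stokes for \<eta>, the flux of s times the conjugate of v. The weights of O(m) cancel in
  this product, so \<eta> transforms as the coefficient of a scalar form and decays like |z|^-2. The
  two terms of d_z \<eta> are the integrands of the two sides, up to factors \<pi>.\<close>

lemma green_identity:
  assumes s: "smooth_section m s" and v: "smooth_section m v"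
  shows "inner_00 \<omega> h (explicit_laplacian \<omega> h s) v = inner_01 h (dbar s) (dbar v)"
proof -
  let ?t = "explicit_laplacian \<omega> h s"
  define \<eta> where "\<eta> = (\<lambda>z. fst (flux h s) z * cnj (fst v z))"
  define \<eta>' where "\<eta>' = (\<lambda>z. snd (flux h s) z * cnj (snd v z))"
  have vs: "smooth (fst v)" "smooth (snd v)" using v by (auto simp: smooth_section_def)
  have ss: "smooth (fst s)" "smooth (snd s)" using s by (auto simp: smooth_section_def)
  have s\<eta>: "smooth \<eta>" "smooth \<eta>'" unfolding \<eta>_def \<eta>'_def by (intro smooth_mult smooth_cnj flux_smooth[OF s] vs)+
  have vm: "fst v z = z ^ m * snd v (1 / z)" if "z \<noteq> 0" for z using v that by (auto simp: smooth_section_def)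
  have match: "\<eta> z = - (\<eta>' (1 / z) / (cnj z)\<^sup>2)" if z: "z \<noteq> 0" for z
    unfolding \<eta>_def \<eta>'_def flux_match[OF s z] vm[OF z] using z by (simp add: power_add power2_eq_square field_simps)
  have tc: "cmod (\<eta> z) * cmod z ^ 2 \<le> cmod (\<eta>' (1 / z))" if "cmod z \<ge> 1" for z
  proof -
    have "z \<noteq> 0" using that by auto
    then show ?thesis by (simp add: match norm_divide norm_power)
  qed
  obtain C where C: "\<And>z. cmod z \<ge> 1 \<Longrightarrow> cmod (\<eta> z) \<le> C / cmod z ^ 2"
    using two_chart_bound[OF smooth_continuous[OF s\<eta>(1)] smooth_continuous[OF s\<eta>(2)] tc] by blast
  have dz\<eta>: "d_z \<eta> z = - complex_of_real pi * (complex_of_real (fst h z) * fst ?t z * cnj (fst v z) * complex_of_real (fst \<omega> z))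
      + complex_of_real (fst h z) * fst (dbar s) z * cnj (fst (dbar v) z)" for z
  proof -
    have "d_z \<eta> z = d_z (fst (flux h s)) z * cnj (fst v z) + fst (flux h s) z * cnj (d_zbar (fst v) z)"
      unfolding \<eta>_def by (simp add: d_z_mult flux_smooth[OF s] smooth_cnj vs d_z_cnj)
    moreover have "d_z (fst (flux h s)) z = - complex_of_real pi * (complex_of_real (fst h z) * fst ?t z * complex_of_real (fst \<omega> z))"
      using herm_pos(1)[of z] vol_pos(1)[of z] by (simp add: explicit_laplacian_def field_simps)
    ultimately show ?thesis by (simp add: flux_def dbar_def algebra_simps)
  qed
  have i1: "integrable lborel (\<lambda>z. complex_of_real (fst h z) * fst ?t z * cnj (fst v z) * complex_of_real (fst \<omega> z))"
    by (rule section_pairing_integrable[OF explicit_laplacian_section[OF s] v])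
  have i2: "integrable lborel (\<lambda>z. complex_of_real (fst h z) * fst (dbar s) z * cnj (fst (dbar v) z))"
  proof -
    \<comment> \<open>The pairing of two (0,1)-forms is a density, and its quotient by that of
      \<omega> is a function on the projective line. Hence the inserted factor, which cancels in the
      end.\<close>
    have "integrable lborel (\<lambda>z. fst (flux h s) z * cnj (d_zbar (fst v) z) * complex_of_real (inverse (fst \<omega> z)) * complex_of_real (fst \<omega> z))"
    proof (rule bounded_times_vol_integrable[where \<psi> = "\<lambda>z. snd (flux h s) z * cnj (d_zbar (snd v) z) * complex_of_real (inverse (snd \<omega> z))"])
      have "fst \<omega> z \<noteq> 0" "snd \<omega> z \<noteq> 0" for z using vol_pos[of z] by simp_all
      then show "continuous_on UNIV (\<lambda>z. fst (flux h s) z * cnj (d_zbar (fst v) z) * complex_of_real (inverse (fst \<omega> z)))"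
        "continuous_on UNIV (\<lambda>z. snd (flux h s) z * cnj (d_zbar (snd v) z) * complex_of_real (inverse (snd \<omega> z)))"
        by (intro smooth_continuous smooth_mult smooth_cnj smooth_of_real smooth_inverse flux_smooth[OF s] smooth_d_zbar vs vol_smooth; simp)+
      fix z :: complex assume z: "z \<noteq> 0"
      have dv: "d_zbar (fst v) z = - (z ^ m * d_zbar (snd v) (1 / z) / (cnj z)\<^sup>2)"
        by (rule d_zbar_section[OF vs(2) z vm])
      have c4: "complex_of_real (cmod z ^ 4) = z\<^sup>2 * (cnj z)\<^sup>2"
        using cmod_even_power[of z 2] by (simp del: of_real_power)
      have "complex_of_real (inverse (fst \<omega> z)) = complex_of_real (cmod z ^ 4) * complex_of_real (inverse (snd \<omega> (1 / z)))"
        unfolding vol_match[OF z] using z by (simp add: divide_inverse)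
      then show "fst (flux h s) z * cnj (d_zbar (fst v) z) * complex_of_real (inverse (fst \<omega> z))
         = snd (flux h s) (1 / z) * cnj (d_zbar (snd v) (1 / z)) * complex_of_real (inverse (snd \<omega> (1 / z)))"
        unfolding flux_match[OF s z] dv c4 using z by (simp add: power_add field_simps power2_eq_square)
    qed
    moreover have "fst (flux h s) z * cnj (d_zbar (fst v) z) * complex_of_real (inverse (fst \<omega> z)) * complex_of_real (fst \<omega> z)
       = complex_of_real (fst h z) * fst (dbar s) z * cnj (fst (dbar v) z)" for z
      using vol_pos(1)[of z] by (simp add: flux_def dbar_def)
    ultimately show ?thesis by simp
  qed
  have "integrable lborel (d_z \<eta>)" unfolding dz\<eta>[abs_def]
    by (rule Bochner_Integration.integrable_add[OF integrable_mult_right[OF i1] i2])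
  then have "(LINT z|lborel. d_z \<eta> z) = 0" using integral_d_z_eq_0[of \<eta> C] s\<eta>(1) C by blast
  then have "- complex_of_real pi * inner_00 \<omega> h ?t v + complex_of_real pi * inner_01 h (dbar s) (dbar v) = 0"
    unfolding dz\<eta> inner_00_def inner_01_def
    by (subst (asm) Bochner_Integration.integral_add[OF integrable_mult_right[OF i1] i2]) simp
  then show ?thesis by simp
qed

text \<open>Testing with the difference of t and t' shows that its squared norm is 0, so it vanishes
  almost everywhere and by continuity everywhere; the point at infinity is reached as a limit. This
  makes \<open>THE\<close> in \<open>dbar_adjoint\<close> meaningful.\<close>

lemma section_unique:
  assumes t: "smooth_section m t" and t': "smooth_section m t'"
    and eq: "\<And>v. smooth_section m v \<Longrightarrow> inner_00 \<omega> h t v = inner_00 \<omega> h t' v"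
  shows "t = t'"
proof -
  define d where "d = (\<lambda>z. fst t z + - fst t' z, \<lambda>z. snd t z + - snd t' z)"
  have d: "smooth_section m d" using t t' unfolding smooth_section_def d_def fst_conv snd_conv
    by (intro conjI allI impI smooth_add smooth_minus) (auto simp: algebra_simps)
  have "inner_00 \<omega> h d d = inner_00 \<omega> h t d - inner_00 \<omega> h t' d"
    unfolding inner_00_def
    by (subst Bochner_Integration.integral_diff[symmetric, OF section_pairing_integrable[OF t d] section_pairing_integrable[OF t' d]])
       (simp add: d_def algebra_simps)
  then have "inner_00 \<omega> h d d = 0" using eq[OF d] by simp
  moreover have form: "complex_of_real (fst h z) * fst d z * cnj (fst d z) * complex_of_real (fst \<omega> z)
      = complex_of_real (fst h z * (cmod (fst d z))\<^sup>2 * fst \<omega> z)" for z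
    by (simp add: complex_norm_square[symmetric] ac_simps del: of_real_power)
  ultimately have "(LINT z|lborel. complex_of_real (fst h z * (cmod (fst d z))\<^sup>2 * fst \<omega> z)) = 0"
    unfolding inner_00_def by simp
  then have "(LINT z|lborel. fst h z * (cmod (fst d z))\<^sup>2 * fst \<omega> z) = 0"
    unfolding integral_complex_of_real by simp
  moreover have "integrable lborel (\<lambda>z. fst h z * (cmod (fst d z))\<^sup>2 * fst \<omega> z)"
    using section_pairing_integrable[OF d d] unfolding form complex_of_real_integrable_eq .
  ultimately have "AE z in lborel. fst h z * (cmod (fst d z))\<^sup>2 * fst \<omega> z = 0"
    by (subst (asm) integral_nonneg_eq_0_iff_AE) (use herm_pos(1) vol_pos(1) in \<open>auto simp: less_imp_le\<close>)
  moreover have "continuous_on UNIV (\<lambda>z. fst h z * (cmod (fst d z))\<^sup>2 * fst \<omega> z)"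
    using d unfolding smooth_section_def
    by (intro continuous_intros smooth_continuous[OF herm_smooth(1)] smooth_continuous[OF vol_smooth(1)] smooth_continuous[of "fst d"]) auto
  ultimately have z0: "fst h z * (cmod (fst d z))\<^sup>2 * fst \<omega> z = 0" for z
    using continuous_AE_zero by blast
  have f0: "fst d z = 0" for z using z0[of z] herm_pos(1)[of z] vol_pos(1)[of z] by auto
  have s0: "snd d w = 0" if "w \<noteq> 0" for w
    using d f0[of "1 / w"] that unfolding smooth_section_def by (auto simp: divide_eq_0_iff)
  have "continuous_on UNIV (snd d)" using d by (auto simp: smooth_section_def smooth_continuous)
  then have "(snd d \<longlongrightarrow> snd d 0) (at 0)" by (auto simp: continuous_on_def)
  moreover have "(snd d \<longlongrightarrow> 0) (at 0)"
    by (rule tendsto_eventually) (auto simp: eventually_at_filter s0)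
  ultimately have "snd d 0 = 0" using tendsto_unique[OF at_neq_bot] by blast
  then have "snd d w = 0" for w using s0 by (cases "w = 0") auto
  then show ?thesis using f0 by (auto simp: d_def prod_eq_iff)
qed

lemma laplacian_explicit:
  assumes s: "smooth_section m s" shows "laplacian m \<omega> h s = explicit_laplacian \<omega> h s"
  unfolding laplacian_def dbar_adjoint_def
proof (rule the_equality)
  show "smooth_section m (explicit_laplacian \<omega> h s) \<and>
    (\<forall>v. smooth_section m v \<longrightarrow> inner_00 \<omega> h (explicit_laplacian \<omega> h s) v = inner_01 h (dbar s) (dbar v))"
    using explicit_laplacian_section[OF s] green_identity[OF s] by blast
  then show "t = explicit_laplacian \<omega> h s"
    if "smooth_section m t \<and> (\<forall>v. smooth_section m v \<longrightarrow> inner_00 \<omega> h t v = inner_01 h (dbar s) (dbar v))" for t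
    using that by (intro section_unique) auto
qed

end

section \<open>Symplectic coordinates\<close>

definition prim :: "(real \<Rightarrow> real) \<Rightarrow> real \<Rightarrow> real" where
  "prim k s = s * integral {0..1} (\<lambda>t. k (t * s))"

lemma prim_deriv: "continuous_on UNIV k \<Longrightarrow> (prim k has_real_derivative k s) (at s)"
  unfolding prim_def[abs_def] by (rule primitive_has_derivative)

lemma prim_0: "prim k 0 = 0" by (simp add: prim_def)

lemma prim_continuous: "continuous_on UNIV k \<Longrightarrow> continuous_on A (prim k)"
  by (rule DERIV_continuous_on[OF has_field_derivative_at_within[OF prim_deriv]])

lemma prim_strict_mono:
  assumes k: "continuous_on UNIV k" "\<And>s. k s > 0" and "x < y"
  shows "prim k x < prim k y"
  using DERIV_pos_imp_increasing[OF \<open>x < y\<close>, of "prim k"] prim_deriv[OF k(1)] k(2) by blast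

lemma zero_derivative_constant:
  fixes f :: "real \<Rightarrow> 'a::real_normed_vector"
  assumes "\<And>s. s > 0 \<Longrightarrow> (f has_vector_derivative 0) (at s)" "s > 0" "t > 0"
  shows "f s = f t"
proof -
  have "\<exists>c. \<forall>x\<in>{0<..}. f x = c"
  proof (rule has_derivative_zero_constant)
    fix x :: real assume "x \<in> {0<..}"
    then show "(f has_derivative (\<lambda>h. 0)) (at x within {0<..})"
      using assms(1)[of x] by (simp add: has_vector_derivative_def has_derivative_at_withinI)
  qed simp
  then show ?thesis using assms by auto
qed

text \<open>The device for all conserved quantities below: they are identified by their limit at a
  pole.\<close>

lemma zero_derivative_limit:
  fixes f :: "real \<Rightarrow> 'a::real_normed_vector"
  assumes d: "\<And>s. s > 0 \<Longrightarrow> (f has_vector_derivative 0) (at s)" and l: "(f \<longlongrightarrow> c) (at_right 0)" and s: "s > 0"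
  shows "f s = c"
proof -
  have "\<forall>\<^sub>F t in at_right 0. f s = f t"
    using eventually_at_right_less[of "0::real"] by (rule eventually_mono) (rule zero_derivative_constant[OF d s])
  then have "(f \<longlongrightarrow> f s) (at_right 0)" by (rule Lim_transform_eventually[OF tendsto_const])
  then show ?thesis using l tendsto_unique[OF trivial_limit_at_right_real] by blast
qed

lemma radial_integral_profile:
  fixes f :: "complex \<Rightarrow> real"
  assumes "radial f"
  shows "integral {0..1} (\<lambda>t. 1 * f (sqrt t *\<^sub>R z)) = integral {0..1} (\<lambda>t. profile f (t * (cmod z)\<^sup>2))"
proof (rule integral_cong)
  fix t :: real assume "t \<in> {0..1}"
  then show "1 * f (sqrt t *\<^sub>R z) = profile f (t * (cmod z)\<^sup>2)"
    using radial_profile[OF assms, of "sqrt t *\<^sub>R z"] by (simp add: power_mult_distrib)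
qed

text \<open>In s the equation reads (s L')' = - f, so - L' is the average of f over the interval
  from 0 to s, and L is, up to sign, s times the average of that average. Written as radial
  integrals, averages are smooth in z also at the origin, where division by s would be
  problematic.\<close>

lemma radial_potential:
  fixes f :: "complex \<Rightarrow> real"
  assumes f: "smooth f" "radial f"
  obtains \<phi> L where "smooth \<phi>" "\<And>z. \<phi> z = L ((cmod z)\<^sup>2)"
    "\<And>s. s > 0 \<Longrightarrow> (L has_real_derivative - (prim (profile f) s / s)) (at s)"
    "\<And>z. d_z (d_zbar (\<lambda>p. complex_of_real (\<phi> p))) z = - complex_of_real (f z)"
proof -
  have cf: "continuous_on UNIV (profile f)" by (rule profile_continuous[OF smooth_continuous[OF f(1)]])
  define mean where "mean = (\<lambda>f (z::complex). integral {0..1} (\<lambda>t. 1 * (f (sqrt t *\<^sub>R z) :: real)))"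
  have mean_eq: "mean g z = integral {0..1} (\<lambda>t. 1 * g (sqrt t *\<^sub>R z))" for g z unfolding mean_def ..
  have mean_smooth: "smooth (mean g)" if "smooth g" for g
    unfolding mean_def by (rule smooth_radial_integral[OF _ _ that]) (auto intro!: continuous_intros)
  define \<mu> where "\<mu> = (\<lambda>s. integral {0..1} (\<lambda>t. profile f (t * s)))"
  have m: "mean f z = \<mu> ((cmod z)\<^sup>2)" for z
    unfolding mean_def \<mu>_def by (rule radial_integral_profile[OF f(2)])
  have mr: "radial (mean f)" unfolding radial_def m by simp
  have mp: "profile (mean f) s = \<mu> s" if "s \<ge> 0" for s using m that by (simp add: profile_def)
  have sm: "smooth (mean f)" by (rule mean_smooth[OF f(1)])
  have c\<mu>: "continuous_on UNIV (profile (mean f))" by (rule profile_continuous[OF smooth_continuous[OF sm]])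
  define L where "L = (\<lambda>s. - prim (profile (mean f)) s)"
  define \<phi> where "\<phi> = (\<lambda>z. - ((cmod z)\<^sup>2 * mean (mean f) z))"
  have sphi: "smooth \<phi>" unfolding \<phi>_def by (intro smooth_minus smooth_mult smooth_norm_sq mean_smooth f(1))
  have phiL: "\<phi> z = L ((cmod z)\<^sup>2)" for z
    unfolding \<phi>_def L_def prim_def mean_eq[of "mean f"] radial_integral_profile[OF mr] ..
  have dL: "(L has_real_derivative - profile (mean f) s) (at s)" for s
    unfolding L_def by (rule DERIV_minus[OF prim_deriv[OF c\<mu>]])
  have prim_mean: "prim (profile f) s = s * profile (mean f) s" if "s \<ge> 0" for s
    unfolding prim_def mp[OF that] \<mu>_def ..
  have zbar: "d_zbar (\<lambda>p. complex_of_real (\<phi> p)) z = z * complex_of_real (- mean f z)" for z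
  proof -
    have "((\<lambda>s. complex_of_real (L s)) has_vector_derivative complex_of_real (- mean f z)) (at ((cmod z)\<^sup>2))"
      using has_vector_derivative_of_real[OF dL[of "(cmod z)\<^sup>2"]]
      by (simp add: mp m)
    from d_zbar_radial[OF this] show ?thesis unfolding phiL .
  qed
  have "d_z (d_zbar (\<lambda>p. complex_of_real (\<phi> p))) z = - complex_of_real (f z)" for z
  proof -
    have eq: "d_zbar (\<lambda>p. complex_of_real (\<phi> p)) = (\<lambda>p. p * complex_of_real (- mean f p))" by (rule ext) (rule zbar)
    show ?thesis
    proof (cases "z = 0")
      case True
      have id1: "d_z (\<lambda>p. p) z = 1" by (rule wirtinger_unique(1)[of _ 1 0]) simp
      have "d_z (\<lambda>p. p * complex_of_real (- mean f p)) z
         = d_z (\<lambda>p. p) z * complex_of_real (- mean f z) + z * d_z (\<lambda>p. complex_of_real (- mean f p)) z"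
        by (rule d_z_mult[OF smooth_ident smooth_of_real[OF smooth_minus[OF sm]]])
      also have "\<dots> = - complex_of_real (mean f 0)" using True id1 by simp
      also have "mean f 0 = f 0" by (simp add: mean_def)
      finally show ?thesis unfolding eq using True by simp
    next
      case False
      define s where "s = (cmod z)\<^sup>2"
      have s: "s > 0" using False by (simp add: s_def)
      have "((\<lambda>s. prim (profile f) s / s) has_real_derivative (profile f s * s - prim (profile f) s * 1) / (s * s)) (at s)"
        by (rule DERIV_divide[OF prim_deriv[OF cf] DERIV_ident]) (use s in simp)
      then have "((\<lambda>s. - complex_of_real (prim (profile f) s / s)) has_vector_derivative
         - complex_of_real ((profile f s * s - prim (profile f) s * 1) / (s * s))) (at ((cmod z)\<^sup>2))"
        unfolding s_def[symmetric]
        by (intro has_vector_derivative_minus has_vector_derivative_of_real)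
      from d_z_times_radial[OF this]
      have 1: "d_z (\<lambda>p. p * - complex_of_real (prim (profile f) ((cmod p)\<^sup>2) / (cmod p)\<^sup>2)) z = - complex_of_real (profile f s)"
        using s by (simp add: s_def[symmetric] field_simps)
      have "d_z (\<lambda>p. p * complex_of_real (- mean f p)) z = d_z (\<lambda>p. p * - complex_of_real (prim (profile f) ((cmod p)\<^sup>2) / (cmod p)\<^sup>2)) z"
      proof (rule d_z_cong(1))
        have "\<forall>\<^sub>F p in nhds z. p \<noteq> 0" using False by (rule t1_space_nhds)
        then show "\<forall>\<^sub>F p in nhds z. p * complex_of_real (- mean f p) = p * - complex_of_real (prim (profile f) ((cmod p)\<^sup>2) / (cmod p)\<^sup>2)"
        proof (rule eventually_mono)
          fix p :: complex assume "p \<noteq> 0"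
          then show "p * complex_of_real (- mean f p) = p * - complex_of_real (prim (profile f) ((cmod p)\<^sup>2) / (cmod p)\<^sup>2)"
            by (simp add: prim_mean mp m)
        qed
      qed
      then show ?thesis unfolding eq 1 using radial_profile[OF f(2), of z] by (simp add: s_def)
    qed
  qed
  moreover have "(L has_real_derivative - (prim (profile f) s / s)) (at s)" if "s > 0" for s
    using dL[of s] prim_mean[of s] that by simp
  ultimately show ?thesis using that[of \<phi> L] sphi phiL by blast
qed

section \<open>The mass of discs as symplectic coordinate\<close>

locale invariant_volume =
  fixes \<omega> :: "real charts"
  assumes vol: "volume_form \<omega>" and inv: "S1_invariant \<omega>" and mass: "total_mass \<omega> = 1"
begin

lemma vol_smooth: "smooth (fst \<omega>)" "smooth (snd \<omega>)" and vol_pos: "fst \<omega> z > 0" "snd \<omega> z > 0"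
  and vol_match: "z \<noteq> 0 \<Longrightarrow> fst \<omega> z = snd \<omega> (1 / z) / cmod z ^ 4"
  using vol unfolding volume_form_def by auto

lemma vol_radial: "radial (fst \<omega>)" "radial (snd \<omega>)"
proof -
  show r: "radial (fst \<omega>)" using inv by (simp add: S1_invariant_radial)
  have e: "snd \<omega> w = fst \<omega> (complex_of_real (1 / cmod w)) / cmod w ^ 4" if "w \<noteq> 0" for w
  proof -
    have "fst \<omega> (1 / w) = snd \<omega> w * cmod w ^ 4" using vol_match[of "1 / w"] that by (simp add: norm_divide field_simps)
    moreover have "fst \<omega> (1 / w) = fst \<omega> (complex_of_real (1 / cmod w))"
      using r[unfolded radial_def, rule_format, of "1 / w"] by (simp add: norm_divide)
    ultimately show ?thesis using that by simp
  qed
  show "radial (snd \<omega>)" unfolding radial_def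
  proof
    fix w show "snd \<omega> w = snd \<omega> (complex_of_real (cmod w))"
      using e[of w] e[of "complex_of_real (cmod w)"] by (cases "w = 0") auto
  qed
qed

text \<open>The factor \<pi> converts the area density into a density in s, so that the primitive
  \<open>M0 s\<close> is the mass of the disc |z|^2 < s, that is, the symplectic coordinate x. The
  index 1 marks the same objects around infinity.\<close>

definition k0 :: "real \<Rightarrow> real" where "k0 s = profile (\<lambda>z. pi * fst \<omega> z) s"
definition k1 :: "real \<Rightarrow> real" where "k1 s = profile (\<lambda>z. pi * snd \<omega> z) s"

lemma k_cont: "continuous_on UNIV k0" "continuous_on UNIV k1"
  unfolding k0_def[abs_def] k1_def[abs_def]
  by (rule profile_continuous, rule smooth_continuous, intro smooth_mult smooth_const vol_smooth)+

lemma k_pos: "k0 s > 0" "k1 s > 0" using vol_pos by (simp_all add: k0_def k1_def profile_def)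

lemma k_match: "s > 0 \<Longrightarrow> k0 s = k1 (1 / s) / s\<^sup>2"
proof -
  assume s: "s > 0"
  have "sqrt s ^ 4 = s\<^sup>2" using s by (metis less_imp_le mult_2 numeral_Bit0 power_add power_mult real_sqrt_pow2 one_add_one power2_eq_square)
  then show ?thesis using vol_match[of "complex_of_real (sqrt s)"] s
    by (simp add: k0_def k1_def profile_def real_sqrt_divide)
qed

definition M0 :: "real \<Rightarrow> real" where "M0 = prim k0"
definition M1 :: "real \<Rightarrow> real" where "M1 = prim k1"

lemma M0_deriv: "(M0 has_real_derivative k0 s) (at s)" and M1_deriv: "(M1 has_real_derivative k1 s) (at s)"
  unfolding M0_def M1_def by (rule prim_deriv[OF k_cont(1)], rule prim_deriv[OF k_cont(2)])

lemma M0_limit: "(M0 \<longlongrightarrow> 1) at_top"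
proof -
  have r: "profile (fst \<omega>) ((cmod z)\<^sup>2) = fst \<omega> z" for z using radial_profile[OF vol_radial(1)] by simp
  have i: "integrable lborel (fst \<omega>)" using mass not_integrable_integral_eq unfolding total_mass_def by fastforce
  have "(M0 \<longlongrightarrow> (LINT z|lborel. profile (fst \<omega>) ((cmod z)\<^sup>2))) at_top"
  proof (rule radial_mass_limit)
    show "continuous_on UNIV (profile (fst \<omega>))" by (rule profile_continuous[OF smooth_continuous[OF vol_smooth(1)]])
    show "profile (fst \<omega>) s \<ge> 0" for s using vol_pos(1) by (simp add: profile_def less_imp_le)
    show "(M0 has_real_derivative pi * profile (fst \<omega>) s) (at s)" for s
      using M0_deriv[of s] by (simp add: k0_def profile_def)
    show "M0 0 = 0" by (simp add: M0_def prim_0)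
  qed (unfold r, rule i)
  then show ?thesis unfolding r using mass by (simp add: total_mass_def)
qed

text \<open>The discs |z|^2 < s and |w|^2 < 1/s are complementary. Their masses have constant sum by
  \<open>k_match\<close>, and the constant is the total mass.\<close>

lemma M_sum: "s > 0 \<Longrightarrow> M0 s + M1 (1 / s) = 1"
proof -
  assume s: "s > 0"
  define f where "f = (\<lambda>s. M0 (1 / s) + M1 s)"
  have "(f has_vector_derivative 0) (at s)" if s: "s > 0" for s
  proof -
    have d: "((\<lambda>s. 1 / s) has_real_derivative - (1 / s\<^sup>2)) (at s)"
      using s by (auto intro!: derivative_eq_intros simp: power2_eq_square)
    have "(f has_real_derivative k0 (1 / s) * - (1 / s\<^sup>2) + k1 s) (at s)"
      unfolding f_def by (rule DERIV_add[OF DERIV_chain2[where f = M0 and g = "\<lambda>s. 1 / s", OF M0_deriv d] M1_deriv])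
    moreover have "k0 (1 / s) * - (1 / s\<^sup>2) + k1 s = 0" using k_match[of "1 / s"] s by (simp add: field_simps)
    ultimately show ?thesis by (simp add: has_real_derivative_iff_has_vector_derivative)
  qed
  moreover have "(f \<longlongrightarrow> 1 + 0) (at_right 0)" unfolding f_def
  proof (rule tendsto_add)
    show "((\<lambda>s. M0 (1 / s)) \<longlongrightarrow> 1) (at_right 0)"
      using filterlim_compose[OF M0_limit filterlim_inverse_at_top_right] by (simp add: inverse_eq_divide)
    have "isCont M1 0" using M1_deriv by (rule DERIV_isCont)
    then have "(M1 \<longlongrightarrow> M1 0) (at 0)" by (simp add: isCont_def)
    then show "(M1 \<longlongrightarrow> 0) (at_right 0)" by (simp add: M1_def prim_0 filterlim_at_split)
  qed
  ultimately have "f (1 / s) = 1" using zero_derivative_limit[of f "1 + 0" "1 / s"] s by simp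
  then show ?thesis by (simp add: f_def)
qed

lemma M_mono: "x < y \<Longrightarrow> M0 x < M0 y" "x < y \<Longrightarrow> M1 x < M1 y"
  unfolding M0_def M1_def using prim_strict_mono k_cont k_pos by blast+

lemma M_at_0: "M0 0 = 0" "M1 0 = 0" by (simp_all add: M0_def M1_def prim_0)

lemma M0_range: "s > 0 \<Longrightarrow> 0 < M0 s \<and> M0 s < 1"
  using M_mono(1)[of 0 s] M_mono(2)[of 0 "1 / s"] M_sum[of s] M_at_0 by (simp add: field_simps)

lemma M0_surj: assumes "0 < x" "x < 1" shows "\<exists>s>0. M0 s = x"
proof -
  have "\<forall>\<^sub>F s in at_top. M0 s > x" using M0_limit assms(2) by (rule order_tendstoD)
  then obtain b where b: "b > 0" "M0 b > x"
    using eventually_happens'[OF trivial_limit_at_top_linorder eventually_conj[OF eventually_gt_at_top[of 0]]] by blast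
  have "\<exists>s\<ge>0. s \<le> b \<and> M0 s = x"
    by (rule IVT') (use b assms M_at_0 in \<open>auto simp: M0_def intro: prim_continuous k_cont\<close>)
  then obtain s where "s \<ge> 0" "M0 s = x" by blast
  then show ?thesis using assms M_at_0 by (intro exI[of _ s]) (auto simp: less_le)
qed

text \<open>The exponentials of potentials in the two charts define a metric on O(1) if they satisfy
  the transition rule, that is, if ln s + L0(s) - L1(1/s) is constant. Its derivative is (1 - M0(s)
  - M1(1/s)) / s: here total mass 1 meets the degree of O(1). The remaining constant c is absorbed
  in the second chart.\<close>

lemma polarization_exists:
  "\<exists>k. hermitian_metric 1 k \<and> S1_invariant k \<and>
     chern_form k = (\<lambda>z. complex_of_real (fst \<omega> z), \<lambda>w. complex_of_real (snd \<omega> w))"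
proof -
  have r: "smooth (\<lambda>z. pi * fst \<omega> z)" "radial (\<lambda>z. pi * fst \<omega> z)" "smooth (\<lambda>z. pi * snd \<omega> z)" "radial (\<lambda>z. pi * snd \<omega> z)"
    using vol_radial by (auto intro!: smooth_mult smooth_const vol_smooth simp: radial_def)
  obtain \<phi>0 L0 where 0: "smooth \<phi>0" "\<And>z. \<phi>0 z = L0 ((cmod z)\<^sup>2)"
    "\<And>s. s > 0 \<Longrightarrow> (L0 has_real_derivative - (M0 s / s)) (at s)"
    "\<And>z. d_z (d_zbar (\<lambda>p. complex_of_real (\<phi>0 p))) z = - complex_of_real (pi * fst \<omega> z)"
    using radial_potential[OF r(1,2)] unfolding M0_def k0_def[abs_def] by metis
  obtain \<phi>1 L1 where 1: "smooth \<phi>1" "\<And>z. \<phi>1 z = L1 ((cmod z)\<^sup>2)"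
    "\<And>s. s > 0 \<Longrightarrow> (L1 has_real_derivative - (M1 s / s)) (at s)"
    "\<And>z. d_z (d_zbar (\<lambda>p. complex_of_real (\<phi>1 p))) z = - complex_of_real (pi * snd \<omega> z)"
    using radial_potential[OF r(3,4)] unfolding M1_def k1_def[abs_def] by metis
  define g where "g = (\<lambda>s. ln s + L0 s - L1 (1 / s))"
  define c where "c = g 1"
  have "(g has_vector_derivative 0) (at s)" if s: "s > 0" for s
  proof -
    have d: "((\<lambda>s. 1 / s) has_real_derivative - (1 / s\<^sup>2)) (at s)"
      using s by (auto intro!: derivative_eq_intros simp: power2_eq_square)
    have "1 / s > 0" using s by simp
    have "(g has_real_derivative (1 / s + - (M0 s / s)) - (- (M1 (1 / s) / (1 / s))) * - (1 / s\<^sup>2)) (at s)"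
      unfolding g_def
      by (intro DERIV_diff DERIV_add 0(3) DERIV_chain2[where f = L1 and g = "\<lambda>s. 1 / s", OF 1(3)[OF \<open>1 / s > 0\<close>] d])
         (use s in \<open>auto intro!: derivative_eq_intros\<close>)
    moreover have "(1 / s + - (M0 s / s)) - (- (M1 (1 / s) / (1 / s))) * - (1 / s\<^sup>2) = (1 - (M0 s + M1 (1 / s))) / s"
      using s by (simp add: field_simps power2_eq_square)
    ultimately show ?thesis using M_sum[OF s] by (simp add: has_real_derivative_iff_has_vector_derivative)
  qed
  then have gc: "g s = c" if "s > 0" for s
    unfolding c_def using zero_derivative_constant[of g s 1] that by simp
  define k where "k = (\<lambda>z. exp (\<phi>0 z), \<lambda>w. exp (\<phi>1 w + c))"
  have "snd k (1 / z) = cmod z ^ (2 * 1) * fst k z" if z: "z \<noteq> 0" for z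
  proof -
    have s: "(cmod z)\<^sup>2 > 0" using z by simp
    have "L1 (1 / (cmod z)\<^sup>2) + c = ln ((cmod z)\<^sup>2) + L0 ((cmod z)\<^sup>2)" using gc[OF s] by (simp add: g_def)
    then have "exp (L1 (1 / (cmod z)\<^sup>2) + c) = (cmod z)\<^sup>2 * exp (L0 ((cmod z)\<^sup>2))"
      by (simp only: exp_add exp_ln[OF s])
    then show ?thesis by (simp add: k_def 0(2) 1(2) norm_divide power_divide)
  qed
  then have "hermitian_metric 1 k"
    using 0(1) 1(1) by (auto simp: hermitian_metric_def k_def intro!: smooth_exp smooth_add smooth_const)
  moreover have "S1_invariant k" unfolding S1_invariant_def by (simp add: k_def 0(2) norm_mult)
  moreover have "chern_form k = (\<lambda>z. complex_of_real (fst \<omega> z), \<lambda>w. complex_of_real (snd \<omega> w))"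
  proof -
    have zc: "d_zbar (\<lambda>p. complex_of_real (\<phi>1 p + c)) = d_zbar (\<lambda>p. complex_of_real (\<phi>1 p))"
    proof
      fix p
      note d = smooth_has_derivative[OF smooth_of_real[OF 1(1)], of p]
      have "((\<lambda>p. complex_of_real (\<phi>1 p + c)) has_derivative frechet_derivative (\<lambda>p. complex_of_real (\<phi>1 p)) (at p)) (at p)"
        using has_derivative_add[OF d has_derivative_const[of "complex_of_real c"]] by simp
      from d_zbar_eq[OF this] d_zbar_eq[OF d] show "d_zbar (\<lambda>p. complex_of_real (\<phi>1 p + c)) p = d_zbar (\<lambda>p. complex_of_real (\<phi>1 p)) p"
        by (simp only:)
    qed
    show ?thesis unfolding chern_form_def k_def fst_conv snd_conv ln_exp zc 0(4) 1(4) by simp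
  qed
  ultimately show ?thesis by blast
qed

text \<open>Holds for whichever metric \<open>SOME\<close> selects: the Chern form fixes the
  derivative of s times that of the logarithm of the metric, and smoothness at the origin fixes the
  constant of integration. The argument exp (- 2 u) is |z|^2.\<close>

lemma F_sym_deriv: "(F_sym \<omega> has_real_derivative M0 (exp (- 2 * u))) (at u)"
proof -
  define k where "k = polarization \<omega>"
  have k: "hermitian_metric 1 k" "S1_invariant k"
    "chern_form k = (\<lambda>z. complex_of_real (fst \<omega> z), \<lambda>w. complex_of_real (snd \<omega> w))"
    unfolding k_def polarization_def using someI_ex[OF polarization_exists] by auto
  have kp: "smooth (fst k)" "\<And>z. fst k z > 0" using k(1) by (auto simp: hermitian_metric_def)
  define \<phi> where "\<phi> = (\<lambda>z. ln (fst k z))"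
  define f where "f = (\<lambda>z. complex_of_real (\<phi> z))"
  have f: "smooth f" "radial f"
    using k(2) kp by (auto simp: f_def \<phi>_def S1_invariant_radial radial_def intro!: smooth_of_real smooth_ln)
  have ch: "d_z (d_zbar f) z = - complex_of_real (pi * fst \<omega> z)" for z
  proof -
    have "- d_z (d_zbar f) z / complex_of_real pi = complex_of_real (fst \<omega> z)"
      using fun_cong[OF arg_cong[OF k(3), of fst], of z] unfolding chern_form_def f_def \<phi>_def by simp
    then have "- d_z (d_zbar f) z = complex_of_real (pi * fst \<omega> z)" by (simp add: field_simps)
    then show ?thesis by (metis minus_minus)
  qed
  have "smooth (\<lambda>_::complex. 1::real)" "radial (\<lambda>_::complex. 1::real)" by (auto simp: radial_def intro: smooth_const)
  from radial_second_order[OF f this] obtain e where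
    e1: "\<And>s. s > 0 \<Longrightarrow> (profile f has_vector_derivative e s) (at s)" and
    e2: "\<And>s. s > 0 \<Longrightarrow> ((\<lambda>s. s *\<^sub>R e s) has_vector_derivative - complex_of_real (k0 s)) (at s)" and
    e3: "((\<lambda>s. s *\<^sub>R e s) \<longlongrightarrow> 0) (at_right 0)"
    by (simp add: profile_def[of "\<lambda>_. 1"] ch k0_def profile_def[of "\<lambda>z. pi * fst \<omega> z"]) metis
  have M0v: "((\<lambda>s. complex_of_real (M0 s)) has_vector_derivative complex_of_real (k0 s)) (at s)" for s
    by (rule has_vector_derivative_of_real[OF M0_deriv])
  have se: "s *\<^sub>R e s + complex_of_real (M0 s) = 0" if s: "s > 0" for s
  proof (rule zero_derivative_limit[OF _ _ s])
    show "((\<lambda>s. s *\<^sub>R e s + complex_of_real (M0 s)) has_vector_derivative 0) (at s)" if "s > 0" for s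
      using has_vector_derivative_add[OF e2[OF that] M0v[of s]] by simp
    have "(M0 \<longlongrightarrow> M0 0) (at 0)" using DERIV_isCont[OF M0_deriv] by (simp add: isCont_def)
    then have "(M0 \<longlongrightarrow> 0) (at_right 0)" by (simp add: M_at_0 filterlim_at_split)
    from tendsto_add[OF e3 tendsto_of_real[OF this]]
    show "((\<lambda>s. s *\<^sub>R e s + complex_of_real (M0 s)) \<longlongrightarrow> 0) (at_right 0)" by simp
  qed
  have dp: "(profile \<phi> has_real_derivative - (M0 s / s)) (at s)" if s: "s > 0" for s
  proof -
    have "e s = complex_of_real (- (M0 s / s))"
    proof -
      have "complex_of_real s * e s = complex_of_real (- M0 s)"
        using se[OF s] by (simp add: scaleR_conv_of_real add_eq_0_iff2)
      then show ?thesis using s by (simp add: field_simps)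
    qed
    then have "(profile f has_vector_derivative complex_of_real (- (M0 s / s))) (at s)" using e1[OF s] by simp
    from bounded_linear.has_vector_derivative[OF bounded_linear_Re this]
    show ?thesis by (simp add: f_def profile_def[abs_def] has_real_derivative_iff_has_vector_derivative)
  qed
  have F: "F_sym \<omega> = (\<lambda>u. 1/2 * profile \<phi> (exp (- 2 * u)))"
  proof
    fix u :: real
    have "sqrt (exp (- 2 * u)) = exp (- u)"
      by (rule real_sqrt_unique) (simp_all add: exp_double[symmetric])
    then show "F_sym \<omega> u = 1/2 * profile \<phi> (exp (- 2 * u))"
      by (simp add: F_sym_def k_def[symmetric] \<phi>_def profile_def ln_sqrt[OF less_imp_le[OF kp(2)]])
  qed
  have de: "((\<lambda>u. exp (- 2 * u)) has_real_derivative exp (- 2 * u) * (- 2)) (at u)"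
    by (rule derivative_eq_intros refl | simp)+
  have "((\<lambda>u. 1/2 * profile \<phi> (exp (- 2 * u))) has_real_derivative
     1/2 * (- (M0 (exp (- 2 * u)) / exp (- 2 * u)) * (exp (- 2 * u) * (- 2)))) (at u)"
    by (rule DERIV_cmult[OF DERIV_chain2[where f = "profile \<phi>" and g = "\<lambda>u. exp (- 2 * u)", OF dp[OF exp_gt_zero] de]])
  then show ?thesis unfolding F by simp
qed

lemma G_sym_M0: assumes "s > 0" shows "G_sym \<omega> (M0 s) = - ln s / 2"
proof -
  have F: "deriv (F_sym \<omega>) = (\<lambda>u. M0 (exp (- 2 * u)))" using DERIV_imp_deriv[OF F_sym_deriv] by auto
  have "inj (\<lambda>u. M0 (exp (- 2 * u)))"
  proof (rule injI)
    fix u v assume "M0 (exp (- 2 * u)) = M0 (exp (- 2 * v))"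
    then have "exp (- 2 * u) = exp (- 2 * v)" using M_mono(1) by (metis linorder_neqE less_irrefl)
    then show "u = v" by simp
  qed
  from inv_f_f[OF this, of "- ln s / 2"] show ?thesis using assms by (simp add: G_sym_def F)
qed

text \<open>As a function of u, x = M0 (exp (- 2 u)) has derivative - 2 s k0(s). The sign and the
  reciprocal in \<open>g_bar\<close> undo those of the derivative of the inverse function.\<close>

lemma g_bar_M0: assumes s: "s > 0" shows "g_bar \<omega> (M0 s) = 2 * s * k0 s"
proof -
  define u where "u = - ln s / 2"
  have es: "exp (- 2 * u) = s" using s by (simp add: u_def)
  have de: "((\<lambda>u. exp (- 2 * u)) has_real_derivative exp (- 2 * u) * (- 2)) (at u)"
    by (rule derivative_eq_intros refl | simp)+
  have d: "((\<lambda>u. M0 (exp (- 2 * u))) has_real_derivative k0 s * (s * (- 2))) (at u)"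
    using DERIV_chain2[where f = M0 and g = "\<lambda>u. exp (- 2 * u)", OF M0_deriv de] unfolding es .
  have ne: "k0 s * (s * - 2) \<noteq> 0" using s k_pos(1)[of s] by simp
  have "(G_sym \<omega> has_derivative (\<lambda>t. inverse (k0 s * (s * (- 2))) * t)) (at (M0 (exp (- 2 * u))))"
  proof (rule has_derivative_inverse_strong[of UNIV u "\<lambda>u. M0 (exp (- 2 * u))"])
    show "continuous_on UNIV (\<lambda>u. M0 (exp (- 2 * u)))" unfolding M0_def
      by (rule continuous_on_compose2[OF prim_continuous[OF k_cont(1)]]) (auto intro!: continuous_intros)
    show "G_sym \<omega> (M0 (exp (- 2 * z))) = z" for z using G_sym_M0[of "exp (- 2 * z)"] by simp
    show "((\<lambda>u. M0 (exp (- 2 * u))) has_derivative (*) (k0 s * (s * (- 2)))) (at u)"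
      using d by (simp only: has_field_derivative_def)
    show "(*) (k0 s * (s * - 2)) \<circ> (\<lambda>t. inverse (k0 s * (s * - 2)) * t) = id"
    proof -
      have "c * (inverse c * t) = t" if "c \<noteq> 0" for c t :: real using that by simp
      from this[OF ne] show ?thesis by (simp only: fun_eq_iff o_apply id_apply) blast
    qed
  qed auto
  then have "(G_sym \<omega> has_real_derivative inverse (k0 s * (s * (- 2)))) (at (M0 (exp (- 2 * u))))"
    by (simp only: has_field_derivative_def)
  from DERIV_imp_deriv[OF this] have D: "deriv (G_sym \<omega>) (M0 s) = inverse (k0 s * (s * (- 2)))" unfolding es .
  show ?thesis unfolding g_bar_def D using s k_pos(1)[of s] by (simp add: field_simps)
qed

lemma h_bar_M0: "s > 0 \<Longrightarrow> h_bar \<omega> h (M0 s) = profile (fst h) s"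
proof -
  assume s: "s > 0"
  have "sqrt s = exp (ln s / 2)" by (rule real_sqrt_unique) (use s in \<open>simp_all add: exp_double[symmetric]\<close>)
  then show ?thesis using G_sym_M0[OF s] by (simp add: h_bar_def profile_def)
qed

text \<open>M0 maps the positive reals onto the open unit interval, so the condition can be pulled
  back to s, where all its ingredients are explicit. The 2 of the bound cancels that of
  \<open>g_bar\<close>.\<close>

lemma pinched_iff:
  "pinched m \<omega> h \<longleftrightarrow> (\<forall>s>0. 1 < profile (fst h) s / (min 1 (2 * (1 - M0 s))) ^ m \<and>
     profile (fst h) s / (min 1 (2 * (1 - M0 s))) ^ m < min (M0 s) (1 - M0 s) / (s * k0 s))"
proof -
  have "pinched m \<omega> h \<longleftrightarrow> (\<forall>s>0. 1 < h_bar \<omega> h (M0 s) / (min 1 (2 * (1 - M0 s))) ^ m \<and>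
     h_bar \<omega> h (M0 s) / (min 1 (2 * (1 - M0 s))) ^ m < 2 * min (M0 s) (1 - M0 s) / g_bar \<omega> (M0 s))"
    unfolding pinched_def using M0_range M0_surj by (metis (no_types, lifting))
  also have "\<dots> \<longleftrightarrow> (\<forall>s>0. 1 < profile (fst h) s / (min 1 (2 * (1 - M0 s))) ^ m \<and>
     profile (fst h) s / (min 1 (2 * (1 - M0 s))) ^ m < min (M0 s) (1 - M0 s) / (s * k0 s))"
    by (simp add: h_bar_M0 g_bar_M0 mult.assoc cong: imp_cong)
  finally show ?thesis .
qed

end

section \<open>Invariant eigenvalues\<close>

text \<open>F = f(|z|^2) has differential 2 (z . v) K with K = Q(|z|^2), and
  \<open>Q_integral\<close> writes K as a radial integral of F times smooth functions. So K is as
  often differentiable as F, which gives F one derivative more.\<close>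

lemma (in radial_sol) smooth_solution:
  assumes h: "smooth h" "radial h" and H: "H = profile h" and \<kappa>: "smooth \<kappa>" "radial \<kappa>" and k: "k = profile \<kappa>"
  shows "smooth (\<lambda>z. f ((cmod z)\<^sup>2) l)"
proof -
  have hz: "h z = H ((cmod z)\<^sup>2)" "\<kappa> z = k ((cmod z)\<^sup>2)" for z
    unfolding H k by (rule radial_profile[OF h(2)], rule radial_profile[OF \<kappa>(2)])
  have hne: "h z \<noteq> 0" for z using H_pos[of "(cmod z)\<^sup>2"] hz(1)[of z] by simp
  define F where "F = (\<lambda>z. f ((cmod z)\<^sup>2) l)"
  define K where "K = (\<lambda>z. - l * (inverse (h z) * integral {0..1} (\<lambda>t. t ^ m * (h (sqrt t *\<^sub>R z) * \<kappa> (sqrt t *\<^sub>R z) * F (sqrt t *\<^sub>R z)))))"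
  have KQ: "K z = Q ((cmod z)\<^sup>2) l" for z
  proof -
    have "integral {0..1} (\<lambda>t. t ^ m * (h (sqrt t *\<^sub>R z) * \<kappa> (sqrt t *\<^sub>R z) * F (sqrt t *\<^sub>R z)))
       = integral {0..1} (\<lambda>t. t ^ m * (H (t * (cmod z)\<^sup>2) * k (t * (cmod z)\<^sup>2) * f (t * (cmod z)\<^sup>2) l))"
      by (rule integral_cong) (simp add: hz F_def power_mult_distrib)
    then have "h z * K z = H ((cmod z)\<^sup>2) * Q ((cmod z)\<^sup>2) l"
      unfolding K_def Q_integral using hne[of z] by simp
    then show ?thesis using hne[of z] by (simp add: hz)
  qed
  have dF: "(F has_derivative (\<lambda>v. 2 * (z \<bullet> v) * K z)) (at z)" for z
    unfolding F_def KQ using radial_has_derivative[OF f_deriv[unfolded has_real_derivative_iff_has_vector_derivative]]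
    by (simp add: mult.commute)
  have "C_k n F" for n
  proof (induction n)
    case 0
    show ?case using dF by (auto intro!: continuous_at_imp_continuous_on has_derivative_continuous)
  next
    case (Suc n)
    have "C_k n (\<lambda>z. h z * \<kappa> z * F z)" by (intro C_k_mult Suc smooth_C_k h \<kappa>)
    then have I: "C_k n (\<lambda>z. integral {0..1} (\<lambda>t. t ^ m * (h (sqrt t *\<^sub>R z) * \<kappa> (sqrt t *\<^sub>R z) * F (sqrt t *\<^sub>R z))))"
      by (rule C_k_radial_integral[rotated 2]) (auto intro!: continuous_intros)
    have "C_k n K" unfolding K_def by (intro C_k_mult C_k_const C_k_inverse hne smooth_C_k[OF h(1)] I)
    from C_k_radial_bootstrap[OF dF this] show ?case .
  qed
  then show ?thesis unfolding smooth_def F_def by blast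
qed

section \<open>Invariant eigensections and the discriminant\<close>

lemma of_real_deriv:
  "(f has_real_derivative D) F \<Longrightarrow> ((\<lambda>x. complex_of_real (f x)) has_vector_derivative complex_of_real D) F"
  by (rule has_vector_derivative_of_real)

locale invariant_pair = P: hermitian_pair m \<omega> h + V: invariant_volume \<omega> for m \<omega> h +
  assumes herm_inv: "S1_invariant h"
begin

lemma herm_radial: "radial (fst h)" "radial (snd h)"
proof -
  show r: "radial (fst h)" using herm_inv by (simp add: S1_invariant_radial)
  have e: "snd h w = fst h (complex_of_real (1 / cmod w)) / cmod w ^ (2 * m)" if "w \<noteq> 0" for w
  proof -
    have "fst h (1 / w) = fst h (complex_of_real (1 / cmod w))"
      using r[unfolded radial_def, rule_format, of "1 / w"] by (simp add: norm_divide)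
    then show ?thesis using P.herm_match[of "1 / w"] that by (simp add: norm_divide field_simps)
  qed
  show "radial (snd h)" unfolding radial_def
  proof
    fix w show "snd h w = snd h (complex_of_real (cmod w))"
      using e[of w] e[of "complex_of_real (cmod w)"] by (cases "w = 0") auto
  qed
qed

definition H0 :: "real \<Rightarrow> real" where "H0 = profile (fst h)"
definition H1 :: "real \<Rightarrow> real" where "H1 = profile (snd h)"

lemma H_cont: "continuous_on UNIV H0" "continuous_on UNIV H1"
  unfolding H0_def H1_def by (rule profile_continuous, rule smooth_continuous, rule P.herm_smooth)+

lemma H_pos: "H0 s > 0" "H1 s > 0" using P.herm_pos by (simp_all add: H0_def H1_def profile_def)

lemma H_match: "s > 0 \<Longrightarrow> H1 (1 / s) = s ^ m * H0 s"
  using P.herm_match[of "complex_of_real (sqrt s)"] by (simp add: H0_def H1_def profile_def real_sqrt_divide power_mult)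

lemma solutions_exist:
  obtains f0 Q0 f1 Q1 where "\<And>b. b > 0 \<Longrightarrow> matching m H0 V.k0 f0 Q0 H1 V.k1 f1 Q1 b (1 / b)"
proof -
  obtain f0 Q0 where 0: "radial_sol 0 H0 V.k0 f0 Q0" using radial_sol_exists[OF H_cont(1) V.k_cont(1) H_pos(1) V.k_pos(1)] by blast
  obtain f1 Q1 where 1: "radial_sol m H1 V.k1 f1 Q1" using radial_sol_exists[OF H_cont(2) V.k_cont(2) H_pos(2) V.k_pos(2)] by blast
  show ?thesis
    by (rule that[of f0 Q0 f1 Q1]) (intro matching.intro matching_axioms.intro 0 1, auto)
qed

text \<open>Solutions of the eigenvalue equation on \<open>C - {0}\<close>: \<open>A\<close> is the function and \<open>B\<close> its flux.\<close>

definition sol :: "real \<Rightarrow> (real \<Rightarrow> complex) \<Rightarrow> (real \<Rightarrow> complex) \<Rightarrow> bool" where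
  "sol l A B \<longleftrightarrow> (\<forall>s>0. (A has_vector_derivative (1 / (s * H0 s)) *\<^sub>R B s) (at s) \<and>
     (B has_vector_derivative (- (l * H0 s * V.k0 s)) *\<^sub>R A s) (at s))"

lemma wronskian:
  assumes "sol l A B" "sol l C D" "s > 0"
  shows "((\<lambda>s. A s * D s - B s * C s) has_vector_derivative 0) (at s)"
proof -
  define p where "p = 1 / (s * H0 s)"
  define v where "v = - (l * H0 s * V.k0 s)"
  have "((\<lambda>s. A s * D s - B s * C s) has_vector_derivative
     (A s * (v *\<^sub>R C s) + (p *\<^sub>R B s) * D s) - (B s * (p *\<^sub>R D s) + (v *\<^sub>R A s) * C s)) (at s)"
    by (intro has_vector_derivative_diff has_vector_derivative_mult)
       (use assms in \<open>auto simp: sol_def p_def v_def\<close>)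
  then show ?thesis by (simp add: algebra_simps)
qed

lemma left_sol:
  assumes "radial_sol 0 H0 V.k0 f0 Q0"
  shows "sol l (\<lambda>s. complex_of_real (f0 s l)) (\<lambda>s. complex_of_real (radial_sol.q 0 H0 Q0 s l))"
proof -
  interpret L: radial_sol 0 H0 V.k0 f0 Q0 by fact
  show ?thesis unfolding sol_def
  proof (intro allI impI conjI)
    fix s :: real assume s: "s > 0"
    show "((\<lambda>s. complex_of_real (f0 s l)) has_vector_derivative (1 / (s * H0 s)) *\<^sub>R complex_of_real (L.q s l)) (at s)"
      using of_real_deriv[OF L.f_deriv[of l s]] L.Q_eq[of s l] s
      by (simp add: L.P_def scaleR_conv_of_real)
    show "((\<lambda>s. complex_of_real (L.q s l)) has_vector_derivative (- (l * H0 s * V.k0 s)) *\<^sub>R complex_of_real (f0 s l)) (at s)"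
      using of_real_deriv[OF L.q_deriv[of l s]] by (simp add: L.V_def scaleR_conv_of_real mult.assoc)
  qed
qed

lemma inverse_deriv: "s > 0 \<Longrightarrow> ((\<lambda>s. 1 / s) has_real_derivative - (1 / s\<^sup>2)) (at (s::real))"
  by (auto intro!: derivative_eq_intros simp: power2_eq_square)

text \<open>The substitution t = 1/s carries the problem at infinity to the equation in s. The
  powers of s are absorbed by \<open>H_match\<close> and \<open>k_match\<close>, and the reversal of
  orientation changes the sign of the flux. Both solutions are thus coefficients with respect to the
  same section 1.\<close>

lemma right_derivs:
  assumes "radial_sol m H1 V.k1 f1 Q1" and s: "s > 0"
  shows "((\<lambda>s. f1 (1 / s) l) has_real_derivative (1 / (s * H0 s)) * - radial_sol.q m H1 Q1 (1 / s) l) (at s)"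
    and "((\<lambda>s. - radial_sol.q m H1 Q1 (1 / s) l) has_real_derivative - (l * H0 s * V.k0 s * f1 (1 / s) l)) (at s)"
proof -
  interpret R: radial_sol m H1 V.k1 f1 Q1 by fact
  have "1 / s > 0" using s by simp
  then have "Q1 (1 / s) l = R.P (1 / s) * R.q (1 / s) l" using R.Q_eq[of "1 / s" l] by simp
  also have "R.P (1 / s) = s / H0 s" using s H_match[OF s] by (simp add: R.P_def power_divide)
  finally have Q: "Q1 (1 / s) l * - (1 / s\<^sup>2) = (1 / (s * H0 s)) * - R.q (1 / s) l"
    using s H_pos(1)[of s] by (simp add: field_simps power2_eq_square)
  show "((\<lambda>s. f1 (1 / s) l) has_real_derivative (1 / (s * H0 s)) * - R.q (1 / s) l) (at s)"
    using DERIV_chain2[where f = "\<lambda>x. f1 x l" and g = "\<lambda>s. 1 / s", OF R.f_deriv[of l "1 / s"] inverse_deriv[OF s]] unfolding Q .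
  have "R.V (1 / s) / s\<^sup>2 = H0 s * V.k0 s"
    using s H_match[OF s] V.k_match[OF s] by (simp add: R.V_def power_divide)
  then have Q2: "- (- (l * R.V (1 / s) * f1 (1 / s) l) * - (1 / s\<^sup>2)) = - (l * H0 s * V.k0 s * f1 (1 / s) l)"
    by (simp add: field_simps)
  show "((\<lambda>s. - R.q (1 / s) l) has_real_derivative - (l * H0 s * V.k0 s * f1 (1 / s) l)) (at s)"
    using DERIV_minus[OF DERIV_chain2[where f = "\<lambda>x. R.q x l" and g = "\<lambda>s. 1 / s", OF R.q_deriv[of l "1 / s"] inverse_deriv[OF s]]]
    unfolding Q2 .
qed

lemma right_sol:
  assumes "radial_sol m H1 V.k1 f1 Q1"
  shows "sol l (\<lambda>s. complex_of_real (f1 (1 / s) l)) (\<lambda>s. complex_of_real (- radial_sol.q m H1 Q1 (1 / s) l))"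
  unfolding sol_def
proof (intro allI impI conjI)
  fix s :: real assume s: "s > 0"
  note d = right_derivs[OF assms s, of l]
  show "((\<lambda>s. complex_of_real (f1 (1 / s) l)) has_vector_derivative (1 / (s * H0 s)) *\<^sub>R complex_of_real (- radial_sol.q m H1 Q1 (1 / s) l)) (at s)"
    using of_real_deriv[OF d(1)] by (simp add: scaleR_conv_of_real)
  show "((\<lambda>s. complex_of_real (- radial_sol.q m H1 Q1 (1 / s) l)) has_vector_derivative (- (l * H0 s * V.k0 s)) *\<^sub>R complex_of_real (f1 (1 / s) l)) (at s)"
    using of_real_deriv[OF d(2)] by (simp add: scaleR_conv_of_real)
qed

lemma section_eqI:
  assumes "smooth_section m s" "smooth_section m t" and eq: "\<And>z. z \<noteq> 0 \<Longrightarrow> fst s z = fst t z"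
  shows "s = t"
proof -
  have at0: "f 0 = g 0" if "continuous_on UNIV f" "continuous_on UNIV g" "\<And>z. z \<noteq> 0 \<Longrightarrow> f z = g z" for f g :: "complex \<Rightarrow> complex"
  proof -
    have "(f \<longlongrightarrow> f 0) (at 0)" "(g \<longlongrightarrow> g 0) (at 0)" using that by (auto simp: continuous_on_def)
    moreover have "\<forall>\<^sub>F z in at 0. f z = g z" unfolding eventually_at_filter using that(3) by simp
    ultimately have "(g \<longlongrightarrow> f 0) (at 0)" "(g \<longlongrightarrow> g 0) (at 0)" using tendsto_cong by fast+
    then show ?thesis using tendsto_unique[OF at_neq_bot] by blast
  qed
  have eq2: "snd s w = snd t w" if w: "w \<noteq> 0" for w
  proof -
    have w': "1 / w \<noteq> 0" using w by simp
    have "fst s (1 / w) = (1 / w) ^ m * snd s (1 / (1 / w))" "fst t (1 / w) = (1 / w) ^ m * snd t (1 / (1 / w))"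
      using assms(1,2) w' unfolding smooth_section_def by blast+
    then have "(1 / w) ^ m * snd s (1 / (1 / w)) = (1 / w) ^ m * snd t (1 / (1 / w))" using eq[OF w'] by (simp only:)
    then show ?thesis using w by simp
  qed
  have c: "continuous_on UNIV (fst s)" "continuous_on UNIV (fst t)" "continuous_on UNIV (snd s)" "continuous_on UNIV (snd t)"
    using assms by (auto simp: smooth_section_def smooth_continuous)
  have "fst s z = fst t z" "snd s z = snd t z" for z
    using at0[OF c(1,2) eq] at0[OF c(3,4) eq2] eq eq2 by (cases "z = 0"; simp)+
  then show ?thesis by (auto simp: prod_eq_iff)
qed

lemma eigenfunction_flux:
  assumes s: "smooth_section m s" and eig: "laplacian m \<omega> h s = (\<lambda>z. complex_of_real l * fst s z, \<lambda>w. complex_of_real l * snd s w)"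
  shows "d_z (fst (flux h s)) z = - complex_of_real (l * fst h z * (pi * fst \<omega> z)) * fst s z"
proof -
  have "complex_of_real (- inverse (pi * fst h z * fst \<omega> z)) * d_z (fst (flux h s)) z = complex_of_real l * fst s z"
    using fun_cong[OF arg_cong[OF eig, of fst], of z] unfolding P.laplacian_explicit[OF s] explicit_laplacian_def by simp
  then have "complex_of_real (- (pi * fst h z * fst \<omega> z)) * (complex_of_real (- inverse (pi * fst h z * fst \<omega> z)) * d_z (fst (flux h s)) z)
     = complex_of_real (- (pi * fst h z * fst \<omega> z)) * (complex_of_real l * fst s z)" by simp
  moreover have "complex_of_real (- (pi * fst h z * fst \<omega> z)) * complex_of_real (- inverse (pi * fst h z * fst \<omega> z)) = 1"
  proof -
    have r: "(- x) * (- inverse x) = 1" if "x \<noteq> 0" for x :: real using that by simp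
    have ne: "pi * fst h z * fst \<omega> z \<noteq> 0" using P.herm_pos(1)[of z] P.vol_pos(1)[of z] by simp
    show ?thesis unfolding of_real_mult[symmetric] r[OF ne] by simp
  qed
  ultimately show ?thesis by (simp only: mult.assoc[symmetric] mult_1) (simp add: ac_simps)
qed

text \<open>
  The Wronskians of an eigenfunction with both regular solutions vanish at the poles, even if the
  coefficient of the section with respect to \<open>x0\<^sup>m\<close> is not known to be bounded at infinity.
\<close>

lemma spectrum_imp_disc:
  assumes mt: "matching m H0 V.k0 f0 Q0 H1 V.k1 f1 Q1 b (1 / b)" and l: "l \<in> invariant_spectrum m \<omega> h"
  shows "matching.disc m H0 f0 Q0 H1 f1 Q1 b (1 / b) l = 0"
proof (rule ccontr)
  interpret X: matching m H0 V.k0 f0 Q0 H1 V.k1 f1 Q1 b "1 / b" by fact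
  assume D: "X.disc l \<noteq> 0"
  obtain s where s: "smooth_section m s" "S1_invariant s" "s \<noteq> (\<lambda>z. 0, \<lambda>w. 0)"
    "laplacian m \<omega> h s = (\<lambda>z. complex_of_real l * fst s z, \<lambda>w. complex_of_real l * snd s w)"
    using l unfolding invariant_spectrum_def by blast
  define f where "f = fst s"
  define S where "S = snd s"
  have f: "smooth f" "radial f" and S: "smooth S" using s by (auto simp: f_def S_def smooth_section_def S1_invariant_radial)
  obtain e where
    e1: "\<And>s. s > 0 \<Longrightarrow> (profile f has_vector_derivative e s) (at s)" and
    e2: "\<And>s. s > 0 \<Longrightarrow> ((\<lambda>s. (s * H0 s) *\<^sub>R e s) has_vector_derivative
        d_z (\<lambda>p. complex_of_real (fst h p) * d_zbar f p) (complex_of_real (sqrt s))) (at s)" and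
    e3: "((\<lambda>s. (s * H0 s) *\<^sub>R e s) \<longlongrightarrow> 0) (at_right 0)"
    using radial_second_order[OF f P.herm_smooth(1) herm_radial(1)] unfolding H0_def by blast
  define \<phi> where "\<phi> = profile f"
  define \<psi> where "\<psi> = (\<lambda>s. (s * H0 s) *\<^sub>R e s)"
  have solf: "sol l \<phi> \<psi>" unfolding sol_def
  proof (intro allI impI conjI)
    fix s :: real assume s': "s > 0"
    show "(\<phi> has_vector_derivative (1 / (s * H0 s)) *\<^sub>R \<psi> s) (at s)"
      using e1[OF s'] s' H_pos(1)[of s] by (simp add: \<phi>_def \<psi>_def)
    have "d_z (\<lambda>p. complex_of_real (fst h p) * d_zbar f p) (complex_of_real (sqrt s)) = (- (l * H0 s * V.k0 s)) *\<^sub>R \<phi> s"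
      using eigenfunction_flux[OF s(1,4), of "complex_of_real (sqrt s)"]
      by (simp add: flux_def f_def[symmetric] H0_def V.k0_def \<phi>_def profile_def scaleR_conv_of_real)
    then show "(\<psi> has_vector_derivative (- (l * H0 s * V.k0 s)) *\<^sub>R \<phi> s) (at s)"
      using e2[OF s'] by (simp add: \<psi>_def)
  qed
  note sol0 = left_sol[OF X.L.radial_sol_axioms, of l] and sol1 = right_sol[OF X.R.radial_sol_axioms, of l]
  have c\<phi>: "continuous_on UNIV \<phi>" unfolding \<phi>_def by (rule profile_continuous[OF smooth_continuous[OF f(1)]])
  have lim0: "(g \<longlongrightarrow> g 0) (at_right 0)" if "continuous_on UNIV g" for g :: "real \<Rightarrow> complex"
    using that by (auto simp: continuous_on_def filterlim_at_split)
  \<comment> \<open>At s = 0 both fluxes tend to 0 while the functions stay bounded, so the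
    conserved Wronskian is 0.\<close>
  have W0: "complex_of_real (f0 s l) * \<psi> s - complex_of_real (X.L.q s l) * \<phi> s = 0" if s': "s > 0" for s
  proof (rule zero_derivative_limit[OF wronskian[OF sol0 solf] _ s'])
    have "((\<lambda>s. complex_of_real (f0 s l) * \<psi> s - complex_of_real (X.L.q s l) * \<phi> s) \<longlongrightarrow>
       complex_of_real (f0 0 l) * 0 - complex_of_real (X.L.q 0 l) * \<phi> 0) (at_right 0)"
      by (intro tendsto_diff tendsto_mult lim0 c\<phi> e3[folded \<psi>_def] continuous_intros)
    then show "((\<lambda>s. complex_of_real (f0 s l) * \<psi> s - complex_of_real (X.L.q s l) * \<phi> s) \<longlongrightarrow> 0) (at_right 0)"
      by (simp add: X.L.q_at_0)
  qed
  define D where "D = (\<lambda>p. frechet_derivative S (at p) 1)"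
  have sD: "smooth D" unfolding D_def by (rule smooth_frechet[OF S])
  have phiS: "\<phi> (1 / t) = (1 / sqrt t) ^ m *\<^sub>R profile S t" if t: "t > 0" for t
    using s(1) t unfolding smooth_section_def
    by (auto simp: \<phi>_def profile_def f_def S_def real_sqrt_divide scaleR_conv_of_real)
  \<comment> \<open>The flux near infinity is expressed through the smooth coefficient S of the
    w-chart: the derivative of \<phi>(1/t) = t^(-m/2) S(sqrt t) is computed in two ways.\<close>
  have psiS: "\<psi> (1 / t) = - (H1 t *\<^sub>R ((sqrt t ^ (m + 1) / 2) *\<^sub>R profile D t - (real m * sqrt t ^ m / 2) *\<^sub>R profile S t))" if t: "t > 0" for t
  proof -
    have t': "1 / t > 0" "sqrt t > 0" using t by auto
    have dS: "(profile S has_vector_derivative (1 / (2 * sqrt t)) *\<^sub>R profile D t) (at t)"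
      using profile_deriv[OF smooth_has_derivative[OF S] t] by (simp add: D_def profile_def)
    have dr: "((\<lambda>t. (1 / sqrt t) ^ m) has_real_derivative - (real m / (2 * t)) * (1 / sqrt t) ^ m) (at t)"
    proof -
      have 1: "((\<lambda>t. inverse (sqrt t)) has_real_derivative - (inverse (sqrt t) * (inverse (sqrt t) / 2) * inverse (sqrt t))) (at t)"
        by (rule DERIV_inverse'[OF DERIV_real_sqrt[OF t]]) (use t in simp)
      have "((\<lambda>t. inverse (sqrt t) ^ m) has_real_derivative of_nat m * (- (inverse (sqrt t) * (inverse (sqrt t) / 2) * inverse (sqrt t)) * inverse (sqrt t) ^ (m - Suc 0))) (at t)"
        by (rule DERIV_power[OF 1])
      moreover have "of_nat m * (- (inverse (sqrt t) * (inverse (sqrt t) / 2) * inverse (sqrt t)) * inverse (sqrt t) ^ (m - Suc 0)) = - (real m / (2 * t)) * (1 / sqrt t) ^ m"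
      proof (cases m)
        case (Suc n)
        define i where "i = inverse (sqrt t)"
        have ii: "i * i = 1 / t" using t by (simp add: i_def inverse_eq_divide)
        have "real m * (- (i * (i / 2) * i) * i ^ n) = - (real m / 2) * (i * i) * (i * i ^ n)" by simp
        also have "\<dots> = - (real m / (2 * t)) * i ^ m" unfolding ii Suc by simp
        finally show ?thesis by (simp add: i_def Suc inverse_eq_divide)
      qed simp
      ultimately show ?thesis by (simp add: inverse_eq_divide)
    qed
    have "((\<lambda>t. \<phi> (1 / t)) has_vector_derivative
       (1 / sqrt t) ^ m *\<^sub>R ((1 / (2 * sqrt t)) *\<^sub>R profile D t) + (- (real m / (2 * t)) * (1 / sqrt t) ^ m) *\<^sub>R profile S t) (at t)"
    proof (rule has_vector_derivative_transform_within_open[of _ _ _ "{0<..}"])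
      show "((\<lambda>t. (1 / sqrt t) ^ m *\<^sub>R profile S t) has_vector_derivative
         (1 / sqrt t) ^ m *\<^sub>R ((1 / (2 * sqrt t)) *\<^sub>R profile D t) + (- (real m / (2 * t)) * (1 / sqrt t) ^ m) *\<^sub>R profile S t) (at t)"
        by (rule has_vector_derivative_scaleR[OF dr dS])
    qed (use t phiS in auto)
    moreover have "((\<lambda>t. \<phi> (1 / t)) has_vector_derivative (- (1 / t\<^sup>2)) *\<^sub>R e (1 / t)) (at t)"
      using vector_diff_chain_at[OF inverse_deriv[OF t, unfolded has_real_derivative_iff_has_vector_derivative] e1[OF t'(1)]]
      by (simp add: \<phi>_def o_def)
    ultimately have E: "(- (1 / t\<^sup>2)) *\<^sub>R e (1 / t) =
       (1 / sqrt t) ^ m *\<^sub>R ((1 / (2 * sqrt t)) *\<^sub>R profile D t) + (- (real m / (2 * t)) * (1 / sqrt t) ^ m) *\<^sub>R profile S t"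
      by (rule vector_derivative_unique_at[symmetric])
    have H: "H0 (1 / t) = t ^ m * H1 t"
      using H_match[OF t'(1)] t by (simp add: power_divide field_simps)
    have tt: "t = sqrt t * sqrt t" using t by simp
    have "\<psi> (1 / t) = - (t ^ (m + 1) * H1 t) *\<^sub>R ((- (1 / t\<^sup>2)) *\<^sub>R e (1 / t))"
      using t by (simp add: \<psi>_def H power2_eq_square)
    also have "\<dots> = - (H1 t *\<^sub>R ((t ^ (m + 1) * ((1 / sqrt t) ^ m * (1 / (2 * sqrt t)))) *\<^sub>R profile D t
         - (t ^ (m + 1) * (real m / (2 * t) * (1 / sqrt t) ^ m)) *\<^sub>R profile S t))"
      unfolding E by (simp add: algebra_simps)
    also have "t ^ (m + 1) * ((1 / sqrt t) ^ m * (1 / (2 * sqrt t))) = sqrt t ^ (m + 1) / 2"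
    proof -
      have "t ^ (m + 1) = sqrt t ^ (m + 1) * sqrt t ^ (m + 1)" by (subst tt) (simp only: power_mult_distrib)
      then show ?thesis using t' by (simp add: power_divide)
    qed
    also have "t ^ (m + 1) * (real m / (2 * t) * (1 / sqrt t) ^ m) = real m * sqrt t ^ m / 2"
    proof -
      have "t ^ m = sqrt t ^ m * sqrt t ^ m" by (subst tt) (simp only: power_mult_distrib)
      then show ?thesis using t t' by (simp add: power_divide)
    qed
    finally show ?thesis .
  qed
  have W1: "complex_of_real (f1 (1 / s) l) * \<psi> s - complex_of_real (- X.R.q (1 / s) l) * \<phi> s = 0" if s': "s > 0" for s
  proof -
    define g where "g = (\<lambda>t. complex_of_real (f1 t l) * \<psi> (1 / t) - complex_of_real (- X.R.q t l) * \<phi> (1 / t))"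
    \<comment> \<open>The Wronskian again, with the negative power t^(-m/2) in \<phi>(1/t) absorbed
      by the t^(m+1) in the flux \<open>X.R.q\<close>. This expression is continuous at t =
      0.\<close>
    define g' where "g' = (\<lambda>t. complex_of_real (f1 t l) * - (H1 t *\<^sub>R ((sqrt t ^ (m + 1) / 2) *\<^sub>R profile D t - (real m * sqrt t ^ m / 2) *\<^sub>R profile S t))
        - complex_of_real (- (sqrt t ^ (m + 2) * (H1 t * Q1 t l))) * profile S t)"
    have gg': "g t = g' t" if t: "t > 0" for t
    proof -
      have t2: "t ^ m = sqrt t ^ m * sqrt t ^ m" "t = sqrt t * sqrt t"
        using t by (simp_all flip: power_mult_distrib)
      have "X.R.q t l * (1 / sqrt t) ^ m = sqrt t ^ (m + 2) * (H1 t * Q1 t l)"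
      proof -
        have "t ^ (m + 1) * (1 / sqrt t) ^ m = sqrt t ^ (m + 2)"
        proof -
          have "t ^ (m + 1) * (1 / sqrt t) ^ m = (sqrt t * sqrt t) * (sqrt t ^ m * sqrt t ^ m) * (1 / sqrt t) ^ m"
            using t2 by (simp add: ac_simps)
          also have "\<dots> = sqrt t ^ (m + 2)" using t by (simp add: power_divide power_add power2_eq_square)
          finally show ?thesis .
        qed
        then show ?thesis unfolding X.R.q_def by (metis mult.assoc mult.commute)
      qed
      then have "complex_of_real (- X.R.q t l) * \<phi> (1 / t) = complex_of_real (- (sqrt t ^ (m + 2) * (H1 t * Q1 t l))) * profile S t"
        unfolding phiS[OF t] scaleR_conv_of_real by (metis mult.assoc mult_minus_left of_real_minus of_real_mult)
      then show ?thesis unfolding g_def g'_def psiS[OF t] by simp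
    qed
    have "continuous_on UNIV g'" unfolding g'_def
      by (intro continuous_intros profile_continuous smooth_continuous sD S X.R.H_cont_on X.R.Q_cont_on X.R.f_cont_on) auto
    then have "(g' \<longlongrightarrow> g' 0) (at_right 0)" by (rule lim0)
    \<comment> \<open>The term with \<open>real m\<close> vanishes by its coefficient when m = 0,
      and by its power of sqrt t when m > 0.\<close>
    moreover have "g' 0 = 0" by (cases m) (simp_all add: g'_def)
    ultimately have "(g' \<longlongrightarrow> 0) (at_right 0)" by simp
    moreover have "\<forall>\<^sub>F t in at_right 0. g' t = g t"
      using eventually_at_right_less[of "0::real"] by (rule eventually_mono) (simp add: gg')
    ultimately have gl: "(g \<longlongrightarrow> 0) (at_right 0)" by (rule Lim_transform_eventually)
    have "(g has_vector_derivative 0) (at t)" if t: "t > 0" for t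
    proof -
      have "((\<lambda>s. complex_of_real (f1 (1 / s) l) * \<psi> s - complex_of_real (- X.R.q (1 / s) l) * \<phi> s) has_vector_derivative 0) (at (1 / t))"
        by (rule wronskian[OF sol1 solf]) (use t in simp)
      from vector_diff_chain_at[OF inverse_deriv[OF t, unfolded has_real_derivative_iff_has_vector_derivative] this]
      show ?thesis by (simp add: g_def o_def)
    qed
    from zero_derivative_limit[OF this gl, of "1 / s"] show ?thesis using s' by (simp add: g_def)
  qed
  \<comment> \<open>\<phi> and \<psi> satisfy two homogeneous linear equations. Their determinant
    is, up to sign, the conserved Wronskian of the two regular solutions, hence plus or minus the
    discriminant.\<close>
  have zero: "\<phi> s = 0" if s': "s > 0" for s
  proof -
    have "complex_of_real (f0 s l) * complex_of_real (- X.R.q (1 / s) l) - complex_of_real (X.L.q s l) * complex_of_real (f1 (1 / s) l)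
        = complex_of_real (f0 b l) * complex_of_real (- X.R.q (1 / b) l) - complex_of_real (X.L.q b l) * complex_of_real (f1 (1 / b) l)"
      by (rule zero_derivative_constant[OF wronskian[OF sol0 sol1] s' X.b_pos(1)])
    also have "\<dots> = - complex_of_real (X.disc l)" by (simp add: X.disc_def)
    finally have "(complex_of_real (f0 s l) * complex_of_real (- X.R.q (1 / s) l) - complex_of_real (X.L.q s l) * complex_of_real (f1 (1 / s) l)) \<noteq> 0"
      using D by simp
    moreover have "(complex_of_real (f0 s l) * complex_of_real (- X.R.q (1 / s) l) - complex_of_real (X.L.q s l) * complex_of_real (f1 (1 / s) l)) * \<phi> s = 0"
      using W0[OF s'] W1[OF s'] by algebra
    ultimately show ?thesis by simp
  qed
  have "s = (\<lambda>z. 0, \<lambda>w. 0)"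
  proof (rule section_eqI[OF s(1)])
    show "smooth_section m (\<lambda>z. 0, \<lambda>w. 0)" by (auto simp: smooth_section_def intro: smooth_const)
    fix z :: complex assume "z \<noteq> 0"
    then show "fst s z = fst (\<lambda>z. 0, \<lambda>w. 0) z"
      using zero[of "(cmod z)\<^sup>2"] radial_profile[OF f(2), of z] by (simp add: \<phi>_def f_def)
  qed
  then show False using s(3) by simp
qed

text \<open>A vanishing discriminant makes the data of the two regular solutions at b parallel. By
  uniqueness the solutions are proportional on all of s > 0 and glue to a section that is smooth at
  both poles.\<close>

lemma disc_imp_spectrum:
  assumes mt: "matching m H0 V.k0 f0 Q0 H1 V.k1 f1 Q1 b (1 / b)"
    and D: "matching.disc m H0 f0 Q0 H1 f1 Q1 b (1 / b) l = 0"
  shows "l \<in> invariant_spectrum m \<omega> h"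
proof -
  interpret X: matching m H0 V.k0 f0 Q0 H1 V.k1 f1 Q1 b "1 / b" by fact
  have b: "b > 0" by (rule X.b_pos(1))
  have D': "f0 b l * X.R.q (1 / b) l + X.L.q b l * f1 (1 / b) l = 0" using D by (simp add: X.disc_def)
  \<comment> \<open>The constant is read off from a nonvanishing component of the right solution;
    its two components never vanish together.\<close>
  obtain c where c: "f0 b l = c * f1 (1 / b) l" "X.L.q b l = - c * X.R.q (1 / b) l"
  proof (cases "f1 (1 / b) l = 0")
    case True
    then have "X.R.q (1 / b) l \<noteq> 0" "f0 b l = 0" using X.R.nonzero[of "1 / b" l] D' by auto
    then show ?thesis using True that[of "- X.L.q b l / X.R.q (1 / b) l"] by simp
  next
    case False
    show ?thesis by (rule that[of "f0 b l / f1 (1 / b) l"]) (use False D' in \<open>auto simp: field_simps add_eq_0_iff\<close>)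
  qed
  have glue: "f0 s l = c * f1 (1 / s) l" if s: "s > 0" for s
  proof -
    define d where "d = (\<lambda>s. f0 s l - c * f1 (1 / s) l)"
    define p where "p = (\<lambda>s. X.L.q s l - c * - X.R.q (1 / s) l)"
    have "d s = 0"
    proof (rule linear_system_zero[of "min s b" "max s b" d "\<lambda>s. 1 / (s * H0 s)" p "\<lambda>s. l * H0 s * V.k0 s" b])
      fix x assume "min s b \<le> x" "x \<le> max s b"
      then have x: "x > 0" using s b by auto
      have Q0: "Q0 x l = 1 / (x * H0 x) * X.L.q x l" using X.L.Q_eq[of x l] x by (simp add: X.L.P_def)
      have "(d has_real_derivative Q0 x l - c * ((1 / (x * H0 x)) * - X.R.q (1 / x) l)) (at x)"
        unfolding d_def by (rule DERIV_diff[OF X.L.f_deriv DERIV_cmult[OF right_derivs(1)[OF X.R.radial_sol_axioms x]]])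
      then show "(d has_real_derivative 1 / (x * H0 x) * p x) (at x)" unfolding Q0 p_def by (simp add: algebra_simps)
      have "(p has_real_derivative - (l * X.L.V x * f0 x l) - c * - (l * H0 x * V.k0 x * f1 (1 / x) l)) (at x)"
        unfolding p_def by (rule DERIV_diff[OF X.L.q_deriv DERIV_cmult[OF right_derivs(2)[OF X.R.radial_sol_axioms x]]])
      then show "(p has_real_derivative - (l * H0 x * V.k0 x * d x)) (at x)" unfolding d_def by (simp add: X.L.V_def algebra_simps)
    next
      have "x \<noteq> 0" if "x \<in> {min s b..max s b}" for x using that s b by auto
      moreover have "H0 x \<noteq> 0" for x using H_pos(1)[of x] by simp
      ultimately show "continuous_on {min s b..max s b} (\<lambda>s. 1 / (s * H0 s))"
        by (intro continuous_intros X.L.H_cont_on) auto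
      show "continuous_on {min s b..max s b} (\<lambda>s. l * H0 s * V.k0 s)"
        by (intro continuous_intros X.L.H_cont_on X.L.k_cont_on)
    qed (use c in \<open>auto simp: d_def p_def\<close>)
    then show ?thesis by (simp add: d_def)
  qed
  \<comment> \<open>The factor w^m converts the coefficient of x0^m, which f1 solves for, into that
    of x1^m.\<close>
  define \<sigma> where "\<sigma> = (\<lambda>z. complex_of_real (f0 ((cmod z)\<^sup>2) l), \<lambda>w. w ^ m * complex_of_real (c * f1 ((cmod w)\<^sup>2) l))"
  have pik: "smooth (\<lambda>z. pi * fst \<omega> z)" "radial (\<lambda>z. pi * fst \<omega> z)" "V.k0 = profile (\<lambda>z. pi * fst \<omega> z)"
     "smooth (\<lambda>z. pi * snd \<omega> z)" "radial (\<lambda>z. pi * snd \<omega> z)" "V.k1 = profile (\<lambda>z. pi * snd \<omega> z)"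
    using V.vol_radial by (auto intro!: smooth_mult smooth_const V.vol_smooth simp: radial_def V.k0_def V.k1_def)
  have sf0: "smooth (\<lambda>z. f0 ((cmod z)\<^sup>2) l)"
    by (rule X.L.smooth_solution[OF P.herm_smooth(1) herm_radial(1) H0_def pik(1,2,3)])
  have sf1: "smooth (\<lambda>z. f1 ((cmod z)\<^sup>2) l)"
    by (rule X.R.smooth_solution[OF P.herm_smooth(2) herm_radial(2) H1_def pik(4,5,6)])
  have sec: "smooth_section m \<sigma>" unfolding smooth_section_def \<sigma>_def fst_conv snd_conv
  proof (intro conjI allI impI)
    show "smooth (\<lambda>z. complex_of_real (f0 ((cmod z)\<^sup>2) l))" by (rule smooth_of_real[OF sf0])
    show "smooth (\<lambda>w. w ^ m * complex_of_real (c * f1 ((cmod w)\<^sup>2) l))"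
      by (intro smooth_mult smooth_power smooth_ident smooth_of_real smooth_const sf1)
    fix z :: complex assume z: "z \<noteq> 0"
    then show "complex_of_real (f0 ((cmod z)\<^sup>2) l) = z ^ m * ((1 / z) ^ m * complex_of_real (c * f1 ((cmod (1 / z))\<^sup>2) l))"
      using glue[of "(cmod z)\<^sup>2"] by (simp add: norm_divide power_divide)
  qed
  have dz: "d_z (fst (flux h \<sigma>)) z = - complex_of_real (l * fst h z * (pi * fst \<omega> z)) * fst \<sigma> z" if z: "z \<noteq> 0" for z
  proof -
    define s where "s = (cmod z)\<^sup>2"
    have s: "s > 0" using z by (simp add: s_def)
    have fl: "fst (flux h \<sigma>) p = p * complex_of_real (X.L.q ((cmod p)\<^sup>2) l / (cmod p)\<^sup>2)" if p: "p \<noteq> 0" for p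
    proof -
      have "d_zbar (fst \<sigma>) p = p * complex_of_real (Q0 ((cmod p)\<^sup>2) l)"
        unfolding \<sigma>_def fst_conv by (rule d_zbar_radial[OF has_vector_derivative_of_real[OF X.L.f_deriv]])
      moreover have "fst h p = H0 ((cmod p)\<^sup>2)" unfolding H0_def by (rule radial_profile[OF herm_radial(1)])
      ultimately show ?thesis using p by (simp add: flux_def X.L.q_def)
    qed
    have "((\<lambda>s. X.L.q s l / s) has_real_derivative (- (l * X.L.V s * f0 s l) * s - X.L.q s l * 1) / (s * s)) (at s)"
      by (rule DERIV_divide[OF X.L.q_deriv DERIV_ident]) (use s in simp)
    then have "((\<lambda>s. complex_of_real (X.L.q s l / s)) has_vector_derivative
        complex_of_real ((- (l * X.L.V s * f0 s l) * s - X.L.q s l * 1) / (s * s))) (at ((cmod z)\<^sup>2))"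
      unfolding s_def by (rule has_vector_derivative_of_real)
    from d_z_times_radial[OF this]
    have "d_z (\<lambda>p. p * complex_of_real (X.L.q ((cmod p)\<^sup>2) l / (cmod p)\<^sup>2)) z =
       complex_of_real (X.L.q s l / s + s * ((- (l * X.L.V s * f0 s l) * s - X.L.q s l * 1) / (s * s)))"
      by (simp add: s_def)
    also have "X.L.q s l / s + s * ((- (l * X.L.V s * f0 s l) * s - X.L.q s l * 1) / (s * s)) = - (l * X.L.V s * f0 s l)"
      using s by (simp add: field_simps)
    also have "X.L.V s = fst h z * (pi * fst \<omega> z)"
      unfolding X.L.V_def using radial_profile[OF herm_radial(1), of z] radial_profile[OF pik(2), of z]
      by (simp add: H0_def pik(3) s_def)
    finally have 1: "d_z (\<lambda>p. p * complex_of_real (X.L.q ((cmod p)\<^sup>2) l / (cmod p)\<^sup>2)) z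
       = - complex_of_real (l * fst h z * (pi * fst \<omega> z)) * fst \<sigma> z" by (simp add: \<sigma>_def s_def ac_simps)
    have "\<forall>\<^sub>F p in nhds z. p \<noteq> 0" using z by (rule t1_space_nhds)
    then have "\<forall>\<^sub>F p in nhds z. fst (flux h \<sigma>) p = p * complex_of_real (X.L.q ((cmod p)\<^sup>2) l / (cmod p)\<^sup>2)"
      by (rule eventually_mono) (rule fl)
    from d_z_cong(1)[OF this] show ?thesis using 1 by simp
  qed
  have "laplacian m \<omega> h \<sigma> = (\<lambda>z. complex_of_real l * fst \<sigma> z, \<lambda>w. complex_of_real l * snd \<sigma> w)"
    unfolding P.laplacian_explicit[OF sec]
  proof (rule section_eqI[OF P.explicit_laplacian_section[OF sec]])
    show "smooth_section m (\<lambda>z. complex_of_real l * fst \<sigma> z, \<lambda>w. complex_of_real l * snd \<sigma> w)"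
      using sec unfolding smooth_section_def fst_conv snd_conv by (auto intro!: smooth_mult smooth_const)
    fix z :: complex assume z: "z \<noteq> 0"
    have "complex_of_real (- inverse (pi * fst h z * fst \<omega> z)) * (- complex_of_real (l * fst h z * (pi * fst \<omega> z))) = complex_of_real l"
      using P.herm_pos(1)[of z] P.vol_pos(1)[of z] by (simp add: field_simps)
    then show "fst (explicit_laplacian \<omega> h \<sigma>) z = fst (\<lambda>z. complex_of_real l * fst \<sigma> z, \<lambda>w. complex_of_real l * snd \<sigma> w) z"
      unfolding explicit_laplacian_def fst_conv dz[OF z] by (simp only: mult.assoc[symmetric])
  qed
  moreover have "S1_invariant \<sigma>" by (simp add: S1_invariant_def \<sigma>_def norm_mult)
  moreover have "\<sigma> \<noteq> (\<lambda>z. 0, \<lambda>w. 0)"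
  proof
    assume "\<sigma> = (\<lambda>z. 0, \<lambda>w. 0)"
    then have "fst \<sigma> 0 = 0" by simp
    then show False by (simp add: \<sigma>_def X.L.f_at_0)
  qed
  ultimately show ?thesis unfolding invariant_spectrum_def using sec by blast
qed

lemma spectrum_eq:
  assumes "matching m H0 V.k0 f0 Q0 H1 V.k1 f1 Q1 b (1 / b)"
  shows "invariant_spectrum m \<omega> h = {l. matching.disc m H0 f0 Q0 H1 f1 Q1 b (1 / b) l = 0}"
  using spectrum_imp_disc[OF assms] disc_imp_spectrum[OF assms] by blast

end

section \<open>Comparison with the limit problem\<close>

text \<open>The unprimed problem is the given one in s. The primed one lives in the mass x = M(s)
  and is pulled back to s by \<open>angle_datum_reparam\<close>, whence the factors \<mu>.\<close>

lemma radial_angle_comparison: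
  assumes A: "radial_sol m H k f Q" and B: "radial_sol m H' k' f' Q'" and b: "0 < b" and l: "0 \<le> l"
    and M: "M 0 = 0" "\<And>s. (M has_real_derivative \<mu> s) (at s)"
    and \<mu>: "continuous_on UNIV \<mu>" "\<And>s. 0 < \<mu> s"
  shows "\<lbrakk>\<And>s. 0 < s \<Longrightarrow> s \<le> b \<Longrightarrow> \<mu> s * radial_sol.P m H' (M s) \<le> radial_sol.P m H s;
      \<And>s. 0 < s \<Longrightarrow> s \<le> b \<Longrightarrow> \<mu> s * radial_sol.V m H' k' (M s) < radial_sol.V m H k s; 0 < l\<rbrakk>
      \<Longrightarrow> radial_sol.angle m H' k' f' Q' (M b) l < radial_sol.angle m H k f Q b l"
    and "\<lbrakk>\<And>s. 0 < s \<Longrightarrow> s \<le> b \<Longrightarrow> radial_sol.P m H s \<le> \<mu> s * radial_sol.P m H' (M s);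
      \<And>s. 0 < s \<Longrightarrow> s \<le> b \<Longrightarrow> radial_sol.V m H k s \<le> \<mu> s * radial_sol.V m H' k' (M s)\<rbrakk>
      \<Longrightarrow> radial_sol.angle m H k f Q b l \<le> radial_sol.angle m H' k' f' Q' (M b) l"
proof -
  interpret A: radial_sol m H k f Q by fact
  interpret B: radial_sol m H' k' f' Q' by fact
  have dB: "angle_datum m b (\<lambda>s. B.angle (M s) l) (\<lambda>s. \<mu> s * B.P (M s)) (\<lambda>s. \<mu> s * (l * B.V (M s)))"
    by (rule angle_datum_reparam[where M = M and \<mu> = \<mu> and \<beta> = "\<lambda>s. B.angle s l", OF B.angle_datum b M(1)]) (use M \<mu> in \<open>auto intro: continuous_on_subset\<close>)
  show "B.angle (M b) l < A.angle b l"
    if "\<And>s. 0 < s \<Longrightarrow> s \<le> b \<Longrightarrow> \<mu> s * B.P (M s) \<le> A.P s"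
      and V: "\<And>s. 0 < s \<Longrightarrow> s \<le> b \<Longrightarrow> \<mu> s * B.V (M s) < A.V s" and "0 < l"
  proof (rule angle_datum_comparison(2)[OF A.angle_datum dB b])
    show "\<mu> s * (l * B.V (M s)) < l * A.V s" if "0 < s" "s \<le> b" for s
      using mult_strict_left_mono[OF V[OF that] \<open>0 < l\<close>] by (simp add: ac_simps)
    then show "\<mu> s * (l * B.V (M s)) \<le> l * A.V s" if "0 < s" "s \<le> b" for s
      using that by (simp add: less_imp_le)
  qed (use that in auto)
  show "A.angle b l \<le> B.angle (M b) l"
    if "\<And>s. 0 < s \<Longrightarrow> s \<le> b \<Longrightarrow> A.P s \<le> \<mu> s * B.P (M s)"
      and V: "\<And>s. 0 < s \<Longrightarrow> s \<le> b \<Longrightarrow> A.V s \<le> \<mu> s * B.V (M s)"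
  proof (rule angle_datum_comparison(1)[OF dB A.angle_datum b])
    show "l * A.V s \<le> \<mu> s * (l * B.V (M s))" if "0 < s" "s \<le> b" for s
      using mult_left_mono[OF V[OF that] l] by (simp add: ac_simps)
  qed (use that in auto)
qed

context invariant_pair
begin

lemma pinched_left:
  assumes p: "pinched m \<omega> h" and s: "0 < s" "V.M0 s \<le> 1/2"
  shows "1 < H0 s" "H0 s < V.M0 s / (s * V.k0 s)"
proof -
  have "min 1 (2 * (1 - V.M0 s)) = 1" "min (V.M0 s) (1 - V.M0 s) = V.M0 s" using s(2) by auto
  then show "1 < H0 s" "H0 s < V.M0 s / (s * V.k0 s)"
    using p[unfolded V.pinched_iff] s(1) by (auto simp: H0_def)
qed

lemma right_chart:
  assumes t: "0 < t"
  shows "H0 (1 / t) = t ^ m * H1 t" "(1 / t) * V.k0 (1 / t) = t * V.k1 t" "V.M0 (1 / t) = 1 - V.M1 t"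
proof -
  show "H0 (1 / t) = t ^ m * H1 t" using H_match[of "1 / t"] t by (simp add: power_divide field_simps)
  show "(1 / t) * V.k0 (1 / t) = t * V.k1 t" using V.k_match[of "1 / t"] t by (simp add: power2_eq_square field_simps)
  show "V.M0 (1 / t) = 1 - V.M1 t" using V.M_sum[of "1 / t"] t by simp
qed

text \<open>The pinching condition in the w-chart, where 1 - x is M1(t) and h(1,1) is t^m H1(t). The
  weight becomes (2 M1)^m, which vanishes at infinity to the same order as h(1,1).\<close>

lemma pinched_right:
  assumes p: "pinched m \<omega> h" and t: "0 < t" "V.M1 t \<le> 1/2"
  shows "(2 * V.M1 t) ^ m < t ^ m * H1 t" "t ^ m * H1 t * (t * V.k1 t) < (2 * V.M1 t) ^ m * V.M1 t"
proof -
  have M: "0 < V.M1 t" using V.M_mono(2)[OF t(1)] V.M_at_0 by simp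
  have t': "1 / t > 0" using t(1) by simp
  have "1 < H0 (1 / t) / (min 1 (2 * (1 - V.M0 (1 / t)))) ^ m"
     "H0 (1 / t) / (min 1 (2 * (1 - V.M0 (1 / t)))) ^ m < min (V.M0 (1 / t)) (1 - V.M0 (1 / t)) / ((1 / t) * V.k0 (1 / t))"
    using p[unfolded V.pinched_iff, rule_format, OF t'] unfolding H0_def by blast+
  moreover have "min 1 (2 * V.M1 t) = 2 * V.M1 t" "min (1 - V.M1 t) (V.M1 t) = V.M1 t" using t(2) by auto
  ultimately have 1: "1 < t ^ m * H1 t / (2 * V.M1 t) ^ m" "t ^ m * H1 t / (2 * V.M1 t) ^ m < V.M1 t / (t * V.k1 t)"
    unfolding right_chart[OF t(1)] by simp_all
  have w: "(2 * V.M1 t) ^ m > 0" "t * V.k1 t > 0" using M t V.k_pos by simp_all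
  show "(2 * V.M1 t) ^ m < t ^ m * H1 t" using 1(1) w(1) by (simp add: field_simps)
  show "t ^ m * H1 t * (t * V.k1 t) < (2 * V.M1 t) ^ m * V.M1 t" using 1(2) w
    by (simp add: divide_less_eq less_divide_eq ac_simps)
qed

lemma M_pos: "s > 0 \<Longrightarrow> V.M0 s > 0" "s > 0 \<Longrightarrow> V.M1 s > 0"
  using V.M_mono(1)[of 0 s] V.M_mono(2)[of 0 s] V.M_at_0 by simp_all

text \<open>The j-th eigenvalue is where the total angle reaches j \<pi>, so an inequality between
  angles at fixed l becomes the opposite one between eigenvalues. In the lower bound one hypothesis
  on \<omega>, namely min(x, 1-x) \<le> \<rho> g/2, controls both coefficients: p is bounded below
  because h > w0, and the upper half of the pinching forces h < \<rho> w0.\<close>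

lemma eigenvalue_bounds:
  assumes p: "pinched m \<omega> h"
  shows "increasing_listing (invariant_eigenvalue m \<omega> h) (invariant_spectrum m \<omega> h)"
    and "invariant_eigenvalue m \<omega> h 0 = 0"
    and "j \<ge> 1 \<Longrightarrow> invariant_eigenvalue m \<omega> h j < (xi m j)\<^sup>2 / 2"
    and "\<lbrakk>j \<ge> 1; \<And>s. s > 0 \<Longrightarrow> min (V.M0 s) (1 - V.M0 s) \<le> \<rho> * (s * V.k0 s)\<rbrakk>
      \<Longrightarrow> (xi m j)\<^sup>2 / 2 / \<rho>\<^sup>2 \<le> invariant_eigenvalue m \<omega> h j"
proof -
  \<comment> \<open>The circle |z|^2 = b halves the mass; at x = 1/2 the limit problem changes its
    formula.\<close>
  obtain b where b: "b > 0" "V.M0 b = 1/2" using V.M0_surj[of "1/2"] by auto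
  have b1: "1 / b > 0" "V.M1 (1 / b) = 1/2" using b V.M_sum[OF b(1)] by auto
  have left: "0 < V.M0 s \<and> V.M0 s \<le> 1/2" if "0 < s" "s \<le> b" for s
    using V.M_mono(1)[of s b] M_pos(1)[of s] b that by (cases "s = b") auto
  have right: "0 < V.M1 s \<and> V.M1 s \<le> 1/2" if "0 < s" "s \<le> 1 / b" for s
    using V.M_mono(2)[of s "1 / b"] M_pos(2)[of s] b1 that by (cases "s = 1 / b") auto
  obtain f0 Q0 f1 Q1 where mt: "\<And>b. b > 0 \<Longrightarrow> matching m H0 V.k0 f0 Q0 H1 V.k1 f1 Q1 b (1 / b)"
    using solutions_exist by blast
  interpret X: matching m H0 V.k0 f0 Q0 H1 V.k1 f1 Q1 b "1 / b" by (rule mt[OF b(1)])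
  interpret Y: bessel_limit m 1 by unfold_locales simp
  obtain a where a: "increasing_listing a {l. X.disc l = 0}" "a 0 = 0" "\<And>j. a j \<ge> 0" "\<And>j. X.total_angle (a j) = real j * pi"
    using X.listing by blast
  obtain c where c: "increasing_listing c {l. Y.disc l = 0}" "c 0 = 0" "\<And>j. c j \<ge> 0" "\<And>j. Y.total_angle (c j) = real j * pi"
    using Y.listing by blast
  have la: "increasing_listing a (invariant_spectrum m \<omega> h)"
    unfolding spectrum_eq[OF X.matching_axioms] by (rule a(1))
  have ev: "invariant_eigenvalue m \<omega> h = a"
    unfolding invariant_eigenvalue_def by (rule the_increasing_listing[OF la])
  show "increasing_listing (invariant_eigenvalue m \<omega> h) (invariant_spectrum m \<omega> h)" "invariant_eigenvalue m \<omega> h 0 = 0"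
    unfolding ev using la a(2) by auto
  have xi: "(xi m j)\<^sup>2 / 2 = c j" if "j \<ge> 1" for j
    using xi_listing(2)[OF c(1,2) that] .
  have cpos: "c j > 0" if "j \<ge> 1" for j
    using strict_monoD[of c 0 j] c(1,2) that by (simp add: increasing_listing_def)
  have upper: "Y.total_angle l < X.total_angle l" if l: "l > 0" for l
  proof -
    have "Y.L.angle (V.M0 b) l < X.L.angle b l"
    proof (rule radial_angle_comparison(1)[OF X.L.radial_sol_axioms Y.L.radial_sol_axioms b(1) less_imp_le[OF l] V.M_at_0(1) V.M0_deriv V.k_cont(1) V.k_pos(1) _ _ l])
      fix s assume s: "0 < s" "s \<le> b"
      note M = left[OF s] and pl = pinched_left[OF p s(1)]
      have k: "V.k0 s > 0" by (rule V.k_pos)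
      show "V.k0 s * Y.L.P (V.M0 s) \<le> X.L.P s"
        unfolding Y.L.P_def X.L.P_def using pl(2) M s k H_pos(1)[of s] by (simp add: field_simps)
      show "V.k0 s * Y.L.V (V.M0 s) < X.L.V s"
        unfolding Y.L.V_def X.L.V_def using pl(1) M s k by simp
    qed
    moreover have "Y.R.angle (V.M1 (1 / b)) l < X.R.angle (1 / b) l"
    proof (rule radial_angle_comparison(1)[OF X.R.radial_sol_axioms Y.R.radial_sol_axioms b1(1) less_imp_le[OF l] V.M_at_0(2) V.M1_deriv V.k_cont(2) V.k_pos(2) _ _ l])
      fix s assume s: "0 < s" "s \<le> 1 / b"
      note M = right[OF s] and pr = pinched_right[OF p s(1)]
      have k: "V.k1 s > 0" by (rule V.k_pos)
      have "s ^ m * H1 s * (s * V.k1 s) \<le> (2 * V.M1 s) ^ m * V.M1 s" using pr(2) M by simp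
      then have "V.k1 s * (s ^ (m + 1) * H1 s) \<le> V.M1 s ^ (m + 1) * 2 ^ m"
        by (simp add: power_mult_distrib ac_simps)
      moreover have "V.M1 s ^ (m + 1) * 2 ^ m > 0" "s ^ (m + 1) * H1 s > 0"
        using M s H_pos(2)[of s] by (simp_all del: power_Suc)
      ultimately show "V.k1 s * Y.R.P (V.M1 s) \<le> X.R.P s"
        unfolding Y.R.P_def X.R.P_def by (simp add: field_simps del: power_Suc)
      show "V.k1 s * Y.R.V (V.M1 s) < X.R.V s"
        unfolding Y.R.V_def X.R.V_def
        using mult_strict_left_mono[OF pr(1) k] M by (simp add: power_mult_distrib ac_simps)
    qed
    ultimately show ?thesis unfolding X.total_angle_def Y.total_angle_def b(2) b1(2) by simp
  qed
  show "invariant_eigenvalue m \<omega> h j < (xi m j)\<^sup>2 / 2" if j: "j \<ge> 1"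
  proof -
    \<comment> \<open>At c j the limit angle is j \<pi> and the given one is already larger, so the
      given angle has passed j \<pi> before.\<close>
    have "X.total_angle (a j) < X.total_angle (c j)" unfolding a(4) c(4)[symmetric] by (rule upper[OF cpos[OF j]])
    then have "\<not> c j \<le> a j" using X.total_angle_mono[of "c j" "a j"] by (auto simp: le_less)
    then show ?thesis unfolding ev xi[OF j] by simp
  qed
  show "(xi m j)\<^sup>2 / 2 / \<rho>\<^sup>2 \<le> invariant_eigenvalue m \<omega> h j"
    if j: "j \<ge> 1" and \<rho>: "\<And>s. s > 0 \<Longrightarrow> min (V.M0 s) (1 - V.M0 s) \<le> \<rho> * (s * V.k0 s)"
  proof -
    have rl: "V.M0 s \<le> \<rho> * (s * V.k0 s)" if "0 < s" "s \<le> b" for s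
      using \<rho>[of s] left[OF that] that by simp
    have rr: "V.M1 s \<le> \<rho> * (s * V.k1 s)" if "0 < s" "s \<le> 1 / b" for s
      using \<rho>[of "1 / s"] right[OF that] that unfolding right_chart[OF that(1)] by simp
    have "0 < \<rho> * (b * V.k0 b)" using rl[of b] left[of b] b(1) by linarith
    moreover have "0 < b * V.k0 b" using b(1) V.k_pos(1)[of b] by simp
    ultimately have rpos: "\<rho> > 0" by (rule zero_less_mult_pos2)
    interpret Z: bessel_limit m \<rho> by unfold_locales (rule rpos)
    obtain d where d: "increasing_listing d {l. Z.disc l = 0}" "d 0 = 0" "\<And>j. d j \<ge> 0" "\<And>j. Z.total_angle (d j) = real j * pi"
      using Z.listing by blast
    have "increasing_listing (\<lambda>j. c j / \<rho>\<^sup>2) {l. Z.disc l = 0}" unfolding increasing_listing_def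
    proof
      show "strict_mono (\<lambda>j. c j / \<rho>\<^sup>2)"
        using c(1) rpos by (auto simp: increasing_listing_def strict_mono_def divide_strict_right_mono)
      have e: "Z.disc l = 0 \<longleftrightarrow> Y.disc (l * \<rho>\<^sup>2) = 0" for l
        unfolding Z.disc_eq Y.disc_eq using rpos by simp
      have rc: "range c = {l. Y.disc l = 0}" using c(1) by (simp add: increasing_listing_def)
      show "range (\<lambda>j. c j / \<rho>\<^sup>2) = {l. Z.disc l = 0}"
      proof (intro equalityI subsetI)
        fix x assume "x \<in> range (\<lambda>j. c j / \<rho>\<^sup>2)"
        then obtain j where "x = c j / \<rho>\<^sup>2" by blast
        then have "x * \<rho>\<^sup>2 \<in> range c" using rpos by simp
        then show "x \<in> {l. Z.disc l = 0}" unfolding e rc by simp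
      next
        fix x assume "x \<in> {l. Z.disc l = 0}"
        then have "x * \<rho>\<^sup>2 \<in> range c" unfolding e rc by simp
        then obtain j where "x * \<rho>\<^sup>2 = c j" by blast
        then have "x = c j / \<rho>\<^sup>2" using rpos by (simp add: field_simps)
        then show "x \<in> range (\<lambda>j. c j / \<rho>\<^sup>2)" by blast
      qed
    qed
    then have dc: "d = (\<lambda>j. c j / \<rho>\<^sup>2)" by (rule increasing_listing_unique[OF d(1)])
    have lower: "X.total_angle l \<le> Z.total_angle l" if l: "l \<ge> 0" for l
    proof -
      have "X.L.angle b l \<le> Z.L.angle (V.M0 b) l"
      proof (rule radial_angle_comparison(2)[OF X.L.radial_sol_axioms Z.L.radial_sol_axioms b(1) l V.M_at_0(1) V.M0_deriv V.k_cont(1) V.k_pos(1)])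
        fix s assume s: "0 < s" "s \<le> b"
        note M = left[OF s] and pl = pinched_left[OF p s(1)]
        have k: "V.k0 s > 0" by (rule V.k_pos)
        have "1 / (s * H0 s) \<le> 1 / s" using pl(1) M s by (simp add: field_simps)
        also have "\<dots> \<le> V.k0 s * (\<rho> / V.M0 s)" using rl[OF s] M s by (simp add: field_simps)
        finally show "X.L.P s \<le> V.k0 s * Z.L.P (V.M0 s)" unfolding Z.L.P_def X.L.P_def by simp
        have "H0 s \<le> V.M0 s / (s * V.k0 s)" using pl(2) M by simp
        also have "\<dots> \<le> \<rho>" using rl[OF s] s k by (simp add: field_simps)
        finally show "X.L.V s \<le> V.k0 s * Z.L.V (V.M0 s)"
          unfolding Z.L.V_def X.L.V_def using k rpos by (simp add: power2_eq_square mult.commute)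
      qed
      moreover have "X.R.angle (1 / b) l \<le> Z.R.angle (V.M1 (1 / b)) l"
      proof (rule radial_angle_comparison(2)[OF X.R.radial_sol_axioms Z.R.radial_sol_axioms b1(1) l V.M_at_0(2) V.M1_deriv V.k_cont(2) V.k_pos(2)])
        fix s assume s: "0 < s" "s \<le> 1 / b"
        note M = right[OF s] and pr = pinched_right[OF p s(1)]
        have k: "V.k1 s > 0" by (rule V.k_pos)
        have q: "(2 * V.M1 s) ^ m > 0" using M by simp
        have "V.M1 s ^ (m + 1) * 2 ^ m = (2 * V.M1 s) ^ m * V.M1 s" by (simp add: power_mult_distrib)
        also have "\<dots> \<le> (s ^ m * H1 s) * (\<rho> * (s * V.k1 s))"
          using pr(1) M rr[OF s] q H_pos(2)[of s] s by (intro mult_mono) auto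
        also have "\<dots> = V.k1 s * \<rho> * (s ^ (m + 1) * H1 s)" by simp
        finally have "V.M1 s ^ (m + 1) * 2 ^ m \<le> V.k1 s * \<rho> * (s ^ (m + 1) * H1 s)" .
        moreover have "V.M1 s ^ (m + 1) * 2 ^ m > 0" "s ^ (m + 1) * H1 s > 0"
          using M s H_pos(2)[of s] by (simp_all del: power_Suc)
        ultimately have "1 / (s ^ (m + 1) * H1 s) \<le> V.k1 s * \<rho> / (V.M1 s ^ (m + 1) * 2 ^ m)"
          by (simp add: field_simps del: power_Suc)
        then show "X.R.P s \<le> V.k1 s * Z.R.P (V.M1 s)"
          unfolding Z.R.P_def X.R.P_def by (simp del: power_Suc)
        have sk: "s * V.k1 s > 0" using s k by simp
        have "(s ^ m * H1 s) * (s * V.k1 s) \<le> ((2 * V.M1 s) ^ m * \<rho>) * (s * V.k1 s)"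
          using less_imp_le[OF pr(2)[OF conjunct2[OF M]]] mult_left_mono[OF rr[OF s] less_imp_le[OF q]]
          unfolding mult.assoc by (rule order_trans)
        then have "s ^ m * H1 s \<le> (2 * V.M1 s) ^ m * \<rho>"
          by (rule mult_right_le_imp_le[OF _ sk])
        from mult_left_mono[OF this less_imp_le[OF k]]
        show "X.R.V s \<le> V.k1 s * Z.R.V (V.M1 s)"
          unfolding Z.R.V_def X.R.V_def using rpos by (simp add: power2_eq_square power_mult_distrib ac_simps)
      qed
      ultimately show ?thesis unfolding X.total_angle_def Z.total_angle_def b(2) b1(2) by simp
    qed
    have "Z.total_angle (d j) \<le> Z.total_angle (a j)" unfolding d(4) a(4)[symmetric] by (rule lower[OF a(3)])
    then have "\<not> a j < d j" using Z.total_angle_mono[of "a j" "d j"] by auto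
    then show ?thesis unfolding ev xi[OF j] dc by simp
  qed
qed

end

section \<open>Near-extremal pairs\<close>

text \<open>
  Near-extremal volume forms: the densities \<open>(1 + |z|\<^sup>2\<^sup>n)\<^sup>-\<^sup>2\<^sup>/\<^sup>n\<close>, which look the same in both charts
  and tend to \<open>min(1, |z|\<^sup>-\<^sup>4)\<close>, the density of two flat discs glued along the unit circle.
\<close>

definition bump :: "nat \<Rightarrow> real \<Rightarrow> real" where
  "bump n s = exp (- (2 / real n) * ln (1 + s ^ n))"

lemma bump_pos: "bump n s > 0" by (simp add: bump_def)

text \<open>From 1 + s^n = s^n (1 + s^-n). It is the transition rule for densities written in
  s.\<close>

lemma bump_inverse:
  assumes "n \<ge> 1" "s > 0" shows "bump n s = bump n (1 / s) / s\<^sup>2"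
proof -
  have "1 + s ^ n = s ^ n * (1 + (1 / s) ^ n)" using assms by (simp add: power_divide field_simps)
  moreover have "1 + (1 / s) ^ n > 0" using assms by (intro add_pos_nonneg) auto
  ultimately have "ln (1 + s ^ n) = real n * ln s + ln (1 + (1 / s) ^ n)"
    using assms by (simp add: ln_mult_pos ln_realpow)
  then have "- (2 / real n) * ln (1 + s ^ n) = - (2 / real n) * ln (1 + (1 / s) ^ n) - 2 * ln s"
    using assms by (simp add: field_simps)
  then have "bump n s = exp (- (2 / real n) * ln (1 + (1 / s) ^ n)) / exp (2 * ln s)"
    unfolding bump_def by (simp only: exp_diff)
  also have "exp (2 * ln s) = s\<^sup>2" using assms by (simp add: exp_double)
  finally show ?thesis by (simp add: bump_def)
qed

lemma bump_smooth: "smooth (\<lambda>z. bump n ((cmod z)\<^sup>2))"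
proof -
  have "smooth (\<lambda>z. 1 + ((cmod z)\<^sup>2) ^ n)" by (intro smooth_add smooth_const smooth_power smooth_norm_sq)
  moreover have "1 + ((cmod z)\<^sup>2) ^ n > 0" for z by (intro add_pos_nonneg) auto
  ultimately show ?thesis unfolding bump_def by (intro smooth_exp smooth_mult smooth_const smooth_ln)
qed

text \<open>Uses 1 + s^n \<ge> max(1, s)^n \<ge> ((1 + s)/2)^n. The bound is an integrable majorant
  over the plane.\<close>

lemma bump_decay:
  assumes n: "n \<ge> 1" and s: "s \<ge> 0" shows "bump n s \<le> 4 / (1 + s)\<^sup>2"
proof -
  have "((1 + s) / 2) ^ n \<le> (max 1 s) ^ n" using s by (intro power_mono) auto
  also have "\<dots> \<le> 1 + s ^ n" using s by (simp add: max_def)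
  finally have "ln (((1 + s) / 2) ^ n) \<le> ln (1 + s ^ n)" using s by (intro ln_mono zero_less_power) auto
  then have "real n * ln ((1 + s) / 2) \<le> ln (1 + s ^ n)" using s by (simp add: ln_realpow)
  then have "2 * ln ((1 + s) / 2) \<le> (2 / real n) * ln (1 + s ^ n)" using n by (simp add: field_simps)
  then have "bump n s \<le> exp (- (2 * ln ((1 + s) / 2)))" unfolding bump_def by simp
  also have "\<dots> = 1 / ((1 + s) / 2)\<^sup>2" using s by (simp add: exp_minus exp_double inverse_eq_divide)
  also have "\<dots> = 4 / (1 + s)\<^sup>2" by (simp add: power_divide)
  finally show ?thesis .
qed

lemma bump_integrable:
  assumes n: "n \<ge> 1" shows "integrable lborel (\<lambda>z. bump n ((cmod z)\<^sup>2))"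
proof (rule integrableI_nonneg)
  show m: "(\<lambda>z. bump n ((cmod z)\<^sup>2)) \<in> borel_measurable lborel"
    using borel_measurable_continuous_onI[OF smooth_continuous[OF bump_smooth]] by simp
  define \<phi> where "\<phi> = (\<lambda>s::real. 4 / (1 + \<bar>s\<bar>)\<^sup>2)"
  have c\<phi>: "\<phi> \<in> borel_measurable borel" unfolding \<phi>_def
    by (intro borel_measurable_continuous_onI continuous_intros) (auto simp: add_nonneg_eq_0_iff)
  have "(\<integral>\<^sup>+ z. ennreal (bump n ((cmod z)\<^sup>2)) \<partial>lborel) \<le> (\<integral>\<^sup>+ z. ennreal (\<phi> ((cmod z)\<^sup>2)) \<partial>lborel)"
    using bump_decay[OF n] by (intro nn_integral_mono ennreal_leI) (simp add: \<phi>_def)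
  also have "\<dots> = (\<integral>\<^sup>+ s. ennreal (pi * \<phi> s) * indicator {0..} s \<partial>lborel)"
    by (rule nn_integral_radial[OF c\<phi>]) (simp add: \<phi>_def)
  also have "\<dots> = ennreal (0 - (- (4 * pi) / (1 + 0)))"
  proof (rule nn_integral_FTC_atLeast)
    show "(\<lambda>s. pi * \<phi> s) \<in> borel_measurable borel" using c\<phi> by simp
    show "((\<lambda>s. - (4 * pi) / (1 + s)) has_real_derivative pi * \<phi> x) (at x)" if "0 \<le> x" for x
      using that by (auto intro!: derivative_eq_intros simp: \<phi>_def power2_eq_square)
    show "((\<lambda>s. - (4 * pi) / (1 + s)) \<longlongrightarrow> 0) at_top"
      by (intro tendsto_divide_0[OF tendsto_const] filterlim_at_top_imp_at_infinity filterlim_tendsto_add_at_top[OF tendsto_const] filterlim_ident)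
  qed (simp add: \<phi>_def)
  also have "\<dots> < \<infinity>" by simp
  finally show "(\<integral>\<^sup>+ z. ennreal (bump n ((cmod z)\<^sup>2)) \<partial>lborel) < \<infinity>" .
qed (simp add: bump_pos less_imp_le)

text \<open>On the unit interval s^j is at most each of the j + 1 powers up to it, and (1 - s) times
  their sum telescopes to at most 1.\<close>

lemma power_tail_bound: "0 \<le> s \<Longrightarrow> s \<le> 1 \<Longrightarrow> (1 - s) * s ^ j \<le> 1 / (real j + 1)" for s :: real
proof -
  assume s: "0 \<le> s" "s \<le> 1"
  have "(real j + 1) * s ^ j = (\<Sum>i<Suc j. s ^ j)" by simp
  also have "\<dots> \<le> (\<Sum>i<Suc j. s ^ i)" using s by (intro sum_mono power_decreasing) auto
  finally have "(1 - s) * ((real j + 1) * s ^ j) \<le> (1 - s) * (\<Sum>i<Suc j. s ^ i)" using s by (intro mult_left_mono) auto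
  also have "\<dots> = 1 - s ^ Suc j" by (rule one_diff_power_eq[symmetric])
  also have "\<dots> \<le> 1" using s by simp
  finally show ?thesis by (simp add: field_simps)
qed

text \<open>For this \<omega> the upper bound min(x, 1-x) / (s k0) exceeds 1 only by a quantity of
  order s^n at the pole 0, and symmetrically at infinity; this is all the room the metric has.
  Instead of the nonsmooth min(1, 2(1-x)) the metric uses \<open>kz\<close>, the average of 1 and
  2(1-x) with weights 1 and s^(N+1). An average is at least the minimum, and it is close to it when
  N is large. The factor \<open>B\<close>, slightly above 1, makes the lower inequality
  strict.\<close>

lemma near_extremal_pair:
  assumes n: "n \<ge> 1"
  obtains \<omega> h where "(\<omega>, h) \<in> admissible_pairs m"
    "\<And>s. s > 0 \<Longrightarrow> min (invariant_volume.M0 \<omega> s) (1 - invariant_volume.M0 \<omega> s)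
        \<le> exp (2 / real n * ln 2) * (s * invariant_volume.k0 \<omega> s)"
proof -
  define I where "I = (LINT z|lborel. bump n ((cmod z)\<^sup>2))"
  have I: "I > 0"
  proof -
    have "I \<ge> 0" unfolding I_def by (intro integral_nonneg_AE AE_I2) (simp add: bump_pos less_imp_le)
    moreover have "I \<noteq> 0"
    proof
      assume "I = 0"
      then have "AE z in lborel. bump n ((cmod z)\<^sup>2) = 0" unfolding I_def
        by (subst (asm) integral_nonneg_eq_0_iff_AE[OF bump_integrable[OF n]]) (auto simp: bump_pos less_imp_le)
      then have "bump n ((cmod 0)\<^sup>2) = 0" by (rule continuous_AE_zero[OF smooth_continuous[OF bump_smooth]])
      then show False using bump_pos[of n "(cmod 0)\<^sup>2"] by simp
    qed
    ultimately show ?thesis by simp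
  qed
  define \<rho> where "\<rho> = (\<lambda>z. bump n ((cmod z)\<^sup>2) / I)"
  have \<rho>: "smooth \<rho>" "\<And>z. \<rho> z > 0" "radial \<rho>"
    using I bump_pos by (auto simp: \<rho>_def radial_def intro!: smooth_divide bump_smooth smooth_const)
  define \<omega> where "\<omega> = (\<rho>, \<rho>)"
  have "invariant_volume \<omega>"
  proof
    have match: "\<rho> z = \<rho> (1 / z) / cmod z ^ 4" if "z \<noteq> 0" for z
      using bump_inverse[OF n, of "(cmod z)\<^sup>2"] that by (simp add: \<rho>_def norm_divide power_divide)
    show "volume_form \<omega>" unfolding volume_form_def \<omega>_def fst_conv snd_conv
      by (intro conjI allI impI \<rho> match)
    show "S1_invariant \<omega>" using \<rho> by (simp add: S1_invariant_radial \<omega>_def)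
    show "total_mass \<omega> = 1" using I by (simp add: total_mass_def \<omega>_def \<rho>_def I_def)
  qed
  then interpret V: invariant_volume \<omega> .
  define C where "C = pi / I"
  have C: "C > 0" using I by (simp add: C_def)
  have k: "V.k0 s = C * bump n s" if "s \<ge> 0" for s
    unfolding V.k0_def profile_def using that by (simp add: \<omega>_def \<rho>_def C_def)
  have k1: "V.k1 = V.k0" unfolding V.k0_def[abs_def] V.k1_def[abs_def] by (simp add: \<omega>_def)
  then have M1: "V.M1 = V.M0" unfolding V.M0_def V.M1_def by simp
  have sym: "V.M0 (1 / s) = 1 - V.M0 s" "(1 / s) * V.k0 (1 / s) = s * V.k0 s" if "s > 0" for s
    using V.M_sum[OF that] V.k_match[OF that] that by (simp_all add: M1 k1 power2_eq_square field_simps)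
  have half: "V.M0 1 = 1/2" using sym(1)[of 1] by simp
  have Mpos: "V.M0 s > 0" if "s > 0" for s using V.M_mono(1)[OF that] V.M_at_0 by simp
  \<comment> \<open>For s \<le> 1 one has 1 + s^n \<le> 2, so the density varies at most by the
    factor 2^(2/n), which tends to 1.\<close>
  define \<kappa> where "\<kappa> = exp (2 / real n * ln 2)"
  have kC: "V.k0 s \<le> C" "C \<le> \<kappa> * V.k0 s" if s: "0 \<le> s" "s \<le> 1" for s
  proof -
    have "0 \<le> ln (1 + s ^ n)" using s by simp
    then have "bump n s \<le> 1" unfolding bump_def by (simp add: mult_nonneg_nonneg)
    then show "V.k0 s \<le> C" using C k[OF s(1)] by simp
    have "ln (1 + s ^ n) \<le> ln 2" using s by (intro ln_mono) (auto intro: add_pos_nonneg power_le_one)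
    then have "2 / real n * ln (1 + s ^ n) \<le> 2 / real n * ln 2" by (intro mult_left_mono) auto
    then have "1 \<le> \<kappa> * bump n s" unfolding bump_def \<kappa>_def by (simp flip: exp_add)
    then show "C \<le> \<kappa> * V.k0 s" using C k[OF s(1)] mult_left_mono[of 1 "\<kappa> * bump n s" C] by (simp add: ac_simps)
  qed
  have slope: "V.M0 t - V.M0 s \<le> C * (t - s)" if st: "0 \<le> s" "s \<le> t" "t \<le> 1" for s t
  proof -
    have "C * s - V.M0 s \<le> C * t - V.M0 t"
    proof (rule DERIV_nonneg_imp_nondecreasing[OF st(2)])
      fix x assume x: "s \<le> x" "x \<le> t"
      have "((\<lambda>x. C * x - V.M0 x) has_real_derivative C - V.k0 x) (at x)"
        by (auto intro!: derivative_eq_intros V.M0_deriv)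
      then show "\<exists>y. ((\<lambda>x. C * x - V.M0 x) has_real_derivative y) (at x) \<and> 0 \<le> y"
        using kC(1)[of x] x st by fastforce
    qed
    then show ?thesis by (simp add: algebra_simps)
  qed
  have upper: "V.M0 s \<le> \<kappa> * (s * V.k0 s)" if s: "0 < s" "s \<le> 1" for s
  proof -
    have "V.M0 s \<le> C * s" using slope[of 0 s] s V.M_at_0 by simp
    also have "\<dots> \<le> (\<kappa> * V.k0 s) * s" using kC(2)[of s] s by (intro mult_right_mono) auto
    finally show ?thesis by (simp add: ac_simps)
  qed
  \<comment> \<open>To leading order at 0 the ratio of M0(s) to s k0(s) is 1 + 2 s^n / (n + 1). Half
    of this coefficient leaves enough slack for a bound on the whole unit interval; with e = s^n the
    sign of the derivative comes down to e (e - 1) \<le> 0.\<close>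
  have lower: "s * V.k0 s * (1 + s ^ n / (real n + 1)) \<le> V.M0 s" if s: "0 \<le> s" "s \<le> 1" for s
  proof -
    define g where "g = (\<lambda>x. x * (C * bump n x) * (1 + x ^ n / (real n + 1)) - V.M0 x)"
    have "g s \<le> g 0"
    proof (rule deriv_nonpos_imp_nonincreasing_open[OF s(1)])
      have "1 + x ^ n > 0" if "x \<ge> 0" for x :: real using that by (intro add_pos_nonneg) auto
      then have L: "continuous_on {0..s} (\<lambda>x. ln (1 + x ^ n))" by (intro continuous_intros) (metis atLeastAtMost_iff less_irrefl)
      show "continuous_on {0..s} g" unfolding g_def bump_def V.M0_def
        by (intro L continuous_intros prim_continuous V.k_cont) (auto simp: add_nonneg_eq_0_iff)
      fix x assume x: "0 < x" "x < s"
      have pos: "1 + x ^ n > 0" using x by (intro add_pos_nonneg) auto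
      define u where "u = bump n x"
      define e where "e = x ^ n"
      have xn: "real n * x ^ (n - 1) = real n * e / x" using x n by (simp add: e_def power_eq_if)
      have dpow: "((\<lambda>x. x ^ n) has_real_derivative real n * e / x) (at x)"
        by (rule DERIV_cong[OF DERIV_pow]) (use xn in simp)
      have db: "(bump n has_real_derivative u * (- 2 * e / (x * (1 + e)))) (at x)"
      proof -
        have "((\<lambda>x. - (2 / real n) * ln (1 + x ^ n)) has_real_derivative - (2 / real n) * (1 / (1 + x ^ n) * (0 + real n * e / x))) (at x)"
          by (intro DERIV_cmult DERIV_chain2[where f = ln and g = "\<lambda>x. 1 + x ^ n", OF DERIV_ln_divide[OF pos]] DERIV_add DERIV_const dpow)
        from DERIV_fun_exp[OF this]
        have "(bump n has_real_derivative u * (- (2 / real n) * (1 / (1 + x ^ n) * (0 + real n * e / x)))) (at x)"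
          by (simp add: bump_def[abs_def] u_def)
        moreover have "- (2 / real n) * (1 / (1 + x ^ n) * (0 + real n * e / x)) = - 2 * e / (x * (1 + e))"
          using n x by (simp add: e_def[symmetric])
        ultimately show ?thesis by (simp only:)
      qed
      have "(g has_real_derivative ((1 * (C * u) + (C * (u * (- 2 * e / (x * (1 + e))))) * x) * (1 + x ^ n / (real n + 1))
          + (0 + (real n * e / x) / (real n + 1)) * (x * (C * u))) - V.k0 x) (at x)"
        unfolding g_def u_def
        by (intro DERIV_diff DERIV_mult DERIV_cmult DERIV_add DERIV_const DERIV_ident DERIV_cdivide V.M0_deriv dpow db[unfolded u_def])
      moreover have "((1 * (C * u) + (C * (u * (- 2 * e / (x * (1 + e))))) * x) * (1 + x ^ n / (real n + 1))
          + (0 + (real n * e / x) / (real n + 1)) * (x * (C * u))) - V.k0 x \<le> 0"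
      proof -
        have e: "0 \<le> e" "e \<le> 1" using x s by (auto simp: e_def power_le_one)
        have u: "u > 0" by (simp add: u_def bump_pos)
        have factor: "((1 * (C * u) + (C * (u * v)) * x) * (1 + x ^ n / (real n + 1)) + (0 + w) * (x * (C * u))) - V.k0 x
          = C * u * ((1 + v * x) * (1 + e / (real n + 1)) + w * x - 1)" for v w
          using x k[of x] by (simp add: u_def[symmetric] e_def[symmetric] algebra_simps add_divide_distrib)
        have cancel: "- 2 * e / (x * (1 + e)) * x = - (2 * e / (1 + e))"
          "(real n * e / x) / (real n + 1) * x = real n * e / (real n + 1)" using x by simp_all
        have "((1 * (C * u) + (C * (u * (- 2 * e / (x * (1 + e))))) * x) * (1 + x ^ n / (real n + 1))
          + (0 + (real n * e / x) / (real n + 1)) * (x * (C * u))) - V.k0 x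
          = C * u * ((1 - 2 * e / (1 + e)) * (1 + e / (real n + 1)) + real n * e / (real n + 1) - 1)"
          unfolding factor cancel by simp
        also have "(1 - 2 * e / (1 + e)) * (1 + e / (real n + 1)) + real n * e / (real n + 1) - 1
            = e - 2 * e / (1 + e) * (1 + e / (real n + 1))"
        proof -
          have "e + real n * e = e * (real n + 1)" "real n + 1 \<noteq> 0" by (auto simp: algebra_simps)
          then have "e / (real n + 1) + real n * e / (real n + 1) = e"
            unfolding add_divide_distrib[symmetric] by simp
          moreover have "(1 - a) * (1 + v) + w - 1 = (v + w) - a * (1 + v)" for a v w :: real
            by (simp add: algebra_simps)
          ultimately show ?thesis by (simp only:)
        qed
        also have "\<dots> \<le> e - 2 * e / (1 + e) * 1"
          using e by (intro diff_left_mono mult_left_mono) auto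
        also have "\<dots> = e * (e - 1) / (1 + e)" using e by (simp add: field_simps)
        also have "\<dots> \<le> 0" using e by (intro divide_nonpos_pos mult_nonneg_nonpos) auto
        finally show ?thesis using C u by (simp add: mult_le_0_iff mult_nonneg_nonpos)
      qed
      ultimately show "\<exists>y. (g has_real_derivative y) (at x) \<and> y \<le> 0" by blast
    qed
    then show ?thesis using s k[of s] V.M_at_0 by (simp add: g_def)
  qed
  \<comment> \<open>M0(s)/s is nonincreasing on this range, because s k0 \<le> M0, and equals 1/2 at
    s = 1. This controls the division by 2 M0(t) in the outer disc.\<close>
  have chord: "s / 2 \<le> V.M0 s" if s: "0 < s" "s \<le> 1" for s
  proof -
    have "V.M0 1 / 1 \<le> V.M0 s / s"
    proof (rule DERIV_nonpos_imp_nonincreasing[OF s(2)])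
      fix x assume x: "s \<le> x" "x \<le> 1"
      have "((\<lambda>x. V.M0 x / x) has_real_derivative (V.k0 x * x - V.M0 x * 1) / (x * x)) (at x)"
        by (rule DERIV_divide[OF V.M0_deriv DERIV_ident]) (use x s in simp)
      moreover have "x * V.k0 x * 1 \<le> x * V.k0 x * (1 + x ^ n / (real n + 1))"
        using x s V.k_pos(1)[of x] by (intro mult_left_mono) auto
      then have "x * V.k0 x * 1 \<le> V.M0 x" by (rule order_trans) (use lower[of x] x s in auto)
      then have "V.k0 x * x - V.M0 x * 1 \<le> 0" by (simp add: mult.commute)
      then have "(V.k0 x * x - V.M0 x * 1) / (x * x) \<le> 0" using x s by (intro divide_nonpos_pos) auto
      ultimately show "\<exists>y. ((\<lambda>x. V.M0 x / x) has_real_derivative y) (at x) \<and> y \<le> 0" by blast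
    qed
    then show ?thesis using s half by (simp add: field_simps)
  qed
  \<comment> \<open>The budget: \<open>B\<close> and r^m are each at most exp (\<epsilon> e) with e
    = s^n, and exp (2 \<epsilon> e) \<le> 1 + 4 \<epsilon> e = 1 + e / (2 (n + 1)), which is half of
    the room.\<close>
  define \<epsilon> where "\<epsilon> = 1 / (8 * (real n + 1))"
  have \<epsilon>: "\<epsilon> > 0" by (simp add: \<epsilon>_def)
  \<comment> \<open>Large enough for m c \<le> \<epsilon>, where c is the constant in the error
    estimate for \<open>kz\<close>.\<close>
  obtain j :: nat where j: "2 * C * real m / \<epsilon> \<le> real j" using real_arch_simple by blast
  define c where "c = 2 * C / (real j + 1)"
  have c: "c \<ge> 0" "real m * c \<le> \<epsilon>"
  proof -
    show "c \<ge> 0" using C by (simp add: c_def)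
    have "2 * C * real m \<le> \<epsilon> * (real j + 1)" using j \<epsilon> by (simp add: field_simps)
    then show "real m * c \<le> \<epsilon>" by (simp add: c_def field_simps)
  qed
  \<comment> \<open>The quotient is invariant under s -> 1/s, so one function serves both charts,
    and it is comparable with s^n for s \<le> 1.\<close>
  define B where "B = (\<lambda>s::real. 1 + \<epsilon> * (s ^ n / (1 + s ^ n * s ^ n)))"
  \<comment> \<open>The pinching condition reduced by symmetry to s \<le> 1; r stands for
    \<open>kz\<close> divided by min(1, 2(1-x)).\<close>
  have ratio: "1 < B s * r ^ m \<and> B s * r ^ m < V.M0 s / (s * V.k0 s)"
    if s: "0 < s" "s \<le> 1" and r: "1 \<le> r" "r \<le> 1 + c * s ^ n" for s r
  proof
    define e where "e = s ^ n"
    have e: "0 < e" "e \<le> 1" using s by (auto simp: e_def power_le_one)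
    have "e / (1 + e * e) > 0" using e by (intro divide_pos_pos add_pos_pos) auto
    from mult_pos_pos[OF \<epsilon> this] have B1: "B s > 1" unfolding B_def e_def by linarith
    have "1 < B s * 1" using B1 by simp
    also have "\<dots> \<le> B s * r ^ m" using B1 r by (intro mult_left_mono one_le_power) auto
    finally show "1 < B s * r ^ m" .
    have "e / (1 + e * e) \<le> e / 1" using e by (intro divide_left_mono) (auto intro: add_pos_pos)
    then have "e / (1 + e * e) \<le> e" by simp
    then have "B s \<le> 1 + \<epsilon> * e" unfolding B_def e_def[symmetric] using \<epsilon> by (intro add_left_mono mult_left_mono) auto
    also have "\<dots> \<le> exp (\<epsilon> * e)" by (rule exp_ge_add_one_self)
    finally have B2: "B s \<le> exp (\<epsilon> * e)" .
    have "r \<le> exp (c * e)" using r(2) exp_ge_add_one_self[of "c * e"] unfolding e_def by linarith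
    then have "r ^ m \<le> exp (c * e) ^ m" using r by (intro power_mono) auto
    also have "\<dots> = exp (real m * (c * e))" by (rule exp_of_nat_mult[symmetric])
    also have "\<dots> \<le> exp (\<epsilon> * e)" using mult_right_mono[OF c(2), of e] e by (simp add: mult.assoc)
    finally have "B s * r ^ m \<le> exp (\<epsilon> * e) * exp (\<epsilon> * e)" using B2 r B1 by (intro mult_mono) auto
    also have "\<dots> = exp (2 * \<epsilon> * e)" by (simp flip: exp_add)
    also have "\<dots> \<le> 1 + 2 * (2 * \<epsilon> * e)"
    proof -
      have "real n + 1 \<ge> 1" by simp
      then have "\<epsilon> \<le> 1 / 8" unfolding \<epsilon>_def by (simp add: field_simps)
      then have "\<epsilon> * e \<le> (1 / 8) * 1" using e \<epsilon> by (intro mult_mono) auto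
      then have b: "0 \<le> 2 * \<epsilon> * e" "2 * \<epsilon> * e \<le> 1/2" using \<epsilon> e by simp_all
      have "exp (2 * \<epsilon> * e) \<le> 1 + 2 * \<epsilon> * e + (2 * \<epsilon> * e)\<^sup>2" using b by (intro exp_bound) auto
      also have "(2 * \<epsilon> * e)\<^sup>2 \<le> 2 * \<epsilon> * e" using b unfolding power2_eq_square by (intro mult_left_le) auto
      finally show ?thesis by simp
    qed
    also have "\<dots> = 1 + e / (real n + 1) / 2"
    proof -
      have "2 * (2 * (1 / (8 * d)) * e) = e / d / 2" for d by simp
      then show ?thesis unfolding \<epsilon>_def by (simp only:)
    qed
    also have "\<dots> < 1 + e / (real n + 1)" proof -
      have "1 + x / 2 < 1 + x" if "0 < x" for x :: real using that by simp
      moreover have "0 < e / (real n + 1)" using e by (intro divide_pos_pos) auto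
      ultimately show ?thesis by blast
    qed
    also have "\<dots> \<le> V.M0 s / (s * V.k0 s)"
    proof -
      have sk: "0 < s * V.k0 s" using s V.k_pos(1)[of s] by simp
      have "(1 + e / (real n + 1)) * (s * V.k0 s) \<le> V.M0 s"
        using lower[OF less_imp_le[OF s(1)] s(2)] unfolding e_def by (simp only: mult.commute)
      then show ?thesis unfolding pos_le_divide_eq[OF sk] .
    qed
    finally show "B s * r ^ m < V.M0 s / (s * V.k0 s)" .
  qed
  \<comment> \<open>In s^N = s^n s^j the first factor is the order of the available room, and the
    second makes the error small through (1 - s) s^j \<le> 1 / (j + 1).\<close>
  define N where "N = n + j"
  \<comment> \<open>The quotient M0(s)/s in a form that is smooth in z at the origin.\<close>
  define mean where "mean = (\<lambda>z. integral {0..1} (\<lambda>t. 1 * (pi * \<rho> (sqrt t *\<^sub>R z))))"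
  have sm: "smooth mean" unfolding mean_def
    by (rule smooth_radial_integral[where g = "\<lambda>z. pi * \<rho> z"]) (auto intro!: continuous_intros smooth_mult smooth_const \<rho>)
  have rpi: "radial (\<lambda>z. pi * \<rho> z)" by (simp add: radial_def \<rho>_def)
  have mean_M: "(cmod z)\<^sup>2 * mean z = V.M0 ((cmod z)\<^sup>2)" for z
    unfolding mean_def radial_integral_profile[OF rpi] V.M0_def prim_def V.k0_def[abs_def] by (simp add: \<omega>_def)
  have mean_pos: "mean z > 0" for z
  proof (cases "z = 0")
    case True
    then show ?thesis using \<rho>(2) by (simp add: mean_def)
  next
    case False
    then have "(cmod z)\<^sup>2 > 0" by simp
    then have "0 < (cmod z)\<^sup>2 * mean z" unfolding mean_M by (rule Mpos)
    then show ?thesis by (rule zero_less_mult_pos) fact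
  qed
  define kz where "kz = (\<lambda>z. (1 + 2 * (1 - (cmod z)\<^sup>2 * mean z) * ((cmod z)\<^sup>2) ^ Suc N) / (1 + ((cmod z)\<^sup>2) ^ Suc N))"
  \<comment> \<open>This is \<open>kz\<close> in the w-chart, rescaled as a metric on O(1). Since 1
    - x is |w|^2 \<open>mean\<close> w there, a factor |w|^2 can be divided out of the
    numerator.\<close>
  define kw where "kw = (\<lambda>z. (((cmod z)\<^sup>2) ^ N + 2 * mean z) / (1 + ((cmod z)\<^sup>2) ^ Suc N))"
  define h where "h = (\<lambda>z. B ((cmod z)\<^sup>2) * kz z ^ m, \<lambda>z. B ((cmod z)\<^sup>2) * kw z ^ m)"
  have dpos: "1 + ((cmod z)\<^sup>2) ^ i > 0" for z i by (intro add_pos_nonneg) auto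
  have dne: "1 + ((cmod z)\<^sup>2) ^ i \<noteq> 0" for z i using dpos[of z i] by simp
  have d2: "1 + s ^ n * s ^ n > 0" for s :: real by (intro add_pos_nonneg) auto
  have d2': "1 + s ^ n * s ^ n \<noteq> 0" for s :: real using d2[of s] by simp
  have sB: "smooth (\<lambda>z. B ((cmod z)\<^sup>2))" unfolding B_def
    by (intro smooth_add smooth_const smooth_mult smooth_divide smooth_power smooth_norm_sq d2')
  have skz: "smooth kz" unfolding kz_def diff_conv_add_uminus
    by (intro smooth_divide dne smooth_add smooth_const smooth_mult smooth_power smooth_norm_sq smooth_minus sm)
  have skw: "smooth kw" unfolding kw_def
    by (intro smooth_divide dne smooth_add smooth_const smooth_mult smooth_power smooth_norm_sq sm)
  have M_lt: "(cmod z)\<^sup>2 * mean z < 1" for z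
    unfolding mean_M using V.M0_range[of "(cmod z)\<^sup>2"] V.M_at_0 by (cases "z = 0") auto
  have kz_pos: "kz z > 0" for z unfolding kz_def using M_lt[of z]
    by (intro divide_pos_pos dpos add_pos_nonneg mult_nonneg_nonneg) auto
  have kw_pos: "kw z > 0" for z unfolding kw_def using mean_pos[of z]
    by (intro divide_pos_pos dpos add_nonneg_pos) auto
  have B_pos: "B ((cmod z)\<^sup>2) > 0" for z unfolding B_def using \<epsilon> d2[of "(cmod z)\<^sup>2"]
    by (intro add_pos_nonneg mult_nonneg_nonneg divide_nonneg_pos) auto
  have B_inv: "B (1 / s) = B s" if "s > 0" for s
  proof -
    define p where "p = s ^ n"
    have p: "p \<noteq> 0" "(1 / s) ^ n = 1 / p" using that by (simp_all add: p_def power_divide)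
    have "(1 / p) / (1 + (1 / p) * (1 / p)) = ((1 / p) * (p * p)) / ((1 + (1 / p) * (1 / p)) * (p * p))"
      by (rule mult_divide_mult_cancel_right[symmetric]) (use p in simp)
    also have "(1 / p) * (p * p) = p" using p by simp
    also have "(1 + (1 / p) * (1 / p)) * (p * p) = 1 + p * p" using p by (simp add: distrib_right add.commute)
    finally have "(1 / s) ^ n / (1 + (1 / s) ^ n * (1 / s) ^ n) = s ^ n / (1 + s ^ n * s ^ n)"
      unfolding p(2) by (simp only: p_def)
    then show ?thesis unfolding B_def by (simp only:)
  qed
  have kzw: "kw (1 / z) = (cmod z)\<^sup>2 * kz z" if z: "z \<noteq> 0" for z
  proof -
    define s where "s = (cmod z)\<^sup>2"
    have s: "s > 0" using z by (simp add: s_def)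
    have ps: "(1 / s) ^ N * s ^ Suc N = s" "(1 / s) ^ Suc N * s ^ Suc N = 1" using s by (simp_all add: power_divide)
    have "mean (1 / z) / s = V.M0 (1 / s)" using mean_M[of "1 / z"] by (simp add: s_def norm_divide power_divide)
    also have "\<dots> = 1 - s * mean z" using sym(1)[OF s] mean_M[of z] by (simp add: s_def)
    finally have m1: "mean (1 / z) = s * (1 - s * mean z)" using s by (simp add: divide_eq_eq mult.commute)
    have "kw (1 / z) = ((1 / s) ^ N + 2 * (s * (1 - s * mean z))) / (1 + (1 / s) ^ Suc N)"
      unfolding kw_def m1 by (simp add: s_def norm_divide power_divide)
    also have "\<dots> = (((1 / s) ^ N + 2 * (s * (1 - s * mean z))) * s ^ Suc N) / ((1 + (1 / s) ^ Suc N) * s ^ Suc N)"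
      by (rule mult_divide_mult_cancel_right[symmetric]) (use s in simp)
    also have "((1 / s) ^ N + 2 * (s * (1 - s * mean z))) * s ^ Suc N = s * (1 + 2 * (1 - s * mean z) * s ^ Suc N)"
      unfolding distrib_right ps by (simp add: algebra_simps)
    also have "(1 + (1 / s) ^ Suc N) * s ^ Suc N = 1 + s ^ Suc N"
      unfolding distrib_right ps by simp
    finally show ?thesis by (simp add: kz_def s_def)
  qed
  have herm: "hermitian_metric m h"
  proof -
    have match: "snd h (1 / z) = cmod z ^ (2 * m) * fst h z" if z: "z \<noteq> 0" for z
    proof -
      have BB: "B ((cmod (1 / z))\<^sup>2) = B ((cmod z)\<^sup>2)"
        using B_inv[of "(cmod z)\<^sup>2"] z by (simp add: norm_divide power_divide)
      show ?thesis unfolding h_def fst_conv snd_conv kzw[OF z] BB power_mult_distrib power_mult by (simp only: ac_simps)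
    qed
    have "smooth (fst h)" "smooth (snd h)" unfolding h_def fst_conv snd_conv
      by (intro smooth_mult smooth_power sB skz skw)+
    moreover have "fst h z > 0" "snd h z > 0" for z unfolding h_def fst_conv snd_conv
      by (intro mult_pos_pos zero_less_power B_pos kz_pos kw_pos)+
    ultimately show ?thesis unfolding hermitian_metric_def using match by blast
  qed
  have mean_radial: "mean (complex_of_real (cmod z)) = mean z" for z
    unfolding mean_def radial_integral_profile[OF rpi] by simp
  have inv: "S1_invariant h"
    unfolding S1_invariant_radial radial_def by (simp add: h_def kz_def mean_radial)
  have prof: "profile (fst h) s = B s * ((1 + 2 * (1 - V.M0 s) * s ^ Suc N) / (1 + s ^ Suc N)) ^ m" if "s > 0" for s
    using that mean_M[of "complex_of_real (sqrt s)"] by (simp add: profile_def h_def kz_def)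
  have tail: "(1 - 2 * V.M0 s) * s ^ N \<le> c * s ^ n" if s: "0 < s" "s \<le> 1" for s
  proof -
    have "V.M0 1 - V.M0 s \<le> C * (1 - s)" using slope[of s 1] s by simp
    then have "1 - 2 * V.M0 s \<le> 2 * (C * (1 - s))" unfolding half by linarith
    then have "1 - 2 * V.M0 s \<le> 2 * C * (1 - s)" by (simp only: mult.assoc)
    then have "(1 - 2 * V.M0 s) * s ^ N \<le> (2 * C * (1 - s)) * s ^ N" using s by (intro mult_right_mono) auto
    also have "\<dots> = 2 * C * s ^ n * ((1 - s) * s ^ j)" by (simp add: N_def power_add ac_simps)
    also have "\<dots> \<le> 2 * C * s ^ n * (1 / (real j + 1))" using s C by (intro mult_left_mono power_tail_bound) auto
    finally show ?thesis by (simp add: c_def)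
  qed
  have M_half: "V.M0 s \<le> 1/2" if "0 < s" "s \<le> 1" for s
    using V.M_mono(1)[of s 1] half that by (cases "s = 1") auto
  have "pinched m \<omega> h" unfolding V.pinched_iff
  proof (intro allI impI)
    fix s :: real assume s: "0 < s"
    show "1 < profile (fst h) s / min 1 (2 * (1 - V.M0 s)) ^ m \<and>
      profile (fst h) s / min 1 (2 * (1 - V.M0 s)) ^ m < min (V.M0 s) (1 - V.M0 s) / (s * V.k0 s)"
    proof (cases "s \<le> 1")
      case True
      have M: "V.M0 s \<le> 1/2" by (rule M_half[OF s True])
      define r where "r = (1 + 2 * (1 - V.M0 s) * s ^ Suc N) / (1 + s ^ Suc N)"
      have D: "1 + s ^ Suc N > 0" using s by (intro add_pos_nonneg) auto
      have r: "r = 1 + (1 - 2 * V.M0 s) * s ^ Suc N / (1 + s ^ Suc N)"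
      proof -
        have "(1 + 2 * (1 - M) * q) / (1 + q) = 1 + (1 - 2 * M) * q / (1 + q)" if q: "1 + q > 0" for M q :: real
        proof -
          have "1 + (1 - 2 * M) * q / (1 + q) = ((1 + q) + (1 - 2 * M) * q) / (1 + q)"
            unfolding add_divide_distrib[of "1 + q"] using q by simp
          also have "(1 + q) + (1 - 2 * M) * q = 1 + 2 * (1 - M) * q" by (simp add: algebra_simps)
          finally show ?thesis by simp
        qed
        from this[OF D] show ?thesis unfolding r_def .
      qed
      have "0 \<le> (1 - 2 * V.M0 s) * s ^ Suc N / (1 + s ^ Suc N)" using D M s by (intro divide_nonneg_pos mult_nonneg_nonneg) auto
      moreover have "(1 - 2 * V.M0 s) * s ^ Suc N / (1 + s ^ Suc N) \<le> (1 - 2 * V.M0 s) * s ^ N"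
      proof -
        have "(1 - 2 * V.M0 s) * s ^ Suc N / (1 + s ^ Suc N) \<le> (1 - 2 * V.M0 s) * s ^ Suc N / 1"
          using D M s by (intro divide_left_mono mult_nonneg_nonneg) auto
        also have "\<dots> \<le> (1 - 2 * V.M0 s) * s ^ N"
          unfolding div_by_1 using M s True by (intro mult_left_mono power_decreasing) auto
        finally show ?thesis .
      qed
      ultimately have "1 \<le> r" "r \<le> 1 + c * s ^ n" unfolding r using tail[OF s True] by linarith+
      note R = ratio[OF s True this]
      have mm: "min 1 (2 * (1 - V.M0 s)) = 1" "min (V.M0 s) (1 - V.M0 s) = V.M0 s" using M by auto
      show ?thesis unfolding prof[OF s] r_def[symmetric] mm power_one div_by_1 by (rule R)
    next
      case False
      define t where "t = 1 / s"
      have t: "0 < t" "t \<le> 1" and st: "s = 1 / t" using False s by (auto simp: t_def)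
      have M: "V.M0 t \<le> 1/2" "V.M0 t > 0" by (rule M_half[OF t], rule Mpos[OF t(1)])
      have Ms: "V.M0 s = 1 - V.M0 t" "s * V.k0 s = t * V.k0 t" unfolding st by (rule sym(1)[OF t(1)], rule sym(2)[OF t(1)])
      \<comment> \<open>In the outer disc the minimum is 2 (1 - x) = 2 M0(t), and r is the quotient
        of \<open>kz\<close> by it, rewritten in t = 1/s.\<close>
      define r where "r = (t ^ Suc N / (2 * V.M0 t) + 1) / (1 + t ^ Suc N)"
      have D: "1 + t ^ Suc N > 0" using t by (intro add_pos_nonneg) auto
      have rr: "(1 + 2 * (1 - V.M0 s) * s ^ Suc N) / (1 + s ^ Suc N) = r * (2 * V.M0 t)"
      proof -
        have ps: "s ^ Suc N * t ^ Suc N = 1" unfolding st using t by (simp add: power_divide)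
        have "(1 + 2 * (1 - V.M0 s) * s ^ Suc N) * t ^ Suc N = t ^ Suc N + 2 * (1 - V.M0 s) * (s ^ Suc N * t ^ Suc N)"
          by (simp only: distrib_right mult_1 mult.assoc)
        then have num: "(1 + 2 * (1 - V.M0 s) * s ^ Suc N) * t ^ Suc N = t ^ Suc N + 2 * V.M0 t" unfolding ps Ms(1) by simp
        have den: "(1 + s ^ Suc N) * t ^ Suc N = 1 + t ^ Suc N" unfolding distrib_right ps by simp
        have "(1 + 2 * (1 - V.M0 s) * s ^ Suc N) / (1 + s ^ Suc N)
          = ((1 + 2 * (1 - V.M0 s) * s ^ Suc N) * t ^ Suc N) / ((1 + s ^ Suc N) * t ^ Suc N)"
          by (rule mult_divide_mult_cancel_right[symmetric]) (use t in simp)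
        also have "\<dots> = (t ^ Suc N + 2 * V.M0 t) / (1 + t ^ Suc N)" unfolding num den ..
        also have "t ^ Suc N + 2 * V.M0 t = (t ^ Suc N / (2 * V.M0 t) + 1) * (2 * V.M0 t)"
          unfolding distrib_right using M by simp
        also have "\<dots> / (1 + t ^ Suc N) = r * (2 * V.M0 t)" unfolding r_def by (simp only: times_divide_eq_left)
        finally show ?thesis .
      qed
      have r: "r = 1 + (1 - 2 * V.M0 t) * t ^ Suc N / (2 * V.M0 t) / (1 + t ^ Suc N)"
      proof -
        have "(q / (2 * M) + 1) / (1 + q) = 1 + (1 - 2 * M) * q / (2 * M) / (1 + q)" if q: "1 + q > 0" "M > 0" for M q :: real
        proof -
          have "(1 - 2 * M) * q / (2 * M) = q / (2 * M) - q" using q by (simp add: left_diff_distrib diff_divide_distrib)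
          then have "q / (2 * M) + 1 = (1 + q) + (1 - 2 * M) * q / (2 * M)" by simp
          then have "(q / (2 * M) + 1) / (1 + q) = (1 + q) / (1 + q) + (1 - 2 * M) * q / (2 * M) / (1 + q)"
            by (simp only: add_divide_distrib)
          then show ?thesis using q by simp
        qed
        from this[OF D M(2)] show ?thesis unfolding r_def .
      qed
      have nn: "0 \<le> (1 - 2 * V.M0 t) * t ^ Suc N / (2 * V.M0 t)" using M t by (intro divide_nonneg_pos mult_nonneg_nonneg) auto
      then have "0 \<le> (1 - 2 * V.M0 t) * t ^ Suc N / (2 * V.M0 t) / (1 + t ^ Suc N)" by (rule divide_nonneg_pos[OF _ D])
      moreover have "(1 - 2 * V.M0 t) * t ^ Suc N / (2 * V.M0 t) / (1 + t ^ Suc N) \<le> (1 - 2 * V.M0 t) * t ^ N"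
      proof -
        have "(1 - 2 * V.M0 t) * t ^ Suc N / (2 * V.M0 t) / (1 + t ^ Suc N) \<le> (1 - 2 * V.M0 t) * t ^ Suc N / (2 * V.M0 t) / 1"
          by (rule divide_left_mono[OF _ nn]) (use D t in auto)
        also have "\<dots> \<le> (1 - 2 * V.M0 t) * t ^ Suc N / t"
          unfolding div_by_1 using chord[OF t] M t by (intro divide_left_mono mult_nonneg_nonneg mult_pos_pos) auto
        also have "\<dots> = (1 - 2 * V.M0 t) * t ^ N" using t by simp
        finally show ?thesis .
      qed
      ultimately have "1 \<le> r" "r \<le> 1 + c * t ^ n" unfolding r using tail[OF t] by linarith+
      note R = ratio[OF t this]
      have "profile (fst h) s / min 1 (2 * (1 - V.M0 s)) ^ m = B t * r ^ m"
      proof -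
        have mm: "min 1 (2 * (1 - V.M0 s)) = 2 * V.M0 t" unfolding Ms(1) using M by auto
        have "B s = B t" unfolding st by (rule B_inv[OF t(1)])
        then show ?thesis unfolding prof[OF s] rr mm power_mult_distrib using M(2) by simp
      qed
      moreover have "min (V.M0 s) (1 - V.M0 s) = V.M0 t" unfolding Ms(1) using M by auto
      ultimately show ?thesis using R by (simp only: Ms(2) HOL.simp_thms)
    qed
  qed
  then have "(\<omega>, h) \<in> admissible_pairs m"
    using V.vol V.inv V.mass herm inv by (simp add: admissible_pairs_def)
  moreover have "min (V.M0 s) (1 - V.M0 s) \<le> \<kappa> * (s * V.k0 s)" if s: "s > 0" for s
  proof (cases "s \<le> 1")
    case True
    then show ?thesis using upper[OF s True] by (simp add: min_le_iff_disj)
  next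
    case False
    then have "V.M0 (1 / s) \<le> \<kappa> * ((1 / s) * V.k0 (1 / s))" using s by (intro upper) auto
    then show ?thesis unfolding sym[OF s] by (simp add: min_le_iff_disj)
  qed
  ultimately show ?thesis using that unfolding \<kappa>_def by blast
qed

section \<open>The bounds and their optimality\<close>

lemma admissible_invariant_pair:
  assumes "volume_form \<omega> \<and> S1_invariant \<omega> \<and> total_mass \<omega> = 1 \<and> hermitian_metric m h \<and> S1_invariant h"
  shows "invariant_pair m \<omega> h"
  using assms by unfold_locales auto

theorem theorem1p2:
  fixes m :: nat
  shows "increasing_listing (\<lambda>i. xi m (Suc i)) (xi_zeros m) \<and>
    (\<forall>\<omega> h. volume_form \<omega> \<and> S1_invariant \<omega> \<and> total_mass \<omega> = 1 \<and>
       hermitian_metric m h \<and> S1_invariant h \<and> pinched m \<omega> h \<longrightarrow>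
         increasing_listing (invariant_eigenvalue m \<omega> h) (invariant_spectrum m \<omega> h) \<and>
         invariant_eigenvalue m \<omega> h 0 = 0 \<and>
         (\<forall>j\<ge>1. invariant_eigenvalue m \<omega> h j < (xi m j)\<^sup>2 / 2)) \<and>
    (\<forall>j\<ge>1. (SUP (\<omega>, h) \<in> admissible_pairs m. ereal (invariant_eigenvalue m \<omega> h j))
       = ereal ((xi m j)\<^sup>2 / 2))"
proof (intro conjI allI impI)
  interpret Y: bessel_limit m 1 by unfold_locales simp
  obtain c where c: "increasing_listing c {l. Y.disc l = 0}" "c 0 = 0"
    "\<And>j. c j \<ge> 0" "\<And>j. Y.total_angle (c j) = real j * pi" using Y.listing by blast
  show "increasing_listing (\<lambda>i. xi m (Suc i)) (xi_zeros m)" by (rule xi_listing(1)[OF c(1,2)])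
next
  fix \<omega> h assume A: "volume_form \<omega> \<and> S1_invariant \<omega> \<and> total_mass \<omega> = 1 \<and>
       hermitian_metric m h \<and> S1_invariant h \<and> pinched m \<omega> h"
  then interpret invariant_pair m \<omega> h by (intro admissible_invariant_pair) auto
  have p: "pinched m \<omega> h" using A by blast
  show "increasing_listing (invariant_eigenvalue m \<omega> h) (invariant_spectrum m \<omega> h)"
    "invariant_eigenvalue m \<omega> h 0 = 0" by (rule eigenvalue_bounds(1)[OF p], rule eigenvalue_bounds(2)[OF p])
  show "invariant_eigenvalue m \<omega> h j < (xi m j)\<^sup>2 / 2" if "1 \<le> j" for j by (rule eigenvalue_bounds(3)[OF p that])
next
  fix j :: nat assume j: "1 \<le> j"
  define S where "S = (SUP (\<omega>, h) \<in> admissible_pairs m. ereal (invariant_eigenvalue m \<omega> h j))"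
  have "S \<le> ereal ((xi m j)\<^sup>2 / 2)" unfolding S_def
  proof (rule SUP_least, clarify)
    fix \<omega> h assume "(\<omega>, h) \<in> admissible_pairs m"
    then have A: "volume_form \<omega> \<and> S1_invariant \<omega> \<and> total_mass \<omega> = 1 \<and> hermitian_metric m h \<and> S1_invariant h"
      and p: "pinched m \<omega> h" by (auto simp: admissible_pairs_def)
    interpret invariant_pair m \<omega> h by (rule admissible_invariant_pair[OF A])
    show "ereal (invariant_eigenvalue m \<omega> h j) \<le> ereal ((xi m j)\<^sup>2 / 2)"
      using eigenvalue_bounds(3)[OF p j] by simp
  qed
  moreover have "ereal ((xi m j)\<^sup>2 / 2) \<le> S"
  proof (rule LIMSEQ_le_const2)
    \<comment> \<open>The distortion of the n-th pair is \<rho> = 2^(2/n), which tends to 1. The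
      lower bound is available for n \<ge> 1, which is all the limit sees.\<close>
    show "(\<lambda>n. ereal ((xi m j)\<^sup>2 / 2 / (exp (2 / real n * ln 2))\<^sup>2)) \<longlonglongrightarrow> ereal ((xi m j)\<^sup>2 / 2)"
    proof -
      have "(\<lambda>n. (xi m j)\<^sup>2 / 2 / (exp (2 / real n * ln 2))\<^sup>2) \<longlonglongrightarrow> (xi m j)\<^sup>2 / 2 / (exp (0 * ln 2))\<^sup>2"
        by (intro tendsto_intros lim_const_over_n) auto
      then show ?thesis by simp
    qed
    have "ereal ((xi m j)\<^sup>2 / 2 / (exp (2 / real n * ln 2))\<^sup>2) \<le> S" if n: "n \<ge> 1" for n
    proof -
      obtain \<omega> h where oh: "(\<omega>, h) \<in> admissible_pairs m"
        "\<And>s. s > 0 \<Longrightarrow> min (invariant_volume.M0 \<omega> s) (1 - invariant_volume.M0 \<omega> s)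
            \<le> exp (2 / real n * ln 2) * (s * invariant_volume.k0 \<omega> s)"
        using near_extremal_pair[OF n, of m] by blast
      then have A: "volume_form \<omega> \<and> S1_invariant \<omega> \<and> total_mass \<omega> = 1 \<and> hermitian_metric m h \<and> S1_invariant h"
        and p: "pinched m \<omega> h" by (auto simp: admissible_pairs_def)
      interpret invariant_pair m \<omega> h by (rule admissible_invariant_pair[OF A])
      have "ereal ((xi m j)\<^sup>2 / 2 / (exp (2 / real n * ln 2))\<^sup>2) \<le> ereal (invariant_eigenvalue m \<omega> h j)"
        using eigenvalue_bounds(4)[OF p j oh(2)] by simp
      also have "\<dots> \<le> S" unfolding S_def using SUP_upper[OF oh(1), of "\<lambda>(\<omega>, h). ereal (invariant_eigenvalue m \<omega> h j)"] by simp
      finally show ?thesis .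
    qed
    then show "\<exists>N. \<forall>n\<ge>N. ereal ((xi m j)\<^sup>2 / 2 / (exp (2 / real n * ln 2))\<^sup>2) \<le> S" by blast
  qed
  ultimately show "S = ereal ((xi m j)\<^sup>2 / 2)" by (rule order_antisym)
qed

end
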